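(* Let $h\colon\mathbf{R}_{>0}^n\times\mathbf{R}^n\times\mathbf{R}_{\ge0}^k\to\mathbf{R}$ be a length-type function. There exists $\lambda\in(0,1)$ such that for all polynomial functions $f_1,\dots,f_{2n+k}$ (of one variable) of degrees $K_1,\dots,K_{2n+k}$ respectively, the $(h,\mathbf{1}_{\mathbf{R}_{>0}^n\times\mathbf{R}^n\times\mathbf{R}_{\ge0}^k})$-convolution of $f_1,\dots,f_{2n+k}$ satisfies $$f_1\star\cdots\star f_{2n+k}\Big|^{h}_{\mathbf{1}_{\mathbf{R}_{>0}^n\times\mathbf{R}^n\times\mathbf{R}_{\ge0}^k}}\in\mathcal{SF}_w^{K_1+\cdots+K_{2n+k}+2n+k-1}(\lambda).$$
   Context: Length-type function: $h\colon\mathbf{R}_{>0}^n\times\mathbf{R}^n\times\mathbf{R}_{\ge0}^k\to\mathbf{R}_{\ge0}$ is length-type if it is proper and $$\cosh\Big(\frac{h(\mathbf{x}_n,\mathbf{t}_n,\mathbf{y}_k)}{2}\Big)=\frac1{\prod_{j=1}^n\sinh(\frac{x_j}{2})^{d_j}}\sum_{i=1}^p\sqrt{\sum_{T\in G_i}a_T^i e^{T(\mathbf{x}_n,\mathbf{t}_n,\mathbf{y}_k)}},$$ where $d_1,\dots,d_n\in\mathbf{N}_{\ge1}$, $G_1,\dots,G_p$ are finite sets of linear forms on $\mathbf{R}^{2n+k}$, and all $a_T^i>0$. Pseudo-convolution: for $\varphi\colon\mathbf{R}^d\to\mathbf{R}$ measurable and locally bounded, $h$ measurable on the support of $\varphi$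 with $h^{-1}(K)\cap\{\varphi\ne0\}$ of finite measure for every compact $K\subset\mathbf{R}$, and $f_1,\dots,f_d\in L^1_{loc}(\mathbf{R})$, the $(h,\varphi)$-convolution of $f_1,\dots,f_d$ is the pushforward by $h$ of the measure $\varphi(x_1,\dots,x_d)f_1(x_1)\cdots f_d(x_d)\,dx_1\cdots dx_d$; when it has a density with respect to Lebesgue measure on $\mathbf{R}$, this density is denoted $\ell\mapsto f_1\star\cdots\star f_d(\ell)\big|_\varphi^h$. The theorem asserts membership of this density in the following class. For $\mu\in(0,1)$, $\mathcal{R}_w(\mu)$ is the space of locally integrable $r\colon\mathbf{R}\to\mathbf{C}$ such that for some $c,c_1>0$: $\int_0^m|r(\ell)|\,d\ell\le c_1(1+m)^ce^{\mu m}$ for all $m\ge1$. For $m\ge0$, $\mathcal{F}_w^m(\mu)=e^\ell\mathbf{C}_{m-1}[\ell]\oplus\mathcal{R}_w(\mu)$, where $\mathbf{C}_{m-1}[\ell]$ is the space of polynomials of degree at most $m-1$, and $\mathcal{SF}_w^m(\lambda)=e^{-\ell}\mathcal{F}_w^{m+1}(1-\lambda)$. Thus $f\in\mathcal{SF}_w^m(\lambda)$ iff $f=p+r$ with $p$ a polynomial of degree at most $m$ and $e^\ell r(\ell)\in\mathcal{R}_w(1-\lambda)$. *)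

theory Defs
  imports "HOL-Analysis.Analysis" "HOL-Computational_Algebra.Polynomial"
begin

text \<open>
  A point of \<open>\<real>\<^sup>d\<close> is an element of \<open>{..<d} \<rightarrow>\<^sub>E UNIV\<close> (a function \<open>nat \<Rightarrow> real\<close> that is undefined
  from \<open>d\<close> on), with the topology \<^term>\<open>powertop_real {..<d}\<close> and the Lebesgue measure
  \<^term>\<open>PiM {..<d} (\<lambda>_. lborel)\<close>.
  This representation allows the dimension to be any natural number.
\<close>

text \<open>
  For \<open>d = 2 * n + k\<close> the coordinates are ordered as
  \<open>(x\<^sub>1, \<dots>, x\<^sub>n, t\<^sub>1, \<dots>, t\<^sub>n, y\<^sub>1, \<dots>, y\<^sub>k)\<close>, numbered from \<open>0\<close>; the set below is
  \<open>\<real>\<^sub>>\<^sub>0\<^sup>n \<times> \<real>\<^sup>n \<times> \<real>\<^sub>\<ge>\<^sub>0\<^sup>k\<close>.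
\<close>

definition length_dom :: "nat \<Rightarrow> nat \<Rightarrow> (nat \<Rightarrow> real) set" where
  "length_dom n k =
     {v \<in> {..<2 * n + k} \<rightarrow>\<^sub>E UNIV. (\<forall>j<n. 0 < v j) \<and> (\<forall>j\<in>{2 * n..<2 * n + k}. 0 \<le> v j)}"

text \<open>
  A linear form on \<open>\<real>\<^sup>d\<close> is given by its coefficient vector in \<open>{..<d} \<rightarrow>\<^sub>E UNIV\<close>; extensionality
  makes distinct vectors correspond to distinct forms.
\<close>

definition lin_form :: "nat \<Rightarrow> (nat \<Rightarrow> real) \<Rightarrow> (nat \<Rightarrow> real) \<Rightarrow> real" where
  "lin_form d T v = (\<Sum>j<d. T j * v j)"

text \<open>
  Only the values of \<open>h\<close> on \<^term>\<open>length_dom n k\<close> matter. Continuity of \<open>h\<close> there is not listed,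
  since it follows from \<open>h \<ge> 0\<close> and the formula.
\<close>

definition length_type :: "nat \<Rightarrow> nat \<Rightarrow> ((nat \<Rightarrow> real) \<Rightarrow> real) \<Rightarrow> bool" where
  "length_type n k h \<longleftrightarrow>
     (\<forall>v\<in>length_dom n k. 0 \<le> h v) \<and>
     proper_map (subtopology (powertop_real {..<2 * n + k}) (length_dom n k))
                (top_of_set {0..}) h \<and>
     (\<exists>(e :: nat \<Rightarrow> nat) (p :: nat) (G :: nat \<Rightarrow> (nat \<Rightarrow> real) set) (a :: nat \<Rightarrow> (nat \<Rightarrow> real) \<Rightarrow> real).
        (\<forall>j<n. 1 \<le> e j) \<and>
        (\<forall>i<p. finite (G i) \<and> G i \<subseteq> {..<2 * n + k} \<rightarrow>\<^sub>E UNIV) \<and>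
        (\<forall>i<p. \<forall>T\<in>G i. 0 < a i T) \<and>
        (\<forall>v\<in>length_dom n k.
           cosh (h v / 2) =
             1 / (\<Prod>j<n. sinh (v j / 2) ^ e j) *
             (\<Sum>i<p. sqrt (\<Sum>T\<in>G i. a i T * exp (lin_form (2 * n + k) T v)))))"

definition locally_integrable :: "(real \<Rightarrow> complex) \<Rightarrow> bool" where
  "locally_integrable f \<longleftrightarrow> (\<forall>K. compact K \<longrightarrow> set_integrable lebesgue K f)"

text \<open>
  \<open>g\<close> is a density, with respect to Lebesgue measure on \<open>\<real>\<close>, of the push-forward by \<open>h\<close> of
  \<open>\<phi>(x\<^sub>1, \<dots>, x\<^sub>d) f\<^sub>1(x\<^sub>1) \<cdots> f\<^sub>d(x\<^sub>d) dx\<^sub>1 \<cdots> dx\<^sub>d\<close>. This is a complex measure on bounded sets only (its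
  total variation on \<open>\<real>\<close> may be infinite), hence the restriction to bounded \<open>B\<close>. The integrability
  clause says that the push-forward is defined on \<open>B\<close>; without it the Bochner integral would
  default to \<open>0\<close>.
\<close>

definition pseudo_conv_density ::
  "nat \<Rightarrow> ((nat \<Rightarrow> real) \<Rightarrow> real) \<Rightarrow> ((nat \<Rightarrow> real) \<Rightarrow> real) \<Rightarrow> (nat \<Rightarrow> real \<Rightarrow> complex) \<Rightarrow>
   (real \<Rightarrow> complex) \<Rightarrow> bool" where
  "pseudo_conv_density d h \<phi> f g \<longleftrightarrow>
     locally_integrable g \<and>
     (\<forall>B\<in>sets borel. bounded B \<longrightarrow>
        integrable (PiM {..<d} (\<lambda>_. lborel))
          (\<lambda>v. indicat_real B (h v) *\<^sub>R (\<phi> v *\<^sub>R (\<Prod>i<d. f i (v i)))) \<and>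
        (LINT v|PiM {..<d} (\<lambda>_. lborel).
           indicat_real B (h v) *\<^sub>R (\<phi> v *\<^sub>R (\<Prod>i<d. f i (v i)))) =
        (LINT l:B|lebesgue. g l))"

definition R_w :: "real \<Rightarrow> (real \<Rightarrow> complex) set" where
  "R_w \<mu> =
     {r. locally_integrable r \<and>
         (\<exists>c>0. \<exists>c1>0. \<forall>m::real. m \<ge> 1 \<longrightarrow>
            (LINT l:{0..m}|lebesgue. cmod (r l)) \<le> c1 * (1 + m) powr c * exp (\<mu> * m))}"

text \<open>
  The condition \<open>P = 0 \<or> degree P < m\<close> says that \<open>P\<close> has degree at most \<open>m - 1\<close>; for \<open>m = 0\<close> only
  \<open>P = 0\<close> is left.
\<close>

definition F_w :: "nat \<Rightarrow> real \<Rightarrow> (real \<Rightarrow> complex) set" where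
  "F_w m \<mu> =
     {\<lambda>l. complex_of_real (exp l) * poly P (complex_of_real l) + r l | P r.
        (P = 0 \<or> degree P < m) \<and> r \<in> R_w \<mu>}"

definition SF_w :: "nat \<Rightarrow> real \<Rightarrow> (real \<Rightarrow> complex) set" where
  "SF_w m lam = (\<lambda>f l. complex_of_real (exp (- l)) * f l) ` F_w (m + 1) (1 - lam)"

end

(*
  Write L for twice the logarithm of 2 cosh (h/2), so that the defining formula of h
  computes L.  Then L is asymptotically piecewise linear, and each ratio of one of its exponential
  terms to the sum containing it is a softmax weight in [0, 1].  If a direction u satisfies T(u) = 1
  for all forms T occurring in a product of such weights, and u is tangent to the faces on which the
  product is concentrated, the derivative of L along u is 1 up to terms carrying further weights.
  Integrating by parts along u therefore writes the push-forward of the product under L as a primitive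
  of push-forwards of products whose constraints on u have larger rank.  This can happen at most
  2n + k times, each time raising the degree of the polynomial part by one; once no u exists, the
  product decays exponentially and its push-forward has an exponentially small density.  Properness
  of h gives the linear growth of L that makes all integrals finite.
*)
theory Submission
  imports Defs "HOL-Library.Function_Algebras"
begin

section \<open>The logarithmic length and its derivatives\<close>

text \<open>The rate must serve all polynomials at once. It can, because the decay of a weight
  depends only on the set of forms and the set of coordinates occurring in it, of which there are
  finitely many pairs, while polynomial factors consume an arbitrarily small part of the rate. The
  number of primitives comes from linear algebra: the weights \<open>q i * \<rho> i T\<close> sum to
  1 and each starts with one independent constraint, whereas d + 1 independent affine constraints on
  d = 2n + k unknowns contradict each other. Three obstacles shape the argument. The faces v_j = 0
  give boundary terms and poles of the derivative of L; factors 1 - exp(- v_j) kill both, and the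
  correction terms contain exp(- v_j), a new constraint. The cutoff L \<le> b is not differentiable,
  so the identity is proved for the squared positive part of b - L and differentiated in b. Finally
  a density has to exist at all: L is convex in its first coordinate and, by linear growth, has
  countably many critical points there, so preimages of null sets are null.\<close>

locale length_form =
  fixes n k :: nat and I :: "nat set" and G :: "nat \<Rightarrow> (nat \<Rightarrow> real) set"
    and a :: "nat \<Rightarrow> (nat \<Rightarrow> real) \<Rightarrow> real" and e :: "nat \<Rightarrow> nat"
  assumes dim_pos: "0 < 2 * n + k"
    and fin_I: "finite I" and I_ne: "I \<noteq> {}"
    and fin_G: "\<And>i. i \<in> I \<Longrightarrow> finite (G i)" and G_ne: "\<And>i. i \<in> I \<Longrightarrow> G i \<noteq> {}"
    and a_pos: "\<And>i T. i \<in> I \<Longrightarrow> T \<in> G i \<Longrightarrow> 0 < a i T"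
    and e_pos: "\<And>j. j < n \<Longrightarrow> 1 \<le> e j"
begin

abbreviation "d \<equiv> 2 * n + k"
abbreviation "D \<equiv> length_dom n k"
abbreviation "M \<equiv> PiM {..<d} (\<lambda>_. lborel :: real measure)"

text \<open>Only the x-coordinates are kept positive: \<open>L\<close> is singular on their faces
  but extends smoothly across the faces of the y-coordinates, so two-sided partial derivatives exist
  at every point of the length domain.\<close>

definition "Dx = {v :: nat \<Rightarrow> real. \<forall>j<n. 0 < v j}"

definition "S i v = (\<Sum>T\<in>G i. a i T * exp (lin_form d T v))"
definition "Z v = (\<Sum>i\<in>I. sqrt (S i v))"
definition "\<rho> i T v = a i T * exp (lin_form d T v) / S i v"
definition "q i v = sqrt (S i v) / Z v"

definition L :: "(nat \<Rightarrow> real) \<Rightarrow> real" where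
  "L v = 2 * ln 2 + 2 * ln (Z v) - 2 * (\<Sum>j<n. e j * ln (sinh (v j / 2)))"

text \<open>\<open>\<mu> r i\<close> is the logarithmic derivative of \<open>S i\<close> in
  coordinate \<open>r\<close>, and \<open>\<nu> r\<close> is that of the square of \<open>Z\<close>.
  Both are averages of coefficients of forms, hence bounded.\<close>

definition "\<mu> r i v = (\<Sum>T\<in>G i. \<rho> i T v * T r)"
definition "\<nu> r v = (\<Sum>i\<in>I. q i v * \<mu> r i v)"
definition "dL r v = \<nu> r v - (if r < n then e r * (cosh (v r / 2) / sinh (v r / 2)) else 0)"

definition pd :: "nat \<Rightarrow> ((nat \<Rightarrow> real) \<Rightarrow> real) \<Rightarrow> ((nat \<Rightarrow> real) \<Rightarrow> real) \<Rightarrow> bool" where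
  "pd r w w' \<longleftrightarrow> (\<forall>v\<in>Dx. ((\<lambda>x. w (v(r := x))) has_real_derivative w' v) (at (v r)))"

lemma D_subset: "D \<subseteq> Dx"
  by (auto simp: length_dom_def Dx_def)

section \<open>Positivity and normalization of the weights\<close>

lemma S_pos: "i \<in> I \<Longrightarrow> 0 < S i v"
  unfolding S_def using fin_G G_ne a_pos by (intro sum_pos) auto

lemma Z_pos: "0 < Z v"
  unfolding Z_def using fin_I I_ne S_pos by (intro sum_pos) auto

lemma \<rho>_pos: "i \<in> I \<Longrightarrow> T \<in> G i \<Longrightarrow> 0 < \<rho> i T v"
  unfolding \<rho>_def using S_pos a_pos by auto

lemma q_pos: "i \<in> I \<Longrightarrow> 0 < q i v"
  unfolding q_def using S_pos Z_pos by auto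

lemma sum_\<rho>: "i \<in> I \<Longrightarrow> (\<Sum>T\<in>G i. \<rho> i T v) = 1"
  using S_pos[of i v] by (simp add: \<rho>_def flip: sum_divide_distrib S_def)

lemma sum_q: "(\<Sum>i\<in>I. q i v) = 1"
  using Z_pos[of v] by (simp add: q_def flip: sum_divide_distrib Z_def)

lemma \<rho>_le1: "i \<in> I \<Longrightarrow> T \<in> G i \<Longrightarrow> \<rho> i T v \<le> 1"
  using sum_\<rho>[of i v] member_le_sum[of T "G i" "\<lambda>T. \<rho> i T v"] fin_G \<rho>_pos
  by (simp add: less_imp_le)

lemma q_le1: "i \<in> I \<Longrightarrow> q i v \<le> 1"
  using sum_q[of v] member_le_sum[of i I "\<lambda>i. q i v"] fin_I q_pos
  by (simp add: less_imp_le)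

section \<open>Partial derivatives of the weights and of \<open>L\<close>\<close>

lemma pdI: "(\<And>v. v \<in> Dx \<Longrightarrow> ((\<lambda>x. w (v(r := x))) has_real_derivative w' v) (at (v r))) \<Longrightarrow> pd r w w'"
  by (auto simp: pd_def)

lemma pdD: "pd r w w' \<Longrightarrow> v \<in> Dx \<Longrightarrow> ((\<lambda>x. w (v(r := x))) has_real_derivative w' v) (at (v r))"
  by (auto simp: pd_def)

lemma pd_mult:
  assumes "pd r w w'" "pd r z z'"
  shows "pd r (\<lambda>v. w v * z v) (\<lambda>v. w' v * z v + w v * z' v)"
proof (rule pdI)
  fix v assume v: "v \<in> Dx"
  show "((\<lambda>x. w (v(r := x)) * z (v(r := x))) has_real_derivative w' v * z v + w v * z' v) (at (v r))"
    using DERIV_mult[OF pdD[OF assms(1) v] pdD[OF assms(2) v]] by (simp add: algebra_simps)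
qed

lemma pd_sum:
  assumes "\<And>i. i \<in> A \<Longrightarrow> pd r (w i) (w' i)"
  shows "pd r (\<lambda>v. \<Sum>i\<in>A. w i v) (\<lambda>v. \<Sum>i\<in>A. w' i v)"
  by (rule pdI, rule DERIV_sum) (use assms pdD in blast)

lemma pd_cong: "pd r w w' \<Longrightarrow> (\<And>v. v \<in> Dx \<Longrightarrow> w' v = w'' v) \<Longrightarrow> pd r w w''"
  by (auto simp: pd_def)

lemma lin_form_upd:
  "r < d \<Longrightarrow> lin_form d T (v(r := x)) = lin_form d T v + T r * (x - v r)"
proof -
  assume r: "r < d"
  have "lin_form d T (v(r := x)) = (\<Sum>j<d. T j * v j + (if j = r then T r * (x - v r) else 0))"
    unfolding lin_form_def by (intro sum.cong) (auto simp: algebra_simps)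
  also have "\<dots> = lin_form d T v + T r * (x - v r)"
    using r by (simp add: sum.distrib lin_form_def)
  finally show ?thesis .
qed

lemma pd_S:
  assumes "r < d" "i \<in> I" shows "pd r (S i) (\<lambda>v. S i v * \<mu> r i v)"
proof (rule pdI)
  fix v
  have "((\<lambda>x. S i (v(r := x))) has_real_derivative (\<Sum>T\<in>G i. a i T * exp (lin_form d T v) * T r)) (at (v r))"
    unfolding S_def lin_form_upd[OF assms(1)]
    by (auto intro!: derivative_eq_intros sum.cong)
  also have "(\<Sum>T\<in>G i. a i T * exp (lin_form d T v) * T r) = S i v * \<mu> r i v"
    using S_pos[OF assms(2), of v] unfolding \<mu>_def \<rho>_def
    by (simp add: sum_distrib_left)
  finally show "((\<lambda>x. S i (v(r := x))) has_real_derivative S i v * \<mu> r i v) (at (v r))" .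
qed

text \<open>The logarithmic derivative of a softmax weight is the deviation of its coefficient from
  the mean, so derivatives of weights are again combinations of products of weights.\<close>

lemma pd_\<rho>:
  assumes "r < d" "i \<in> I" "T \<in> G i"
  shows "pd r (\<rho> i T) (\<lambda>v. \<rho> i T v * (T r - \<mu> r i v))"
proof (rule pdI)
  fix v assume v: "v \<in> Dx"
  show "((\<lambda>x. \<rho> i T (v(r := x))) has_real_derivative \<rho> i T v * (T r - \<mu> r i v)) (at (v r))"
    unfolding \<rho>_def lin_form_upd[OF assms(1)]
    by (rule derivative_eq_intros pdD[OF pd_S[OF assms(1,2)] v] refl)+
       (use S_pos[OF assms(2), of v] in \<open>auto simp: field_simps power2_eq_square\<close>)
qed

lemma pd_sqrt_S:
  assumes "r < d" "i \<in> I" shows "pd r (\<lambda>v. sqrt (S i v)) (\<lambda>v. sqrt (S i v) * \<mu> r i v / 2)"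
proof (rule pdI)
  fix v assume v: "v \<in> Dx"
  have "S i v * inverse (sqrt (S i v)) = sqrt (S i v)"
    using S_pos[OF assms(2), of v] by (simp add: real_div_sqrt flip: divide_inverse)
  then have "inverse (sqrt (S i v)) / 2 * (S i v * \<mu> r i v) = sqrt (S i v) * \<mu> r i v / 2"
    by (simp add: ac_simps)
  moreover have "((\<lambda>x. sqrt (S i (v(r := x)))) has_real_derivative
      inverse (sqrt (S i v)) / 2 * (S i v * \<mu> r i v)) (at (v r))"
    using DERIV_chain2[OF DERIV_real_sqrt pdD[OF pd_S[OF assms(1,2)] v]] S_pos[OF assms(2), of v]
    by simp
  ultimately show "((\<lambda>x. sqrt (S i (v(r := x)))) has_real_derivative sqrt (S i v) * \<mu> r i v / 2) (at (v r))"
    by (simp only:)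
qed

lemma pd_Z:
  assumes "r < d" shows "pd r Z (\<lambda>v. Z v * \<nu> r v / 2)"
proof -
  have "(\<lambda>v. \<Sum>i\<in>I. sqrt (S i v) * \<mu> r i v / 2) = (\<lambda>v. Z v * \<nu> r v / 2)"
    using Z_pos by (auto simp: \<nu>_def q_def sum_distrib_left sum_divide_distrib less_imp_neq[symmetric])
  then show ?thesis
    using pd_sum[of I r "\<lambda>i v. sqrt (S i v)", OF pd_sqrt_S[OF assms]]
    unfolding Z_def[abs_def, symmetric] by metis
qed

lemma pd_q:
  assumes "r < d" "i \<in> I" shows "pd r (q i) (\<lambda>v. q i v * ((\<mu> r i v - \<nu> r v) / 2))"
proof (rule pdI)
  fix v assume v: "v \<in> Dx"
  show "((\<lambda>x. q i (v(r := x))) has_real_derivative q i v * ((\<mu> r i v - \<nu> r v) / 2)) (at (v r))"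
    unfolding q_def
    by (rule derivative_eq_intros pdD[OF pd_sqrt_S[OF assms] v] pdD[OF pd_Z[OF assms(1)] v] refl)+
       (use Z_pos[of v] in \<open>auto simp: field_simps power2_eq_square\<close>)
qed

lemma pd_L:
  assumes "r < d" shows "pd r L (dL r)"
proof (rule pdI)
  fix v assume v: "v \<in> Dx"
  have Z: "((\<lambda>x. 2 * ln (Z (v(r := x)))) has_real_derivative \<nu> r v) (at (v r))"
    using DERIV_cmult[OF DERIV_chain2[OF DERIV_ln_divide pdD[OF pd_Z[OF assms] v]], of 2] Z_pos[of v]
    by simp
  have s: "((\<lambda>x. ln (sinh ((v(r := x)) j / 2))) has_real_derivative
      (if j = r then cosh (v r / 2) / sinh (v r / 2) / 2 else 0)) (at (v r))" if "j < n" for j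
  proof (cases "j = r")
    case True
    with v that have "0 < v r" by (simp add: Dx_def)
    then have "((\<lambda>x. ln (sinh (x / 2))) has_real_derivative (cosh (v r / 2) / sinh (v r / 2) / 2)) (at (v r))"
      by (auto intro!: derivative_eq_intros)
    with True show ?thesis by simp
  qed auto
  have "((\<lambda>x. 2 * (\<Sum>j<n. e j * ln (sinh ((v(r := x)) j / 2)))) has_real_derivative
      2 * (\<Sum>j<n. e j * (if j = r then cosh (v r / 2) / sinh (v r / 2) / 2 else 0))) (at (v r))"
    by (intro DERIV_cmult DERIV_sum s) auto
  moreover have "2 * (\<Sum>j<n. e j * (if j = r then cosh (v r / 2) / sinh (v r / 2) / 2 else 0)) =
      (if r < n then e r * (cosh (v r / 2) / sinh (v r / 2)) else 0)"
    by (simp add: if_distrib[of "\<lambda>x. _ * x"] cong: if_cong)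
  ultimately show "((\<lambda>x. L (v(r := x))) has_real_derivative dL r v) (at (v r))"
    unfolding L_def dL_def using DERIV_diff[OF DERIV_add[OF DERIV_const Z]] by auto
qed

end

section \<open>Softmax weights\<close>

context length_form
begin

text \<open>The coordinates that have a boundary face: all except the free t-coordinates.\<close>

definition "Bd = {..<n} \<union> {2 * n..<d}"

text \<open>Over \<open>\<Prod>\<^sub>j sinh (v\<^sub>j / 2)^(2 * e\<^sub>j)\<close>, the term \<open>exp (T v)\<close> grows like the exponential of the form
  \<open>nf T\<close>.\<close>

definition nf :: "(nat \<Rightarrow> real) \<Rightarrow> nat \<Rightarrow> real" where
  "nf T j = T j - (if j < n then real (e j) else 0)"

text \<open>\<open>\<tau> u T\<close> is the defect of the normalized form from unit speed along
  \<open>u\<close>; \<open>mm\<close> and \<open>mt\<close> are its averages under the weights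
  \<open>\<rho> i\<close> and \<open>q\<close>.\<close>

definition "\<tau> u T = (\<Sum>j<d. u j * nf T j) - 1"
definition "mm u i v = (\<Sum>T\<in>G i. \<rho> i T v * \<tau> u T)"
definition "mt u v = (\<Sum>i\<in>I. q i v * mm u i v)"

definition "Sol u A J \<longleftrightarrow> (\<forall>T\<in>A. \<tau> u T = 0) \<and> (\<forall>j\<in>J. u j = 0)"

text \<open>The side condition \<open>i \<in> Q\<close> pairs each factor \<open>\<rho> i T\<close> with a factor \<open>q i\<close>: only their product is
  small wherever \<open>T\<close> is far from maximal among all forms.\<close>

inductive wt :: "(nat \<Rightarrow> real) set \<Rightarrow> nat set \<Rightarrow> nat set \<Rightarrow> ((nat \<Rightarrow> real) \<Rightarrow> real) \<Rightarrow> bool" where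
  wt_one: "wt {} {} {} (\<lambda>_. 1)"
| wt_q: "wt A J Q w \<Longrightarrow> i \<in> I \<Longrightarrow> wt A J (insert i Q) (\<lambda>v. w v * q i v)"
| wt_rho: "wt A J Q w \<Longrightarrow> i \<in> Q \<Longrightarrow> T \<in> G i \<Longrightarrow> wt (insert T A) J Q (\<lambda>v. w v * \<rho> i T v)"
| wt_exp: "wt A J Q w \<Longrightarrow> j \<in> Bd \<Longrightarrow> wt A (insert j J) Q (\<lambda>v. w v * exp (- v j))"

lemma wt_sets: "wt A J Q w \<Longrightarrow> Q \<subseteq> I \<and> J \<subseteq> Bd \<and> A \<subseteq> (\<Union>i\<in>I. G i)"
  by (induction rule: wt.induct) auto

lemma D_Bd_nonneg: "v \<in> D \<Longrightarrow> j \<in> Bd \<Longrightarrow> 0 \<le> v j"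
  by (auto simp: length_dom_def Bd_def intro: less_imp_le)

lemma wt_bounds_mono:
  fixes x y :: real
  assumes "x \<le> y"
    and "\<forall>i\<in>Q. y \<le> q i v" "\<forall>j\<in>J. y \<le> exp (- v j)"
      "\<forall>T\<in>A. \<exists>i\<in>I. T \<in> G i \<and> y \<le> q i v * \<rho> i T v"
  shows "\<forall>i\<in>Q. x \<le> q i v" "\<forall>j\<in>J. x \<le> exp (- v j)"
      "\<forall>T\<in>A. \<exists>i\<in>I. T \<in> G i \<and> x \<le> q i v * \<rho> i T v"
  using assms order_trans[OF assms(1)] by blast+

text \<open>A product of numbers in (0, 1] lies below each of its factors. For a form in
  \<open>A\<close>, the pairing rule of \<open>wt\<close> supplies a factor \<open>q i\<close> next
  to \<open>\<rho> i T\<close>, so the product of these two is an upper bound as well.\<close>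

lemma wt_bounds:
  assumes "wt A J Q w" "v \<in> D"
  shows "0 < w v \<and> w v \<le> 1 \<and> (\<forall>i\<in>Q. w v \<le> q i v) \<and> (\<forall>j\<in>J. w v \<le> exp (- v j)) \<and>
    (\<forall>T\<in>A. \<exists>i\<in>I. T \<in> G i \<and> w v \<le> q i v * \<rho> i T v)"
  using assms
proof (induction rule: wt.induct)
  case (wt_q A J Q w i)
  then have IH: "0 < w v" "w v \<le> 1" "\<forall>i\<in>Q. w v \<le> q i v" "\<forall>j\<in>J. w v \<le> exp (- v j)"
    "\<forall>T\<in>A. \<exists>i\<in>I. T \<in> G i \<and> w v \<le> q i v * \<rho> i T v" by auto
  note * = q_pos[OF wt_q.hyps(2), of v] q_le1[OF wt_q.hyps(2), of v]
  have "w v * q i v \<le> w v" "w v * q i v \<le> q i v" "0 < w v * q i v"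
    using * IH(1,2) by (auto simp: mult_left_le mult_left_le_one_le)
  with wt_bounds_mono[OF this(1) IH(3-)] IH(2) show ?case by auto
next
  case (wt_rho A J Q w i T)
  then have IH: "0 < w v" "w v \<le> 1" "\<forall>i\<in>Q. w v \<le> q i v" "\<forall>j\<in>J. w v \<le> exp (- v j)"
    "\<forall>T\<in>A. \<exists>i\<in>I. T \<in> G i \<and> w v \<le> q i v * \<rho> i T v" by auto
  have i: "i \<in> I" using wt_rho.hyps wt_sets by blast
  note * = \<rho>_pos[OF i wt_rho.hyps(3), of v] \<rho>_le1[OF i wt_rho.hyps(3), of v]
  have "w v * \<rho> i T v \<le> q i v * \<rho> i T v"
    using IH(3) wt_rho.hyps(2) * by (intro mult_right_mono) auto
  moreover have "w v * \<rho> i T v \<le> w v" "0 < w v * \<rho> i T v"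
    using * IH(1) by (auto simp: mult_left_le)
  ultimately show ?case using wt_bounds_mono[OF _ IH(3-), of "w v * \<rho> i T v"] IH(2) i wt_rho.hyps(3) by auto
next
  case (wt_exp A J Q w j)
  then have IH: "0 < w v" "w v \<le> 1" "\<forall>i\<in>Q. w v \<le> q i v" "\<forall>j\<in>J. w v \<le> exp (- v j)"
    "\<forall>T\<in>A. \<exists>i\<in>I. T \<in> G i \<and> w v \<le> q i v * \<rho> i T v" by auto
  have "w v * exp (- v j) \<le> w v" "w v * exp (- v j) \<le> exp (- v j)" "0 < w v * exp (- v j)"
    using D_Bd_nonneg[OF wt_exp.prems wt_exp.hyps(2)] IH(1,2) by (auto simp: mult_left_le mult_left_le_one_le)
  with wt_bounds_mono[OF this(1) IH(3-)] IH(2) show ?case by auto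
qed auto

section \<open>Measurability, and bounds on the averages\<close>

lemma component_measurable [measurable]: "j < d \<Longrightarrow> (\<lambda>v. v j) \<in> borel_measurable M"
  using measurable_component_singleton[of j "{..<d}" "\<lambda>_. lborel :: real measure"] by simp

lemma lin_form_measurable [measurable]: "lin_form d T \<in> borel_measurable M"
  unfolding lin_form_def[abs_def] by (intro borel_measurable_sum borel_measurable_times) auto

lemma S_measurable [measurable]: "S i \<in> borel_measurable M"
  unfolding S_def[abs_def] by measurable

lemma Z_measurable [measurable]: "Z \<in> borel_measurable M"
  unfolding Z_def[abs_def] by measurable

lemma \<rho>_measurable [measurable]: "\<rho> i T \<in> borel_measurable M"
  unfolding \<rho>_def[abs_def] by measurable

lemma q_measurable [measurable]: "q i \<in> borel_measurable M"
  unfolding q_def[abs_def] by measurable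

lemma \<mu>_measurable [measurable]: "\<mu> r i \<in> borel_measurable M"
  unfolding \<mu>_def[abs_def] by measurable

lemma \<nu>_measurable [measurable]: "\<nu> r \<in> borel_measurable M"
  unfolding \<nu>_def[abs_def] by measurable

lemma sinh_measurable [measurable]: "(sinh :: real \<Rightarrow> real) \<in> borel_measurable borel"
  "(cosh :: real \<Rightarrow> real) \<in> borel_measurable borel"
  by (intro borel_measurable_continuous_onI continuous_intros)+

lemma L_measurable [measurable]: "L \<in> borel_measurable M"
proof -
  have "(\<lambda>v. \<Sum>j<n. e j * ln (sinh (v j / 2))) \<in> borel_measurable M"
  proof (intro borel_measurable_sum borel_measurable_times borel_measurable_const)
    fix j assume "j \<in> {..<n}"
    then have [measurable]: "(\<lambda>v. v j) \<in> borel_measurable M" by auto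
    show "(\<lambda>v. ln (sinh (v j / 2))) \<in> borel_measurable M" by measurable
  qed
  then show ?thesis unfolding L_def[abs_def] by measurable
qed

lemma dL_measurable [measurable]: "r < d \<Longrightarrow> dL r \<in> borel_measurable M"
  unfolding dL_def[abs_def] by measurable

lemma wt_measurable: "wt A J Q w \<Longrightarrow> w \<in> borel_measurable M"
proof (induction rule: wt.induct)
  case (wt_exp A J Q w j)
  then have "j < d" by (auto simp: Bd_def)
  with wt_exp show ?case by measurable
qed auto

lemma mu_bound: "i \<in> I \<Longrightarrow> \<bar>\<mu> r i v\<bar> \<le> (\<Sum>i\<in>I. \<Sum>T\<in>G i. \<bar>T r\<bar>)"
proof -
  assume i: "i \<in> I"
  have "\<bar>\<mu> r i v\<bar> \<le> (\<Sum>T\<in>G i. \<bar>\<rho> i T v * T r\<bar>)" unfolding \<mu>_def by (rule sum_abs)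
  also have "\<dots> \<le> (\<Sum>T\<in>G i. \<bar>T r\<bar>)"
    using \<rho>_pos[OF i] \<rho>_le1[OF i]
    by (intro sum_mono) (auto simp: abs_mult less_imp_le intro!: mult_left_le_one_le)
  also have "\<dots> \<le> (\<Sum>i\<in>I. \<Sum>T\<in>G i. \<bar>T r\<bar>)"
    using member_le_sum[of i I "\<lambda>i. \<Sum>T\<in>G i. \<bar>T r\<bar>"] i fin_I by (simp add: sum_nonneg)
  finally show ?thesis .
qed

lemma nu_bound: "\<bar>\<nu> r v\<bar> \<le> (\<Sum>i\<in>I. \<Sum>T\<in>G i. \<bar>T r\<bar>)"
proof -
  let ?B = "\<Sum>i\<in>I. \<Sum>T\<in>G i. \<bar>T r\<bar>"
  have "\<bar>\<nu> r v\<bar> \<le> (\<Sum>i\<in>I. \<bar>q i v * \<mu> r i v\<bar>)" unfolding \<nu>_def by (rule sum_abs)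
  also have "\<dots> \<le> (\<Sum>i\<in>I. q i v * ?B)"
    using q_pos mu_bound by (intro sum_mono) (auto simp: abs_mult less_imp_le intro!: mult_mono)
  also have "\<dots> = ?B" by (simp add: sum_q flip: sum_distrib_right)
  finally show ?thesis .
qed

section \<open>Derivatives along a direction \<open>u\<close>\<close>

lemma sum_u_form: "(\<Sum>r<d. u r * T r) = \<tau> u T + 1 + (\<Sum>r<n. u r * e r)"
proof -
  have "(\<Sum>r<d. u r * T r) = (\<Sum>r<d. u r * nf T r) + (\<Sum>r<d. if r < n then u r * e r else 0)"
    unfolding sum.distrib[symmetric] by (intro sum.cong) (auto simp: nf_def algebra_simps)
  also have "(\<Sum>r<d. if r < n then u r * e r else 0) = (\<Sum>r<n. u r * e r)"
    by (rule sum.mono_neutral_cong_right) auto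
  finally show ?thesis by (simp add: \<tau>_def)
qed

lemma sum_u_mu: "i \<in> I \<Longrightarrow> (\<Sum>r<d. u r * \<mu> r i v) = mm u i v + 1 + (\<Sum>r<n. u r * e r)"
proof -
  assume i: "i \<in> I"
  have "(\<Sum>r<d. u r * \<mu> r i v) = (\<Sum>T\<in>G i. \<rho> i T v * (\<Sum>r<d. u r * T r))"
    unfolding \<mu>_def sum_distrib_left by (subst sum.swap) (simp add: ac_simps)
  also have "\<dots> = mm u i v + (\<Sum>T\<in>G i. \<rho> i T v) * (1 + (\<Sum>r<n. u r * e r))"
    unfolding sum_u_form mm_def by (simp add: algebra_simps sum.distrib sum_distrib_left)
  finally show ?thesis using sum_\<rho>[OF i] by simp
qed

lemma sum_u_nu: "(\<Sum>r<d. u r * \<nu> r v) = mt u v + 1 + (\<Sum>r<n. u r * e r)"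
proof -
  have "(\<Sum>r<d. u r * \<nu> r v) = (\<Sum>i\<in>I. q i v * (\<Sum>r<d. u r * \<mu> r i v))"
    unfolding \<nu>_def sum_distrib_left by (subst sum.swap) (simp add: ac_simps)
  also have "\<dots> = (\<Sum>i\<in>I. q i v * (mm u i v + 1 + (\<Sum>r<n. u r * e r)))"
    by (simp only: sum_u_mu cong: sum.cong)
  also have "\<dots> = mt u v + (\<Sum>i\<in>I. q i v) * (1 + (\<Sum>r<n. u r * e r))"
    unfolding mt_def sum_distrib_right sum.distrib[symmetric]
    by (intro sum.cong) (auto simp: algebra_simps)
  finally show ?thesis by (simp add: sum_q)
qed

text \<open>Splits off the limit 1 at infinity. The rest carries exp(- x), and its pole at 0 is
  cancelled by a factor 1 - exp(- x).\<close>

lemma coth_half: "0 < x \<Longrightarrow> cosh (x / 2) / sinh (x / 2) = 1 + 2 * (exp (- x) / (1 - exp (- x)))" for x :: real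
proof -
  assume x: "0 < x"
  define p where "p = exp (x / 2)"
  have p: "1 < p" using x by (simp add: p_def)
  have e: "exp (- (x / 2)) = 1 / p" "exp (- x) = 1 / p ^ 2"
    by (simp_all add: p_def exp_minus inverse_eq_divide power2_eq_square flip: exp_add)
  have p2: "1 < p ^ 2" using p by (simp add: one_less_power)
  have "(p + 1 / p) / (p - 1 / p) = ((p ^ 2 + 1) / p) / ((p ^ 2 - 1) / p)"
    using p by (simp add: add_divide_distrib diff_divide_distrib power2_eq_square)
  also have "\<dots> = (p ^ 2 + 1) / (p ^ 2 - 1)" using p by simp
  also have "\<dots> = 1 + 2 / (p ^ 2 - 1)" using p2 by (simp add: field_simps)
  also have "2 / (p ^ 2 - 1) = 2 * (1 / p ^ 2 / ((p ^ 2 - 1) / p ^ 2))" using p by simp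
  also have "(p ^ 2 - 1) / p ^ 2 = 1 - 1 / p ^ 2" using p by (simp add: diff_divide_distrib)
  finally have "(p + 1 / p) / (p - 1 / p) = 1 + 2 * (1 / p ^ 2 / (1 - 1 / p ^ 2))" .
  moreover have "cosh (x / 2) / sinh (x / 2) = (p + 1 / p) / (p - 1 / p)"
  proof -
    have "cosh (x / 2) = (p + 1 / p) / 2" "sinh (x / 2) = (p - 1 / p) / 2"
      unfolding cosh_field_def sinh_field_def e p_def[symmetric] by simp_all
    moreover have "(x / 2) / (y / 2) = x / y" for x y :: real by simp
    ultimately show ?thesis by (simp only:)
  qed
  ultimately show ?thesis by (simp only: e)
qed

text \<open>The constants \<open>u r * e r\<close> from the averages and from the limit of the coth
  cancel. For every \<open>u\<close>, what remains besides 1 consists of averaged defects and of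
  terms carrying some exp(- v r).\<close>

lemma sum_u_dL:
  assumes "v \<in> D"
  shows "(\<Sum>r<d. u r * dL r v) = 1 + mt u v - (\<Sum>r<n. u r * e r * (2 * (exp (- v r) / (1 - exp (- v r)))))"
proof -
  have "(\<Sum>r<d. u r * dL r v) = (\<Sum>r<d. u r * \<nu> r v)
      - (\<Sum>r<d. if r < n then u r * e r * (cosh (v r / 2) / sinh (v r / 2)) else 0)"
    unfolding sum_subtractf[symmetric] by (intro sum.cong) (auto simp: dL_def algebra_simps)
  also have "(\<Sum>r<d. if r < n then u r * e r * (cosh (v r / 2) / sinh (v r / 2)) else 0) =
      (\<Sum>r<n. u r * e r * (cosh (v r / 2) / sinh (v r / 2)))"
    by (rule sum.mono_neutral_cong_right) auto
  also have "\<dots> = (\<Sum>r<n. u r * e r) + (\<Sum>r<n. u r * e r * (2 * (exp (- v r) / (1 - exp (- v r)))))"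
    unfolding sum.distrib[symmetric]
  proof (intro sum.cong refl)
    fix r assume "r \<in> {..<n}"
    then have "0 < v r" using assms by (auto simp: length_dom_def)
    then show "u r * e r * (cosh (v r / 2) / sinh (v r / 2)) =
       u r * e r + u r * e r * (2 * (exp (- v r) / (1 - exp (- v r))))"
      by (simp only: coth_half[OF \<open>0 < v r\<close>] distrib_left mult_1_right)
  qed
  finally show ?thesis by (simp add: sum_u_nu)
qed

text \<open>\<open>l\<close> is a logarithmic gradient of \<open>w\<close>. The last clause is what
  makes ranks grow: along a solution \<open>u\<close> there is no constant term, only averaged
  defects, and \<open>mm u i\<close> occurs only for \<open>i\<close> in \<open>Q\<close>, where
  multiplication by \<open>\<rho> i T\<close> gives a weight in the sense of \<open>wt\<close>
  again.\<close>

definition "log_deriv A J Q w l \<longleftrightarrow>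
  (\<forall>r<d. pd r w (\<lambda>v. w v * l r v) \<and> l r \<in> borel_measurable M \<and> (\<exists>C. \<forall>v. \<bar>l r v\<bar> \<le> C)) \<and>
  (\<forall>u. Sol u A J \<longrightarrow> (\<exists>\<kappa> \<kappa>0. (\<forall>i. i \<notin> Q \<longrightarrow> \<kappa> i = 0) \<and>
     (\<forall>v. (\<Sum>r<d. u r * l r v) = (\<Sum>i\<in>I. \<kappa> i * mm u i v) + \<kappa>0 * mt u v)))"

lemma pd_log_mult:
  assumes "pd r w (\<lambda>v. w v * l v)" "pd r z (\<lambda>v. z v * l' v)"
  shows "pd r (\<lambda>v. w v * z v) (\<lambda>v. w v * z v * (l v + l' v))"
  using pd_mult[OF assms] by (rule pd_cong) (simp add: algebra_simps)

lemma log_deriv_mult: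
  assumes w: "log_deriv A J Q w l"
    and z: "\<And>r. r < d \<Longrightarrow> pd r z (\<lambda>v. z v * l' r v)"
    and meas: "\<And>r. r < d \<Longrightarrow> l' r \<in> borel_measurable M"
    and bnd: "\<And>r. r < d \<Longrightarrow> \<exists>C. \<forall>v. \<bar>l' r v\<bar> \<le> C"
    and u: "\<And>u. Sol u A' J' \<Longrightarrow> Sol u A J \<and> (\<exists>\<kappa> \<kappa>0. (\<forall>i. i \<notin> Q' \<longrightarrow> \<kappa> i = 0) \<and>
     (\<forall>v. (\<Sum>r<d. u r * l' r v) = (\<Sum>i\<in>I. \<kappa> i * mm u i v) + \<kappa>0 * mt u v))"
    and Q: "Q \<subseteq> Q'"
  shows "log_deriv A' J' Q' (\<lambda>v. w v * z v) (\<lambda>r v. l r v + l' r v)"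
  unfolding log_deriv_def
proof (intro conjI allI impI)
  fix r assume r: "r < d"
  have w': "pd r w (\<lambda>v. w v * l r v)" "l r \<in> borel_measurable M" "\<exists>C. \<forall>v. \<bar>l r v\<bar> \<le> C"
    using w r unfolding log_deriv_def by blast+
  show "pd r (\<lambda>v. w v * z v) (\<lambda>v. w v * z v * (l r v + l' r v))"
    using pd_log_mult[OF w'(1) z[OF r]] .
  show "(\<lambda>v. l r v + l' r v) \<in> borel_measurable M"
    using meas[OF r] w'(2) by simp
  obtain C C' where "\<forall>v. \<bar>l r v\<bar> \<le> C" "\<forall>v. \<bar>l' r v\<bar> \<le> C'"
    using bnd[OF r] w'(3) by blast
  then have "\<forall>v. \<bar>l r v + l' r v\<bar> \<le> C + C'"
    by (meson abs_triangle_ineq add_mono order_trans)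
  then show "\<exists>C. \<forall>v. \<bar>l r v + l' r v\<bar> \<le> C" ..
next
  fix u assume "Sol u A' J'"
  from u[OF this] obtain \<kappa> \<kappa>0 where Sol: "Sol u A J" and
    1: "\<And>i. i \<notin> Q' \<Longrightarrow> \<kappa> i = 0" "\<And>v. (\<Sum>r<d. u r * l' r v) = (\<Sum>i\<in>I. \<kappa> i * mm u i v) + \<kappa>0 * mt u v"
    by auto
  from Sol w obtain \<kappa>' \<kappa>0' where
    2: "\<And>i. i \<notin> Q \<Longrightarrow> \<kappa>' i = 0" "\<And>v. (\<Sum>r<d. u r * l r v) = (\<Sum>i\<in>I. \<kappa>' i * mm u i v) + \<kappa>0' * mt u v"
    unfolding log_deriv_def by blast
  have "(\<Sum>r<d. u r * (l r v + l' r v)) =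
      (\<Sum>i\<in>I. (\<kappa> i + \<kappa>' i) * mm u i v) + (\<kappa>0 + \<kappa>0') * mt u v" for v
    unfolding distrib_left distrib_right sum.distrib 1(2) 2(2) by simp
  moreover have "\<kappa> i + \<kappa>' i = 0" if "i \<notin> Q'" for i
    using 1(1)[OF that] 2(1)[of i] that Q by auto
  ultimately show "\<exists>\<kappa> \<kappa>0. (\<forall>i. i \<notin> Q' \<longrightarrow> \<kappa> i = 0) \<and>
     (\<forall>v. (\<Sum>r<d. u r * (l r v + l' r v)) = (\<Sum>i\<in>I. \<kappa> i * mm u i v) + \<kappa>0 * mt u v)"
    by (intro exI[of _ "\<lambda>i. \<kappa> i + \<kappa>' i"] exI[of _ "\<kappa>0 + \<kappa>0'"]) simp
qed

lemma Sol_combI: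
  assumes "Sol u A J" "\<And>i. i \<notin> Q \<Longrightarrow> \<kappa> i = 0"
    and "\<And>v. (\<Sum>r<d. u r * l r v) = (\<Sum>i\<in>I. \<kappa> i * mm u i v) + \<kappa>0 * mt u v"
  shows "Sol u A J \<and> (\<exists>\<kappa> \<kappa>0. (\<forall>i. i \<notin> Q \<longrightarrow> \<kappa> i = 0) \<and>
     (\<forall>v. (\<Sum>r<d. u r * l r v) = (\<Sum>i\<in>I. \<kappa> i * mm u i v) + \<kappa>0 * mt u v))"
  using assms by blast

text \<open>Logarithmic derivatives of the factors add up. Along a solution, \<open>q i\<close>
  contributes (mm u i - mt u) / 2, \<open>\<rho> i T\<close> contributes - mm u i because the defect
  of \<open>T\<close> vanishes, and exp(- v j) contributes - u j = 0.\<close>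

lemma wt_log_deriv: "wt A J Q w \<Longrightarrow> \<exists>l. log_deriv A J Q w l"
proof (induction rule: wt.induct)
  case wt_one
  have "log_deriv {} {} {} (\<lambda>_. 1) (\<lambda>_ _. 0)"
    unfolding log_deriv_def pd_def
    by (auto intro!: exI[of _ "\<lambda>_. 0"] exI[of _ 0])
  then show ?case by - (rule exI)
next
  case (wt_q A J Q w i)
  then obtain l where l: "log_deriv A J Q w l" by blast
  have "log_deriv A J (insert i Q) (\<lambda>v. w v * q i v) (\<lambda>r v. l r v + (\<mu> r i v - \<nu> r v) / 2)"
  proof (rule log_deriv_mult[OF l])
    fix r assume r: "r < d"
    show "pd r (q i) (\<lambda>v. q i v * ((\<mu> r i v - \<nu> r v) / 2))" by (rule pd_q[OF r wt_q.hyps(2)])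
    have "\<bar>(\<mu> r i v - \<nu> r v) / 2\<bar> \<le> (\<Sum>i\<in>I. \<Sum>T\<in>G i. \<bar>T r\<bar>)" for v
    proof -
      have *: "\<bar>(x - y) / 2\<bar> \<le> B" if "\<bar>x\<bar> \<le> B" "\<bar>y\<bar> \<le> B" for x y B :: real
        using that by (simp add: abs_le_iff)
      show ?thesis by (rule *[OF mu_bound[OF wt_q.hyps(2)] nu_bound])
    qed
    then show "\<exists>C. \<forall>v. \<bar>(\<mu> r i v - \<nu> r v) / 2\<bar> \<le> C" by blast
  next
    fix u assume u: "Sol u A J"
    have *: "(\<Sum>r<d. u r * ((\<mu> r i v - \<nu> r v) / 2)) =
      (\<Sum>i'\<in>I. (if i' = i then 1 / 2 else 0) * mm u i' v) + (- 1 / 2) * mt u v" for v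
    proof -
      have "(\<Sum>r<d. u r * ((\<mu> r i v - \<nu> r v) / 2)) =
          ((\<Sum>r<d. u r * \<mu> r i v) - (\<Sum>r<d. u r * \<nu> r v)) / 2"
        unfolding sum_subtractf[symmetric] sum_divide_distrib by (intro sum.cong) (auto simp: algebra_simps)
      also have "\<dots> = mm u i v / 2 - mt u v / 2"
        unfolding sum_u_mu[OF wt_q.hyps(2)] sum_u_nu by (simp add: diff_divide_distrib)
      also have "mm u i v / 2 = (\<Sum>i'\<in>I. if i' = i then mm u i' v / 2 else 0)"
        using wt_q.hyps(2) fin_I by simp
      also have "\<dots> = (\<Sum>i'\<in>I. (if i' = i then 1 / 2 else 0) * mm u i' v)"
        by (intro sum.cong) auto
      finally show ?thesis by simp
    qed
    show "Sol u A J \<and> (\<exists>\<kappa> \<kappa>0. (\<forall>i'. i' \<notin> insert i Q \<longrightarrow> \<kappa> i' = 0) \<and>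
       (\<forall>v. (\<Sum>r<d. u r * ((\<mu> r i v - \<nu> r v) / 2)) = (\<Sum>i\<in>I. \<kappa> i * mm u i v) + \<kappa>0 * mt u v))"
      by (rule Sol_combI[OF u _ *]) simp
  qed auto
  then show ?case by - (rule exI)
next
  case (wt_rho A J Q w i T)
  then obtain l where l: "log_deriv A J Q w l" by blast
  have i: "i \<in> I" using wt_rho.hyps wt_sets by blast
  have "log_deriv (insert T A) J Q (\<lambda>v. w v * \<rho> i T v) (\<lambda>r v. l r v + (T r - \<mu> r i v))"
  proof (rule log_deriv_mult[OF l])
    fix r assume r: "r < d"
    show "pd r (\<rho> i T) (\<lambda>v. \<rho> i T v * (T r - \<mu> r i v))" by (rule pd_\<rho>[OF r i wt_rho.hyps(3)])
    have "\<bar>T r - \<mu> r i v\<bar> \<le> \<bar>T r\<bar> + (\<Sum>i\<in>I. \<Sum>T\<in>G i. \<bar>T r\<bar>)" for v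
      using mu_bound[OF i, of r v] by linarith
    then show "\<exists>C. \<forall>v. \<bar>T r - \<mu> r i v\<bar> \<le> C" by blast
  next
    fix u assume u: "Sol u (insert T A) J"
    then have u': "Sol u A J" by (simp add: Sol_def)
    have *: "(\<Sum>r<d. u r * (T r - \<mu> r i v)) =
      (\<Sum>i'\<in>I. (if i' = i then - 1 else 0) * mm u i' v) + 0 * mt u v" for v
    proof -
      have "(\<Sum>r<d. u r * (T r - \<mu> r i v)) =
          (\<Sum>r<d. u r * T r) - (\<Sum>r<d. u r * \<mu> r i v)"
        by (simp add: algebra_simps sum_subtractf)
      also have "\<dots> = - mm u i v"
        using u unfolding sum_u_mu[OF i] sum_u_form[of u T] by (simp add: Sol_def)
      finally show ?thesis
        using i fin_I by (simp add: if_distrib[of "\<lambda>x. x * _"] cong: if_cong)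
    qed
    show "Sol u A J \<and> (\<exists>\<kappa> \<kappa>0. (\<forall>i'. i' \<notin> Q \<longrightarrow> \<kappa> i' = 0) \<and>
       (\<forall>v. (\<Sum>r<d. u r * (T r - \<mu> r i v)) = (\<Sum>i\<in>I. \<kappa> i * mm u i v) + \<kappa>0 * mt u v))"
      by (rule Sol_combI[OF u' _ *]) (use wt_rho.hyps(2) in auto)
  qed auto
  then show ?case by - (rule exI)
next
  case (wt_exp A J Q w j)
  then obtain l where l: "log_deriv A J Q w l" by blast
  have "log_deriv A (insert j J) Q (\<lambda>v. w v * exp (- v j)) (\<lambda>r v. l r v + (if r = j then -1 else 0))"
  proof (rule log_deriv_mult[OF l])
    fix r assume r: "r < d"
    show "pd r (\<lambda>v. exp (- v j)) (\<lambda>v. exp (- v j) * (if r = j then -1 else 0))"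
      by (cases "r = j") (auto intro!: pdI derivative_eq_intros)
  next
    fix u assume u: "Sol u A (insert j J)"
    then have u': "Sol u A J" by (simp add: Sol_def)
    have "(\<Sum>r<d. u r * (if r = j then -1 else 0)) = 0"
      using u by (intro sum.neutral) (auto simp: Sol_def)
    then have *: "(\<Sum>r<d. u r * (if r = j then -1 else 0)) = (\<Sum>i\<in>I. (\<lambda>_. 0) i * mm u i v) + 0 * mt u v" for v
      by simp
    show "Sol u A J \<and> (\<exists>\<kappa> \<kappa>0. (\<forall>i'. i' \<notin> Q \<longrightarrow> \<kappa> i' = 0) \<and>
       (\<forall>v :: nat \<Rightarrow> real. (\<Sum>r<d. u r * (if r = j then -1 else 0)) = (\<Sum>i\<in>I. \<kappa> i * mm u i v) + \<kappa>0 * mt u v))"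
      by (rule Sol_combI[OF u' _ *]) simp
  qed auto
  then show ?case by - (rule exI)
qed

end

section \<open>Ranks of the constraints on a direction\<close>

text \<open>Real sequences with pointwise scaling form the ambient vector space. Its span and
  independence get names outside the interpretation so that they remain usable after that context is
  closed.\<close>

definition fspan :: "(nat \<Rightarrow> real) set \<Rightarrow> (nat \<Rightarrow> real) set" where
  "fspan = module.span (\<lambda>(c::real) f i. c * f i)"

definition findep :: "(nat \<Rightarrow> real) set \<Rightarrow> bool" where
  "findep R \<longleftrightarrow> \<not> module.dependent (\<lambda>(c::real) f i. c * f i) R"

context
begin

interpretation fv: vector_space "\<lambda>(c::real) (f :: nat \<Rightarrow> real) i. c * f i"
  by unfold_locales (simp_all add: plus_fun_def distrib_left distrib_right mult.assoc)

interpretation fvr: vector_space_pair "\<lambda>(c::real) (f :: nat \<Rightarrow> real) i. c * f i" "(*) :: real \<Rightarrow> real \<Rightarrow> real"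
  by unfold_locales (simp_all add: distrib_left distrib_right)

text \<open>The \<open>j\<close>-th unit vector. If a vector is read as an equation with its
  right-hand side in coordinate \<open>d\<close>, then \<open>urow d\<close> is the contradiction 0
  = 1.\<close>

definition urow :: "nat \<Rightarrow> nat \<Rightarrow> real" where "urow j i = (if i = j then 1 else 0)"

lemma fspan_mono: "A \<subseteq> B \<Longrightarrow> fspan A \<subseteq> fspan B"
  unfolding fspan_def by (rule fv.span_mono)

lemma fspan_base: "f \<in> A \<Longrightarrow> f \<in> fspan A"
  unfolding fspan_def by (rule fv.span_base)

lemma findep_insertI: "f \<notin> fspan R \<Longrightarrow> findep R \<Longrightarrow> findep (insert f R)"
  unfolding fspan_def findep_def by (rule fv.independent_insertI)

lemma findep_single: "f \<noteq> 0 \<Longrightarrow> findep {f}"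
  unfolding findep_def by simp

lemma sum_fun_apply: "(\<Sum>x\<in>A. f x) i = (\<Sum>x\<in>A. f x i)" for f :: "'a \<Rightarrow> nat \<Rightarrow> real"
  by (induction A rule: infinite_finite_induct) (auto simp: plus_fun_def zero_fun_def)

lemma urow_expand:
  fixes f :: "nat \<Rightarrow> real"
  assumes "\<And>i. d < i \<Longrightarrow> f i = 0"
  shows "f = (\<Sum>j\<le>d. (\<lambda>i. f j * urow j i))"
proof
  fix i
  have "(\<Sum>j\<le>d. f j * urow j i) = (\<Sum>j\<le>d. if i = j then f j else 0)"
    by (intro sum.cong) (auto simp: urow_def)
  then show "f i = (\<Sum>j\<le>d. (\<lambda>i. f j * urow j i)) i"
    using assms[of i] by (auto simp: sum_fun_apply not_le)
qed

lemma urow_span: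
  assumes "\<And>i. d < i \<Longrightarrow> f i = 0"
  shows "f \<in> fv.span (urow ` {..d})"
proof -
  have "(\<Sum>j\<le>d. (\<lambda>i. f j * urow j i)) \<in> fv.span (urow ` {..d})"
    by (intro fv.span_sum fv.span_scale fv.span_base) auto
  moreover have "(\<Sum>j\<le>d. (\<lambda>i. f j * urow j i)) = f"
    by (rule urow_expand[symmetric]) (rule assms)
  ultimately show ?thesis by (simp only:)
qed

lemma card_le_urow:
  assumes "fv.independent R" "\<And>f i. f \<in> R \<Longrightarrow> d < i \<Longrightarrow> f i = 0"
  shows "finite R" "card R \<le> Suc d"
proof -
  have "R \<subseteq> fv.span (urow ` {..d})" using assms(2) urow_span by blast
  from fv.independent_span_bound[OF _ assms(1) this]
  have "finite R" "card R \<le> card (urow ` {..d})" by auto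
  moreover have "card (urow ` {..d}) \<le> Suc d" using card_image_le[of "{..d}" urow] by simp
  ultimately show "finite R" "card R \<le> Suc d" by auto
qed

text \<open>A set of \<open>d + 1\<close> independent vectors supported on the coordinates 0, ..., d
  exhausts that space; otherwise \<open>urow d\<close> would enlarge it to \<open>d + 2\<close>
  independent ones.\<close>

lemma full_span_urow:
  assumes "findep R" "\<And>f i. f \<in> R \<Longrightarrow> d < i \<Longrightarrow> f i = 0" "Suc d \<le> card R"
  shows "urow d \<in> fspan R"
unfolding fspan_def
proof (rule ccontr)
  note assms = assms[unfolded findep_def fspan_def]
  assume *: "urow d \<notin> fv.span R"
  then have "fv.independent (insert (urow d) R)" by (rule fv.independent_insertI[OF _ assms(1)])
  then have "card (insert (urow d) R) \<le> Suc d"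
    by (rule card_le_urow(2)) (use assms(2) in \<open>auto simp: urow_def\<close>)
  moreover have "urow d \<notin> R" using * fv.span_base by blast
  moreover have "finite R" by (rule card_le_urow(1)[OF assms(1)]) (rule assms(2))
  ultimately show False using assms(3) by simp
qed

text \<open>A basis of the span of \<open>R\<close> stays independent after adding
  \<open>urow d\<close>, so some linear functional vanishes on \<open>R\<close> and is -1 on
  \<open>urow d\<close>. Its values on the other unit vectors are the solution.\<close>

lemma solve_affine_system:
  assumes "urow d \<notin> fspan R" "\<And>f i. f \<in> R \<Longrightarrow> d < i \<Longrightarrow> f i = 0"
  obtains u where "\<And>f. f \<in> R \<Longrightarrow> (\<Sum>i<d. u i * f i) = f d"
proof -
  note assms = assms[unfolded fspan_def]
  obtain B where B: "B \<subseteq> R" "fv.independent B" "R \<subseteq> fv.span B"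
    using fv.maximal_independent_subset[of R] by blast
  have "urow d \<notin> fv.span B" using assms(1) B(1) fv.span_mono by blast
  then have ind: "fv.independent (insert (urow d) B)" by (rule fv.independent_insertI[OF _ B(2)])
  obtain g where g: "Vector_Spaces.linear (\<lambda>(c::real) (f :: nat \<Rightarrow> real) i. c * f i) ((*) :: real \<Rightarrow> real \<Rightarrow> real) g"
    and g': "\<forall>f\<in>insert (urow d) B. g f = (if f = urow d then -1 else 0)"
    using fvr.linear_independent_extend[OF ind, of "\<lambda>f. if f = urow d then -1 else 0"] by (elim exE conjE)
  note gB = bspec[OF g']
  interpret g: Vector_Spaces.linear "\<lambda>(c::real) (f :: nat \<Rightarrow> real) i. c * f i" "(*) :: real \<Rightarrow> real \<Rightarrow> real" g
    by (rule g)
  have "g f = 0" if "f \<in> B" for f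
    using gB[of f] that \<open>urow d \<notin> fv.span B\<close> fv.span_base by auto
  then have 0: "g f = 0" if "f \<in> fv.span B" for f
    using g.eq_0_on_span that by blast
  have "(\<Sum>i<d. g (urow i) * f i) = f d" if f: "f \<in> R" for f
  proof -
    have "0 = g f" using 0 f B(3) by auto
    also have "\<dots> = g (\<Sum>j\<le>d. (\<lambda>i. f j * urow j i))"
      by (rule arg_cong[where f = g], rule urow_expand) (rule assms(2)[OF f])
    also have "\<dots> = (\<Sum>j\<le>d. f j * g (urow j))" by (simp only: g.sum g.scale)
    also have "\<dots> = (\<Sum>j<d. f j * g (urow j)) - f d"
      using gB[of "urow d"] by (simp flip: lessThan_Suc_atMost)
    finally show ?thesis by (simp add: mult.commute)
  qed
  then show ?thesis by (rule that)
qed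

text \<open>Being solved by \<open>u\<close> passes to linear combinations, so a row violated by
  \<open>u\<close> is independent of the rows it satisfies.\<close>

lemma not_in_span:
  fixes u :: "nat \<Rightarrow> real"
  assumes "\<And>f. f \<in> R \<Longrightarrow> (\<Sum>i<d. u i * f i) = f d" "(\<Sum>i<d. u i * f i) \<noteq> f d"
  shows "f \<notin> fspan R"
unfolding fspan_def
proof
  assume "f \<in> fv.span R"
  then have "(\<Sum>i<d. u i * f i) = f d"
  proof (induction rule: fv.span_induct_alt)
    case (step c x y)
    have "(\<Sum>i<d. u i * (c * x i + y i)) = c * (\<Sum>i<d. u i * x i) + (\<Sum>i<d. u i * y i)"
      by (simp add: sum_distrib_left algebra_simps sum.distrib)
    then show ?case using step assms(1) by (simp add: plus_fun_def)
  qed (simp add: zero_fun_def)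
  with assms(2) show False by simp
qed

lemma span_certificate:
  assumes "finite R" "f \<in> fspan R"
  obtains c where "\<And>i. f i = (\<Sum>g\<in>R. c g * g i)"
proof -
  note assms = assms[unfolded fspan_def]
  obtain c where "f = (\<Sum>g\<in>R. (\<lambda>i. c g * g i))"
    using assms(2) fv.span_finite[OF assms(1)] by auto
  then have "\<And>i. f i = (\<Sum>g\<in>R. c g * g i)" by (simp add: sum_fun_apply)
  then show ?thesis by (rule that)
qed

end

section \<open>Rank of the constraints carried by a weight\<close>

context length_form
begin

text \<open>The condition \<open>Sol u A J\<close> says that \<open>(u, -1)\<close> is orthogonal to all rows below, so it has a
  solution \<open>u\<close> iff \<open>urow d\<close> is not in their span.\<close>

definition frow :: "(nat \<Rightarrow> real) \<Rightarrow> nat \<Rightarrow> real" where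
  "frow T i = (if i < d then nf T i else if i = d then 1 else 0)"

definition "crows A J = frow ` A \<union> urow ` J"

lemma Bd_less: "j \<in> Bd \<Longrightarrow> j < d"
  by (auto simp: Bd_def)

lemma rows_supp: "J \<subseteq> Bd \<Longrightarrow> f \<in> crows A J \<Longrightarrow> d < i \<Longrightarrow> f i = 0"
  using Bd_less by (fastforce simp: crows_def frow_def urow_def)

lemma Sol_rows:
  assumes "J \<subseteq> Bd"
  shows "Sol u A J \<longleftrightarrow> (\<forall>f\<in>crows A J. (\<Sum>i<d. u i * f i) = f d)"
proof -
  have "(\<Sum>i<d. u i * frow T i) = frow T d \<longleftrightarrow> \<tau> u T = 0" for T
    by (simp add: frow_def \<tau>_def)
  moreover have "(\<Sum>i<d. u i * urow j i) = urow j d \<longleftrightarrow> u j = 0" if "j \<in> J" for j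
  proof -
    have "j < d" using that assms Bd_less by auto
    moreover have "(\<Sum>i<d. u i * urow j i) = (\<Sum>i<d. if i = j then u j else 0)"
      by (intro sum.cong) (auto simp: urow_def)
    ultimately show ?thesis by (simp add: urow_def)
  qed
  ultimately show ?thesis by (auto simp: Sol_def crows_def)
qed

text \<open>\<open>r\<close> is a lower bound for the rank and not the rank itself, which makes the
  predicate monotone in both sets of constraints.\<close>

definition has_rank :: "(nat \<Rightarrow> real) set \<Rightarrow> nat set \<Rightarrow> nat \<Rightarrow> bool" where
  "has_rank A J r \<longleftrightarrow> (\<exists>R\<subseteq>crows A J. findep R \<and> finite R \<and> r \<le> card R)"

lemma has_rank_mono: "has_rank A J r \<Longrightarrow> A \<subseteq> A' \<Longrightarrow> J \<subseteq> J' \<Longrightarrow> has_rank A' J' r"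
  unfolding has_rank_def crows_def by (meson Un_mono image_mono order_trans)

lemma has_rank_insert:
  assumes "has_rank A J r" "f \<notin> fspan (crows A J)" "f \<in> crows A' J'" "A \<subseteq> A'" "J \<subseteq> J'"
  shows "has_rank A' J' (Suc r)"
proof -
  obtain R where R: "R \<subseteq> crows A J" "findep R" "finite R" "r \<le> card R"
    using assms(1) by (auto simp: has_rank_def)
  have f: "f \<notin> fspan R" using assms(2) R(1) fspan_mono by blast
  then have "f \<notin> R" using fspan_base by blast
  moreover have "crows A J \<subseteq> crows A' J'" using assms(4,5) by (auto simp: crows_def)
  ultimately show ?thesis
    unfolding has_rank_def using R assms(3) findep_insertI[OF f R(2)]
    by (intro exI[of _ "insert f R"]) auto
qed

text \<open>A form with nonzero defect is an equation violated by the solution \<open>u\<close> of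
  the present ones, hence a row outside their span.\<close>

lemma has_rank_form:
  assumes "has_rank A J r" "Sol u A J" "J \<subseteq> Bd" "\<tau> u T \<noteq> 0"
  shows "has_rank (insert T A) J (Suc r)"
proof (rule has_rank_insert[OF assms(1)])
  show "frow T \<notin> fspan (crows A J)"
    using assms(2,4) Sol_rows[OF assms(3)]
    by (intro not_in_span[where u = u and d = d]) (auto simp: frow_def \<tau>_def)
qed (auto simp: crows_def)

lemma has_rank_urow:
  assumes "has_rank A J r" "Sol u A J" "J \<subseteq> Bd" "j \<in> Bd" "u j \<noteq> 0" "j \<in> J'" "J \<subseteq> J'"
  shows "has_rank A J' (Suc r)"
proof (rule has_rank_insert[OF assms(1)])
  have "(\<Sum>i<d. u i * urow j i) = (\<Sum>i<d. if i = j then u j else 0)"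
    by (intro sum.cong) (auto simp: urow_def)
  then show "urow j \<notin> fspan (crows A J)"
    using assms(2,5) Sol_rows[OF assms(3)] Bd_less[OF assms(4)]
    by (intro not_in_span[where u = u and d = d]) (auto simp: urow_def)
qed (use assms in \<open>auto simp: crows_def\<close>)

lemma full_rank:
  assumes "has_rank A J (Suc d)" "J \<subseteq> Bd"
  shows "urow d \<in> fspan (crows A J)"
proof -
  obtain R where R: "R \<subseteq> crows A J" "findep R" "finite R" "Suc d \<le> card R"
    using assms(1) by (auto simp: has_rank_def)
  then have "urow d \<in> fspan R"
    using rows_supp[OF assms(2)] by (intro full_span_urow) auto
  then show ?thesis using R(1) fspan_mono by blast
qed

lemma rows_dichotomy:
  assumes "J \<subseteq> Bd"
  shows "urow d \<in> fspan (crows A J) \<or> (\<exists>u. Sol u A J)"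
proof (cases "urow d \<in> fspan (crows A J)")
  case False
  obtain u where "\<And>f. f \<in> crows A J \<Longrightarrow> (\<Sum>i<d. u i * f i) = f d"
    by (rule solve_affine_system[OF False]) (use rows_supp[OF assms] in auto)
  then show ?thesis using Sol_rows[OF assms] by blast
qed auto

text \<open>The row of a form is nonzero because its last entry is 1. This is the rank at which the
  induction starts.\<close>

lemma has_rank_single:
  "has_rank {T} {} 1"
proof -
  have "frow T d = 1" by (simp add: frow_def)
  then have "frow T \<noteq> 0" by (auto simp: zero_fun_def)
  then have "findep {frow T}" by (rule findep_single)
  then show ?thesis unfolding has_rank_def by (intro exI[of _ "{frow T}"]) (auto simp: crows_def)
qed

end

section \<open>Growth bounds\<close>

text \<open>For exponents up to 1/2, the singularity of a negative power of 1 - exp(- x) at 0 is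
  dominated by 1 + x powr (-1/2), which is integrable near 0 and bounded at infinity.\<close>

lemma minus_ln_one_minus_exp_le:
  fixes x \<theta> :: real
  assumes "0 < x" "0 \<le> \<theta>" "\<theta> \<le> 1 / 2"
  shows "- \<theta> * ln (1 - exp (- x)) \<le> ln (1 + x powr (- 1 / 2))"
proof -
  have pos: "0 < 1 - exp (- x)" using assms(1) by simp
  then have "0 \<le> - ln (1 - exp (- x))" by simp
  then have "\<theta> * (- ln (1 - exp (- x))) \<le> 1 / 2 * (- ln (1 - exp (- x)))"
    using assms(3) by (rule mult_right_mono[rotated])
  then have "- \<theta> * ln (1 - exp (- x)) \<le> 1 / 2 * (- ln (1 - exp (- x)))" by simp
  also have "- ln (1 - exp (- x)) \<le> ln (1 + 1 / x)"
  proof -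
    have "exp (- x) \<le> 1 / (1 + x)"
      using exp_ge_add_one_self[of x] assms(1) by (simp add: exp_minus field_simps)
    also have "\<dots> = 1 - x / (1 + x)" using assms(1) by (simp add: field_simps)
    finally have "x / (1 + x) \<le> 1 - exp (- x)" by simp
    then have "ln (x / (1 + x)) \<le> ln (1 - exp (- x))"
      using assms(1) pos by (subst ln_le_cancel_iff) auto
    moreover have "ln (1 + 1 / x) = - ln (x / (1 + x))"
    proof -
      have "1 + 1 / x = inverse (x / (1 + x))" using assms(1) by (simp add: field_simps)
      then show ?thesis using assms(1) by (simp only: ln_inverse)
    qed
    ultimately show ?thesis by simp
  qed
  also have "1 / 2 * ln (1 + 1 / x) \<le> ln (1 + x powr (- 1 / 2))"
  proof -
    define s where "s = x powr (- 1 / 2)"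
    have s: "0 < s" "s\<^sup>2 = 1 / x"
      using assms(1) by (simp_all add: s_def power2_eq_square powr_minus_divide flip: powr_add)
    have "ln (1 + s\<^sup>2) \<le> ln ((1 + s)\<^sup>2)"
      using s(1) by (subst ln_le_cancel_iff) (auto simp: power2_eq_square algebra_simps intro: add_pos_nonneg)
    also have "\<dots> = 2 * ln (1 + s)" using s(1) by (simp add: ln_realpow)
    finally show ?thesis using s by (simp add: s_def)
  qed
  finally show ?thesis by simp
qed

section \<open>Asymptotic behaviour of \<open>L\<close> and decay of the weights\<close>

context length_form
begin

definition "FS = (SIGMA i:I. G i)"
definition "NF T v = lin_form d (nf T) v"
text \<open>The convex piecewise linear function that \<open>L\<close> follows, up to bounded terms
  and singular terms at the x-faces.\<close>

definition "Nmax v = Max ((\<lambda>(i, T). NF T v) ` FS)"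

lemma FS_finite: "finite FS" and FS_ne: "FS \<noteq> {}"
  using fin_I I_ne fin_G G_ne by (auto simp: FS_def)

lemma NF_le_Nmax: "i \<in> I \<Longrightarrow> T \<in> G i \<Longrightarrow> NF T v \<le> Nmax v"
  unfolding Nmax_def by (rule Max_ge) (use FS_finite in \<open>auto simp: FS_def\<close>)

lemma Nmax_attained: obtains i T where "i \<in> I" "T \<in> G i" "Nmax v = NF T v"
proof -
  have "Nmax v \<in> (\<lambda>(i, T). NF T v) ` FS"
    unfolding Nmax_def by (rule Max_in) (use FS_finite FS_ne in auto)
  then show ?thesis using that by (auto simp: FS_def)
qed

lemma lin_form_NF: "lin_form d T v = NF T v + (\<Sum>j<n. e j * v j)" for v :: "nat \<Rightarrow> real"
  using sum_u_form[of v T] by (simp add: NF_def lin_form_def \<tau>_def mult.commute)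

lemma S_ge: "i \<in> I \<Longrightarrow> T \<in> G i \<Longrightarrow> a i T * exp (lin_form d T v) \<le> S i v"
  unfolding S_def using fin_G a_pos
  by (intro member_le_sum) (auto intro!: mult_nonneg_nonneg less_imp_le)

lemma Z_ge: "i \<in> I \<Longrightarrow> sqrt (S i v) \<le> Z v"
  unfolding Z_def using fin_I S_pos by (intro member_le_sum) (auto simp: less_imp_le)

text \<open>With \<open>x\<close> the term of \<open>T\<close> and \<open>y\<close> the term of a
  maximal form, the product is x / (sqrt (S i) * Z). Since \<open>S i\<close> is at least
  \<open>x\<close> and \<open>Z\<close> at least the square root of \<open>y\<close>, this is at
  most sqrt (x / y), whence the rate 1/2.\<close>

lemma q_\<rho>_le:
  obtains C where "1 \<le> C" "\<And>i T v. i \<in> I \<Longrightarrow> T \<in> G i \<Longrightarrow> q i v * \<rho> i T v \<le> C * exp (- (Nmax v - NF T v) / 2)"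
proof -
  define A where "A = (\<Sum>(i, T)\<in>FS. sqrt (a i T))"
  define B where "B = (\<Sum>(i, T)\<in>FS. 1 / sqrt (a i T))"
  have AB: "sqrt (a i T) \<le> A" "1 / sqrt (a i T) \<le> B" if "i \<in> I" "T \<in> G i" for i T
  proof -
    have *: "(i, T) \<in> FS" using that by (auto simp: FS_def)
    show "sqrt (a i T) \<le> A"
      unfolding A_def using member_le_sum[OF *, of "\<lambda>(i, T). sqrt (a i T)"] FS_finite a_pos
      by (auto simp: FS_def less_imp_le)
    show "1 / sqrt (a i T) \<le> B"
      unfolding B_def using member_le_sum[OF *, of "\<lambda>(i, T). 1 / sqrt (a i T)"] FS_finite a_pos
      by (auto simp: FS_def less_imp_le)
  qed
  show ?thesis
  proof (rule that[of "1 + A * B"])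
    have "0 \<le> A" "0 \<le> B" unfolding A_def B_def using a_pos
      by (auto intro!: sum_nonneg simp: FS_def less_imp_le)
    then show "1 \<le> 1 + A * B" by simp
  next
    fix i T v assume iT: "i \<in> I" "T \<in> G i"
    obtain i' T' where iT': "i' \<in> I" "T' \<in> G i'" and N: "Nmax v = NF T' v" by (rule Nmax_attained)
    define x where "x = a i T * exp (lin_form d T v)"
    define y where "y = a i' T' * exp (lin_form d T' v)"
    have xy: "0 < x" "0 < y" "x \<le> S i v" "y \<le> S i' v"
      using S_ge iT iT' a_pos by (auto simp: x_def y_def)
    have Si: "0 < S i v" by (rule S_pos[OF iT(1)])
    have "q i v * \<rho> i T v = x / (sqrt (S i v) * Z v)"
    proof -
      have "sqrt (S i v) / Z v * (x / S i v) = (sqrt (S i v) / S i v) * x / Z v" by simp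
      also have "sqrt (S i v) / S i v = 1 / sqrt (S i v)"
        using Si by (metis less_imp_le real_sqrt_divide real_div_sqrt divide_divide_eq_right
            divide_self_if mult_1 nonzero_divide_mult_cancel_left real_sqrt_gt_zero order_less_irrefl)
      finally show ?thesis by (simp add: q_def \<rho>_def x_def mult.commute)
    qed
    also have "\<dots> \<le> x / (sqrt x * sqrt y)"
    proof (rule divide_left_mono)
      have "sqrt y \<le> Z v" using Z_ge[OF iT'(1), of v] xy(4) by (meson order_trans real_sqrt_le_mono)
      then show "sqrt x * sqrt y \<le> sqrt (S i v) * Z v"
        using xy by (intro mult_mono) auto
    qed (use xy Si Z_pos in auto)
    also have "\<dots> = sqrt x / sqrt y"
      using xy(1) by (metis divide_divide_eq_left less_imp_le real_div_sqrt)
    also have "\<dots> = (sqrt (a i T) * (1 / sqrt (a i' T'))) * exp (- (Nmax v - NF T v) / 2)"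
    proof -
      have "sqrt (exp t) = exp (t / 2)" for t :: real
        by (rule real_sqrt_unique) (simp_all add: power2_eq_square flip: exp_add)
      then have "sqrt x / sqrt y = sqrt (a i T) / sqrt (a i' T') *
          (exp (lin_form d T v / 2) / exp (lin_form d T' v / 2))"
        by (simp add: x_def y_def real_sqrt_mult)
      also have "exp (lin_form d T v / 2) / exp (lin_form d T' v / 2) = exp (- (Nmax v - NF T v) / 2)"
        unfolding exp_diff[symmetric] lin_form_NF N by (simp add: field_simps)
      finally show ?thesis by simp
    qed
    also have "\<dots> \<le> (1 + A * B) * exp (- (Nmax v - NF T v) / 2)"
    proof (rule mult_right_mono)
      have "sqrt (a i T) * (1 / sqrt (a i' T')) \<le> A * B"
        using AB[OF iT] AB[OF iT'] a_pos[OF iT] a_pos[OF iT'] by (intro mult_mono) (auto intro: order_trans[rotated])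
      then show "sqrt (a i T) * (1 / sqrt (a i' T')) \<le> 1 + A * B" by simp
    qed simp
    finally show "q i v * \<rho> i T v \<le> (1 + A * B) * exp (- (Nmax v - NF T v) / 2)" .
  qed
qed

text \<open>Write \<open>urow d\<close> as a combination of the rows and pair each row with the
  vector (- v, Nmax v). The pairing gives \<open>Nmax v\<close> on \<open>urow d\<close>, the gap
  \<open>Nmax v - NF T v\<close> on the row of \<open>T\<close>, and \<open>- v j\<close> on the row
  of \<open>j\<close>, so one of these quantities must be comparable to
  \<open>Nmax v\<close>.\<close>

lemma inconsistent_bound:
  assumes span: "urow d \<in> fspan (crows A J)" and fin: "finite A" "finite J" and J: "J \<subseteq> Bd"
    and A: "A \<subseteq> (\<Union>i\<in>I. G i)"
  obtains \<Lambda> where "0 < \<Lambda>" "\<And>v. v \<in> D \<Longrightarrow> 0 < Nmax v \<Longrightarrow>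
    (\<exists>T\<in>A. Nmax v \<le> \<Lambda> * (Nmax v - NF T v)) \<or> (\<exists>j\<in>J. Nmax v \<le> \<Lambda> * v j)"
proof -
  have "finite (crows A J)" using fin by (simp add: crows_def)
  then obtain c where c: "\<And>i. urow d i = (\<Sum>g\<in>crows A J. c g * g i)"
    using span by (rule span_certificate) blast
  \<comment> \<open>The summand 1 makes \<open>\<Lambda>\<close> positive and the estimate in the
    contradiction below strict.\<close>
  define \<Lambda> where "\<Lambda> = 1 + (\<Sum>g\<in>crows A J. \<bar>c g\<bar>)"
  have \<Lambda>: "0 < \<Lambda>" unfolding \<Lambda>_def by (rule add_pos_nonneg) (auto intro: sum_nonneg)
  show ?thesis
  proof (rule that[OF \<Lambda>])
    fix v assume v: "v \<in> D" and N: "0 < Nmax v"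
    define \<eta> where "\<eta> g = g d * Nmax v - (\<Sum>i<d. g i * v i)" for g :: "nat \<Rightarrow> real"
    have "Nmax v = urow d d * Nmax v - (\<Sum>i<d. urow d i * v i)"
      by (simp add: urow_def)
    also have "\<dots> = (\<Sum>g\<in>crows A J. c g * \<eta> g)"
      unfolding c \<eta>_def right_diff_distrib sum_subtractf sum_distrib_right sum_distrib_left
      by (subst sum.swap) (simp add: mult.assoc)
    also have "\<dots> \<le> (\<Sum>g\<in>crows A J. \<bar>c g\<bar> * \<bar>\<eta> g\<bar>)"
      by (intro sum_mono) (simp flip: abs_mult)
    finally have le: "Nmax v \<le> (\<Sum>g\<in>crows A J. \<bar>c g\<bar> * \<bar>\<eta> g\<bar>)" .
    have "\<exists>g\<in>crows A J. Nmax v \<le> \<Lambda> * \<bar>\<eta> g\<bar>"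
    proof (rule ccontr)
      assume "\<not> ?thesis"
      then have "\<bar>\<eta> g\<bar> \<le> Nmax v / \<Lambda>" if "g \<in> crows A J" for g
        using that \<Lambda> by (auto simp: field_simps not_le intro: less_imp_le)
      then have "(\<Sum>g\<in>crows A J. \<bar>c g\<bar> * \<bar>\<eta> g\<bar>) \<le> (\<Sum>g\<in>crows A J. \<bar>c g\<bar> * (Nmax v / \<Lambda>))"
        by (intro sum_mono mult_left_mono) auto
      also have "\<dots> = (\<Lambda> - 1) * (Nmax v / \<Lambda>)"
        by (simp only: \<Lambda>_def add_diff_cancel_left' sum_distrib_right)
      also have "\<dots> < Nmax v" using \<Lambda> N by (simp add: field_simps)
      finally show False using le by simp
    qed
    then obtain g where g: "g \<in> crows A J" "Nmax v \<le> \<Lambda> * \<bar>\<eta> g\<bar>" by blast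
    from g(1) consider T where "T \<in> A" "g = frow T" | j where "j \<in> J" "g = urow j"
      by (auto simp: crows_def)
    then show "(\<exists>T\<in>A. Nmax v \<le> \<Lambda> * (Nmax v - NF T v)) \<or> (\<exists>j\<in>J. Nmax v \<le> \<Lambda> * v j)"
    proof cases
      case 1
      have "\<eta> g = Nmax v - NF T v" by (simp add: \<eta>_def 1 frow_def NF_def lin_form_def)
      moreover have "NF T v \<le> Nmax v" using 1 A NF_le_Nmax by blast
      ultimately show ?thesis using 1 g by auto
    next
      case 2
      have "j < d" using 2 J Bd_less by blast
      then have "(\<Sum>i<d. urow j i * v i) = v j"
        by (simp add: urow_def if_distrib[of "\<lambda>x. x * _"] cong: if_cong)
      then have "\<eta> g = - v j" using \<open>j < d\<close> by (simp add: \<eta>_def 2 urow_def)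
      moreover have "0 \<le> v j" using D_Bd_nonneg[OF v] 2 J by blast
      ultimately show ?thesis using 2 g by auto
    qed
  qed
qed

text \<open>The bounds for a weight involve only its forms and its coordinates, and there are
  finitely many such pairs, so one rate and one constant serve weights with any number of repeated
  factors.\<close>

lemma wt_exp_small:
  obtains \<epsilon> C where "0 < \<epsilon>" "\<And>A J Q w v. wt A J Q w \<Longrightarrow> urow d \<in> fspan (crows A J) \<Longrightarrow> v \<in> D \<Longrightarrow>
    0 \<le> Nmax v \<Longrightarrow> w v \<le> C * exp (- \<epsilon> * Nmax v)"
proof -
  obtain C where C: "1 \<le> C" "\<And>i T v. i \<in> I \<Longrightarrow> T \<in> G i \<Longrightarrow> q i v * \<rho> i T v \<le> C * exp (- (Nmax v - NF T v) / 2)"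
    by (rule q_\<rho>_le) blast
  define U where "U = (\<Union>i\<in>I. G i)"
  have U: "finite U" using fin_I fin_G by (auto simp: U_def)
  have Bd: "finite Bd" by (simp add: Bd_def)
  define P where "P = {(A, J). A \<subseteq> U \<and> J \<subseteq> Bd \<and> urow d \<in> fspan (crows A J)}"
  have "P \<subseteq> Pow U \<times> Pow Bd" by (auto simp: P_def)
  then have P: "finite P" using U Bd by (meson finite_Pow_iff finite_SigmaI finite_subset)
  have "\<forall>p\<in>P. \<exists>\<Lambda>>0. \<forall>v\<in>D. 0 < Nmax v \<longrightarrow>
      (\<exists>T\<in>fst p. Nmax v \<le> \<Lambda> * (Nmax v - NF T v)) \<or> (\<exists>j\<in>snd p. Nmax v \<le> \<Lambda> * v j)"
  proof
    fix p assume p: "p \<in> P"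
    obtain A J where AJ: "p = (A, J)" by fastforce
    have "urow d \<in> fspan (crows A J)" "finite A" "finite J" "J \<subseteq> Bd" "A \<subseteq> (\<Union>i\<in>I. G i)"
      using p U Bd AJ by (auto simp: P_def U_def intro: finite_subset)
    from inconsistent_bound[OF this] show "\<exists>\<Lambda>>0. \<forall>v\<in>D. 0 < Nmax v \<longrightarrow>
      (\<exists>T\<in>fst p. Nmax v \<le> \<Lambda> * (Nmax v - NF T v)) \<or> (\<exists>j\<in>snd p. Nmax v \<le> \<Lambda> * v j)"
      unfolding AJ fst_conv snd_conv by metis
  qed
  then obtain \<Lambda> where \<Lambda>: "\<And>p. p \<in> P \<Longrightarrow> 0 < \<Lambda> p" "\<And>p v. p \<in> P \<Longrightarrow> v \<in> D \<Longrightarrow> 0 < Nmax v \<Longrightarrow>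
      (\<exists>T\<in>fst p. Nmax v \<le> \<Lambda> p * (Nmax v - NF T v)) \<or> (\<exists>j\<in>snd p. Nmax v \<le> \<Lambda> p * v j)"
    using bchoice[of P] by metis
  define K where "K = 1 + (\<Sum>p\<in>P. \<Lambda> p)"
  have K: "0 < K" unfolding K_def using \<Lambda>(1) by (intro add_pos_nonneg sum_nonneg) (auto simp: less_imp_le)
  have \<Lambda>K: "\<Lambda> p \<le> K" if "p \<in> P" for p
    using member_le_sum[OF that, of \<Lambda>] \<Lambda>(1) P by (auto simp: K_def less_imp_le)
  show ?thesis
  \<comment> \<open>The 2 is the loss from the square root in \<open>q_\<rho>_le\<close>;
    \<open>K\<close> dominates the constants of all inconsistent pairs.\<close>
  proof (rule that[of "1 / (2 * K)" C])
    show "0 < 1 / (2 * K)" using K by simp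
    fix A J Q w v
    assume w: "wt A J Q w" and sp: "urow d \<in> fspan (crows A J)" and v: "v \<in> D" and N0: "0 \<le> Nmax v"
    note b = wt_bounds[OF w v]
    show "w v \<le> C * exp (- (1 / (2 * K)) * Nmax v)"
    proof (cases "Nmax v = 0")
      case True
      then show ?thesis using b C by simp
    next
      case False
      with N0 have N: "0 < Nmax v" by simp
      have p: "(A, J) \<in> P" using wt_sets[OF w] sp by (auto simp: P_def U_def)
      have main: "\<exists>y. Nmax v \<le> K * y \<and> w v \<le> C * exp (- y / 2)"
        using \<Lambda>(2)[OF p v N]
      proof (elim disjE bexE)
        fix T assume T: "T \<in> fst (A, J)" "Nmax v \<le> \<Lambda> (A, J) * (Nmax v - NF T v)"
        then obtain i where i: "i \<in> I" "T \<in> G i" "w v \<le> q i v * \<rho> i T v" using b by auto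
        have "Nmax v \<le> K * (Nmax v - NF T v)"
          using T(2) mult_right_mono[OF \<Lambda>K[OF p], of "Nmax v - NF T v"] NF_le_Nmax[OF i(1,2), of v] by simp
        then show ?thesis using order_trans[OF i(3) C(2)[OF i(1,2)]] by blast
      next
        fix j assume j: "j \<in> snd (A, J)" "Nmax v \<le> \<Lambda> (A, J) * v j"
        have vj: "0 \<le> v j" using D_Bd_nonneg[OF v] j wt_sets[OF w] by auto
        have "Nmax v \<le> K * v j" using j(2) mult_right_mono[OF \<Lambda>K[OF p] vj] by simp
        moreover have "w v \<le> exp (- v j)" using b j by auto
        moreover have "exp (- v j) \<le> C * exp (- v j / 2)"
          using vj C(1) by (intro order_trans[OF _ mult_right_mono[of 1 C]]) auto
        ultimately show ?thesis by (meson order_trans)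
      qed
      then obtain y where y: "Nmax v \<le> K * y" "w v \<le> C * exp (- y / 2)" by blast
      have "1 / (2 * K) * Nmax v \<le> y / 2" using y(1) K by (simp add: field_simps)
      then have "exp (- y / 2) \<le> exp (- (1 / (2 * K)) * Nmax v)" by simp
      with y(2) C(1) show ?thesis by (meson order_trans mult_left_mono less_imp_le zero_less_one order.strict_trans2)
    qed
  qed
qed

text \<open>\<open>Z\<close> is at least the square root of a maximal term, and each sinh in the
  denominator is at most the exponential of its argument.\<close>

lemma L_lower:
  obtains C where "\<And>v. v \<in> D \<Longrightarrow> Nmax v - C \<le> L v"
proof -
  define C where "C = (\<Sum>(i, T)\<in>FS. \<bar>ln (a i T)\<bar>)"
  show ?thesis
  proof (rule that[of C])
    fix v assume v: "v \<in> D"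
    obtain i T where iT: "i \<in> I" "T \<in> G i" and N: "Nmax v = NF T v" by (rule Nmax_attained)
    have x: "0 < a i T * exp (lin_form d T v)" using a_pos[OF iT] by simp
    have "(i, T) \<in> FS" using iT by (simp add: FS_def)
    then have "\<bar>ln (a i T)\<bar> \<le> C"
      unfolding C_def using member_le_sum[of "(i, T)" FS "\<lambda>(i, T). \<bar>ln (a i T)\<bar>"] FS_finite by auto
    then have "lin_form d T v - C \<le> ln (a i T) + lin_form d T v" by simp
    also have "\<dots> = ln (a i T * exp (lin_form d T v))" using a_pos[OF iT] by (simp add: ln_mult)
    also have "\<dots> \<le> ln (S i v)" using S_ge[OF iT] x S_pos[OF iT(1)] by (subst ln_le_cancel_iff) auto
    also have "\<dots> = 2 * ln (sqrt (S i v))" using S_pos[OF iT(1), of v] by (simp add: ln_sqrt)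
    also have "ln (sqrt (S i v)) \<le> ln (Z v)"
      using Z_ge[OF iT(1), of v] S_pos[OF iT(1), of v] Z_pos[of v] by (subst ln_le_cancel_iff) auto
    finally have 1: "lin_form d T v - C \<le> 2 * ln (Z v)" by simp
    have "(\<Sum>j<n. e j * ln (sinh (v j / 2))) \<le> (\<Sum>j<n. e j * (v j / 2))"
    proof (intro sum_mono mult_left_mono)
      fix j assume "j \<in> {..<n}"
      then have vj: "0 < v j" using v by (auto simp: length_dom_def)
      have "- exp (- (v j / 2)) \<le> exp (v j / 2)" by (rule order_trans[of _ 0]) simp_all
      then have "sinh (v j / 2) \<le> exp (v j / 2)" by (simp add: sinh_field_def)
      then have "ln (sinh (v j / 2)) \<le> ln (exp (v j / 2))"
        using vj by (subst ln_le_cancel_iff) auto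
      then show "ln (sinh (v j / 2)) \<le> v j / 2" by simp
    qed auto
    then have 2: "2 * (\<Sum>j<n. e j * ln (sinh (v j / 2))) \<le> (\<Sum>j<n. e j * v j)"
      by (simp flip: sum_divide_distrib)
    have "0 \<le> 2 * ln (2 :: real)" by simp
    with 1 2 show "Nmax v - C \<le> L v" unfolding L_def N lin_form_NF by linarith
  qed
qed

text \<open>Factoring sinh (x / 2) as exp (x / 2) * (1 - exp(- x)) / 2 isolates the logarithms,
  through which \<open>L\<close> tends to infinity at the x-faces.\<close>

lemma L_upper:
  obtains C where "\<And>v. v \<in> D \<Longrightarrow> L v \<le> Nmax v + C - (\<Sum>j<n. 2 * e j * ln (1 - exp (- v j)))"
proof -
  define A where "A = 1 + (\<Sum>(i, T)\<in>FS. a i T)"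
  have A: "0 < A" unfolding A_def using a_pos
    by (intro add_pos_nonneg sum_nonneg) (auto simp: FS_def less_imp_le)
  define C where "C = 2 * ln 2 + 2 * ln (card I * sqrt A) + (\<Sum>j<n. 2 * e j * ln 2)"
  have I: "0 < card I" using fin_I I_ne by (simp add: card_gt_0_iff)
  show ?thesis
  proof (rule that[of C])
    fix v assume v: "v \<in> D"
    define m where "m = Nmax v + (\<Sum>j<n. e j * v j)"
    have "S i v \<le> A * exp m" if i: "i \<in> I" for i
    proof -
      have "S i v \<le> (\<Sum>T\<in>G i. a i T * exp m)" unfolding S_def lin_form_NF m_def
        using NF_le_Nmax[OF i] a_pos[OF i] by (intro sum_mono mult_left_mono) (auto simp: less_imp_le)
      also have "\<dots> = (\<Sum>T\<in>G i. a i T) * exp m" by (simp add: sum_distrib_right)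
      also have "\<dots> \<le> A * exp m"
      proof (rule mult_right_mono)
        have "(\<Sum>T\<in>G i. a i T) \<le> (\<Sum>i\<in>I. \<Sum>T\<in>G i. a i T)"
          by (rule member_le_sum[OF i, of "\<lambda>i. \<Sum>T\<in>G i. a i T"])
             (use fin_I a_pos in \<open>auto intro!: sum_nonneg simp: less_imp_le\<close>)
        also have "\<dots> = A - 1" unfolding A_def FS_def using fin_I fin_G by (simp add: sum.Sigma)
        finally show "(\<Sum>T\<in>G i. a i T) \<le> A" by simp
      qed simp
      finally show ?thesis .
    qed
    then have "Z v \<le> (\<Sum>i\<in>I. sqrt (A * exp m))" unfolding Z_def by (intro sum_mono) simp
    also have "\<dots> = (card I * sqrt A) * sqrt (exp m)" by (simp add: real_sqrt_mult)
    finally have "ln (Z v) \<le> ln ((card I * sqrt A) * sqrt (exp m))"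
      using Z_pos[of v] A I by (subst ln_le_cancel_iff) auto
    also have "\<dots> = ln (card I * sqrt A) + m / 2" using A I by (simp add: ln_mult ln_sqrt)
    finally have 1: "2 * ln (Z v) \<le> 2 * ln (card I * sqrt A) + m" by simp
    have 2: "2 * (\<Sum>j<n. e j * ln (sinh (v j / 2))) =
      (\<Sum>j<n. e j * v j) + (\<Sum>j<n. 2 * e j * ln (1 - exp (- v j))) - (\<Sum>j<n. 2 * e j * ln 2)"
      unfolding sum_distrib_left sum.distrib[symmetric] sum_subtractf[symmetric]
    proof (intro sum.cong refl)
      fix j assume "j \<in> {..<n}"
      then have vj: "0 < v j" using v by (auto simp: length_dom_def)
      have "exp (v j / 2) * exp (- v j) = exp (- (v j / 2))" by (simp flip: exp_add)
      then have "sinh (v j / 2) = exp (v j / 2) * (1 - exp (- v j)) / 2"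
        by (simp add: sinh_field_def right_diff_distrib)
      then have "ln (sinh (v j / 2)) = ln (exp (v j / 2) * (1 - exp (- v j)) / 2)" by (simp only:)
      also have "\<dots> = v j / 2 + ln (1 - exp (- v j)) - ln 2"
        using vj by (simp add: ln_mult ln_div)
      finally have eq: "ln (sinh (v j / 2)) = v j / 2 + ln (1 - exp (- v j)) - ln 2" .
      show "2 * (e j * ln (sinh (v j / 2))) = e j * v j + 2 * e j * ln (1 - exp (- v j)) - 2 * e j * ln 2"
        unfolding eq by (simp add: algebra_simps)
    qed
    show "L v \<le> Nmax v + C - (\<Sum>j<n. 2 * e j * ln (1 - exp (- v j)))"
      using 1 unfolding L_def 2 C_def m_def by linarith
  qed
qed

end

section \<open>Integrability under linear growth\<close>

lemma poly_le_exp: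
  fixes p :: "real poly" and \<delta> :: real
  assumes "0 < \<delta>"
  shows "\<exists>C. \<forall>x. \<bar>poly p x\<bar> \<le> C * exp (\<delta> * \<bar>x\<bar>)"
  using assms
proof (induction p arbitrary: \<delta>)
  case 0
  then show ?case by (intro exI[of _ 0]) auto
next
  case (pCons a p)
  then obtain C where C: "\<And>x. \<bar>poly p x\<bar> \<le> C * exp (\<delta> / 2 * \<bar>x\<bar>)"
    by (metis half_gt_zero)
  have "\<bar>poly (pCons a p) x\<bar> \<le> (\<bar>a\<bar> + 2 / \<delta> * C) * exp (\<delta> * \<bar>x\<bar>)" for x
  proof -
    have "\<delta> / 2 * \<bar>x\<bar> \<le> exp (\<delta> / 2 * \<bar>x\<bar>)"
      using exp_ge_add_one_self[of "\<delta> / 2 * \<bar>x\<bar>"] by linarith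
    then have x: "\<bar>x\<bar> \<le> 2 / \<delta> * exp (\<delta> / 2 * \<bar>x\<bar>)"
      using pCons.prems by (simp add: field_simps)
    have "\<bar>poly (pCons a p) x\<bar> \<le> \<bar>a\<bar> + \<bar>x\<bar> * \<bar>poly p x\<bar>"
      by (simp flip: abs_mult)
    also have "\<bar>x\<bar> * \<bar>poly p x\<bar> \<le> (2 / \<delta> * exp (\<delta> / 2 * \<bar>x\<bar>)) * (C * exp (\<delta> / 2 * \<bar>x\<bar>))"
      using pCons.prems by (intro mult_mono x C) auto
    also have "\<dots> = 2 / \<delta> * C * (exp (\<delta> / 2 * \<bar>x\<bar>) * exp (\<delta> / 2 * \<bar>x\<bar>))" by simp
    also have "exp (\<delta> / 2 * \<bar>x\<bar>) * exp (\<delta> / 2 * \<bar>x\<bar>) = exp (\<delta> * \<bar>x\<bar>)"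
      by (simp flip: exp_add)
    also have "\<bar>a\<bar> \<le> \<bar>a\<bar> * exp (\<delta> * \<bar>x\<bar>)"
      using pCons.prems mult_left_mono[of 1 "exp (\<delta> * \<bar>x\<bar>)" "\<bar>a\<bar>"] by simp
    finally show ?thesis by (simp add: algebra_simps)
  qed
  then show ?case by blast
qed

lemma poly_borel_measurable [measurable]: "poly p \<in> borel_measurable borel" for p :: "real poly"
  by (intro borel_measurable_continuous_onI continuous_intros)

lemma integrable_even:
  fixes g :: "real \<Rightarrow> real"
  assumes "integrable lborel (\<lambda>x. indicat_real {0..} x * g x)" "\<And>x. g (- x) = g x"
  shows "integrable lborel g"
proof -
  have "integrable lborel (\<lambda>x. indicat_real {0..} (- x) * g (- x))"
    using lborel_integrable_real_affine[OF assms(1), of "-1" 0] by simp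
  then have "integrable lborel (\<lambda>x. indicat_real {0..} x * g x + indicat_real {0..} (- x) * g x)"
    unfolding assms(2) by (rule Bochner_Integration.integrable_add[OF assms(1)])
  then show ?thesis
  proof (rule Bochner_Integration.integrable_cong_AE_imp)
    show "g \<in> borel_measurable lborel"
    proof -
      have "(\<lambda>x. if 0 \<le> x then indicat_real {0..} x * g x else indicat_real {0..} (- x) * g (- x)) \<in> borel_measurable lborel"
        using borel_measurable_integrable[OF assms(1)]
          borel_measurable_integrable[OF \<open>integrable lborel (\<lambda>x. indicat_real {0..} (- x) * g (- x))\<close>]
        by measurable
      moreover have "(\<lambda>x. if 0 \<le> x then indicat_real {0..} x * g x else indicat_real {0..} (- x) * g (- x)) = g"
        using assms(2) by (auto simp: fun_eq_iff)
      ultimately show ?thesis by simp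
    qed
    show "AE x in lborel. indicat_real {0..} x * g x + indicat_real {0..} (- x) * g x = g x"
      using AE_lborel_singleton[of "0::real"] by eventually_elim (auto simp: indicator_def)
  qed
qed

text \<open>Half of the exponential absorbs the polynomial. The negative power is kept only on
  [-1, 1], where it is integrable, and is at most 1 elsewhere.\<close>

lemma poly_exp_powr_integrable:
  fixes p :: "real poly" and \<delta> :: real
  assumes "0 < \<delta>"
  shows "integrable lborel (\<lambda>x. \<bar>poly p x\<bar> * exp (- \<delta> * \<bar>x\<bar>) * (1 + \<bar>x\<bar> powr (- (1 / 2))))"
proof -
  obtain C where C: "\<And>x. \<bar>poly p x\<bar> \<le> C * exp (\<delta> / 2 * \<bar>x\<bar>)"
    using poly_le_exp[of "\<delta> / 2" p] assms by auto
  define h where "h x = 2 * exp (- \<delta> / 2 * \<bar>x\<bar>) + indicat_real {-1..1} x * \<bar>x\<bar> powr (- (1 / 2))" for x :: real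
  have 1: "integrable lborel (\<lambda>x. indicat_real {0..} x * exp (- \<delta> / 2 * x))"
  proof -
    have "(\<lambda>x. exp (- (\<delta> / 2) * x)) integrable_on {0..}"
      using integrable_on_exp_minus_to_infinity[of "\<delta> / 2" 0] assms by simp
    then have "(\<lambda>x. exp (- (\<delta> / 2) * x)) absolutely_integrable_on {0..}"
      by (intro nonnegative_absolutely_integrable_1) auto
    then have "integrable lebesgue (\<lambda>x. indicat_real {0..} x * exp (- (\<delta> / 2) * x))"
      by (simp add: set_integrable_def)
    then show ?thesis by (subst (asm) integrable_completion) simp_all
  qed
  have 2: "integrable lborel (\<lambda>x. indicat_real {0..1} x * x powr (- (1 / 2)))"
  proof -
    have "(\<lambda>x::real. x powr (- (1 / 2))) integrable_on {0..1}"
      by (rule integrable_on_powr_from_0) auto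
    then have "(\<lambda>x::real. x powr (- (1 / 2))) absolutely_integrable_on {0..1}"
      by (intro nonnegative_absolutely_integrable_1) auto
    then have "integrable lebesgue (\<lambda>x::real. indicat_real {0..1} x * x powr (- (1 / 2)))"
      by (simp add: set_integrable_def)
    then show ?thesis by (subst (asm) integrable_completion) simp_all
  qed
  have "integrable lborel (\<lambda>x. 2 * (indicat_real {0..} x * exp (- \<delta> / 2 * x)) + indicat_real {0..1} x * x powr (- (1 / 2)))"
    using 1 2 by (intro Bochner_Integration.integrable_add integrable_mult_right)
  moreover have "(\<lambda>x. 2 * (indicat_real {0..} x * exp (- \<delta> / 2 * x)) + indicat_real {0..1} x * x powr (- (1 / 2))) =
      (\<lambda>x. indicat_real {0..} x * h x)"
    by (auto simp: h_def fun_eq_iff indicator_def)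
  ultimately have "integrable lborel (\<lambda>x. indicat_real {0..} x * h x)" by (simp only:)
  then have h: "integrable lborel h"
    by (rule integrable_even) (auto simp: h_def indicator_def)
  show ?thesis
  proof (rule Bochner_Integration.integrable_bound)
    show "integrable lborel (\<lambda>x. C * h x)" using h by simp
    show "AE x in lborel. norm (\<bar>poly p x\<bar> * exp (- \<delta> * \<bar>x\<bar>) * (1 + \<bar>x\<bar> powr (- (1 / 2)))) \<le> norm (C * h x)"
    proof (rule AE_I2)
      fix x :: real
      have C0: "0 \<le> C" using C[of 0] by simp
      have "\<bar>poly p x\<bar> * exp (- \<delta> * \<bar>x\<bar>) \<le> (C * exp (\<delta> / 2 * \<bar>x\<bar>)) * exp (- \<delta> * \<bar>x\<bar>)"
        by (intro mult_right_mono C) auto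
      also have "\<dots> = C * exp (- \<delta> / 2 * \<bar>x\<bar>)"
        by (simp add: mult.assoc flip: exp_add)
      finally have "\<bar>poly p x\<bar> * exp (- \<delta> * \<bar>x\<bar>) * (1 + \<bar>x\<bar> powr (- (1 / 2))) \<le>
          C * exp (- \<delta> / 2 * \<bar>x\<bar>) * (1 + \<bar>x\<bar> powr (- (1 / 2)))"
        by (rule mult_right_mono) auto
      also have "\<dots> = C * (exp (- \<delta> / 2 * \<bar>x\<bar>) * (1 + \<bar>x\<bar> powr (- (1 / 2))))" by simp
      also have "\<dots> \<le> C * h x"
      proof (rule mult_left_mono[OF _ C0])
        define E where "E = exp (- \<delta> / 2 * \<bar>x\<bar>)"
        define P where "P = \<bar>x\<bar> powr (- (1 / 2))"
        have E: "0 \<le> E" "E \<le> 1" using assms by (auto simp: E_def)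
        have P: "0 \<le> P" by (simp add: P_def)
        have "E * P \<le> E + indicat_real {-1..1} x * P"
        proof (cases "\<bar>x\<bar> \<le> 1")
          case True
          then have "indicat_real {-1..1} x = 1" by (auto simp: indicator_def)
          moreover have "E * P \<le> P" using E P by (intro mult_left_le_one_le) auto
          ultimately show ?thesis using E(1) by simp
        next
          case False
          then have "1 \<le> \<bar>x\<bar> powr (1 / 2)" by (intro ge_one_powr_ge_zero) auto
          then have "P \<le> 1" unfolding P_def powr_minus_divide by (auto simp: divide_le_eq_1)
          then have "E * P \<le> E" using E P by (intro mult_left_le) auto
          then show ?thesis using P by (simp add: indicator_def)
        qed
        then show "exp (- \<delta> / 2 * \<bar>x\<bar>) * (1 + \<bar>x\<bar> powr (- (1 / 2))) \<le> h x"
          unfolding h_def E_def[symmetric] P_def[symmetric] by (simp add: algebra_simps)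
      qed
      finally have "\<bar>poly p x\<bar> * exp (- \<delta> * \<bar>x\<bar>) * (1 + \<bar>x\<bar> powr (- (1 / 2))) \<le> C * h x" .
      then show "norm (\<bar>poly p x\<bar> * exp (- \<delta> * \<bar>x\<bar>) * (1 + \<bar>x\<bar> powr (- (1 / 2)))) \<le> norm (C * h x)"
        by (intro order_trans[OF _ abs_ge_self[of "C * h x", folded real_norm_def]]) (simp add: abs_mult)
    qed
  qed measurable
qed

text \<open>\<open>growth\<close> is the form in which properness is used throughout; it is derived
  from boundedness of sublevel sets at the end. Nonnegativity of \<open>L\<close> places every
  push-forward on [0, \<infinity>).\<close>

locale proper_form = length_form +
  fixes c :: real
  assumes c_pos: "0 < c"
    and growth: "\<And>v. v \<in> D \<Longrightarrow> c * (\<Sum>j<d. \<bar>v j\<bar>) \<le> Nmax v"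
    and L_nonneg: "\<And>v. v \<in> D \<Longrightarrow> 0 \<le> L v"
begin

definition "pf f v = (\<Prod>i<d. poly (f i) (v i))" for f :: "nat \<Rightarrow> real poly" and v :: "nat \<Rightarrow> real"

definition "sub b = {v \<in> D. L v \<le> b}"
text \<open>The distribution function of the push-forward of \<open>W\<close> by \<open>L\<close>.
  Signed push-forwards are handled through it, and \<open>adm\<close> says that they are finite on
  bounded sets.\<close>

definition "V W b = (\<integral>v. indicat_real (sub b) v * W v \<partial>M)"
definition "adm W \<longleftrightarrow> W \<in> borel_measurable M \<and> (\<forall>b. integrable M (\<lambda>v. indicat_real (sub b) v * W v))"

lemma D_sets [measurable]: "D \<in> sets M"
proof -
  have "D = {v \<in> space M. (\<forall>j<n. 0 < v j) \<and> (\<forall>j\<in>{2 * n..<d}. 0 \<le> v j)}"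
    by (auto simp: length_dom_def space_PiM)
  also have "\<dots> \<in> sets M"
  proof (intro sets.sets_Collect_conj)
    have "{v \<in> space M. \<forall>j\<in>{..<n}. 0 < v j} \<in> sets M"
      by (intro sets.sets_Collect_finite_All) (auto intro!: borel_measurable_less)
    then show "{v \<in> space M. \<forall>j<n. 0 < v j} \<in> sets M" by (simp add: Ball_def)
    show "{v \<in> space M. \<forall>j\<in>{2 * n..<d}. 0 \<le> v j} \<in> sets M"
      by (intro sets.sets_Collect_finite_All) (auto intro!: borel_measurable_le)
  qed
  finally show ?thesis .
qed

lemma D_space: "D \<subseteq> space M"
  by (auto simp: length_dom_def space_PiM)

lemma sub_sets [measurable]: "sub b \<in> sets M"
proof -
  have "sub b = D \<inter> {v \<in> space M. L v \<le> b}" using D_space by (auto simp: sub_def)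
  then show ?thesis by simp
qed

lemma pf_measurable [measurable]: "pf f \<in> borel_measurable M"
  unfolding pf_def[abs_def]
proof (rule borel_measurable_prod)
  fix i assume "i \<in> {..<d}"
  then have [measurable]: "(\<lambda>v. v i) \<in> borel_measurable M" by auto
  show "(\<lambda>v. poly (f i) (v i)) \<in> borel_measurable M" by measurable
qed

text \<open>The majorant is a product of functions of one variable, which reduces integrability to
  the single coordinates.\<close>

lemma integrable_dominated:
  fixes \<delta> C :: real
  assumes "0 < \<delta>" and [measurable]: "W \<in> borel_measurable M" and A: "A \<subseteq> D" "A \<in> sets M"
    and bnd: "\<And>v. v \<in> A \<Longrightarrow> \<bar>W v\<bar> \<le> C * \<bar>pf f v\<bar> * exp (- \<delta> * (\<Sum>j<d. \<bar>v j\<bar>)) * (\<Prod>j<n. 1 + \<bar>v j\<bar> powr (- (1 / 2)))"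
  shows "integrable M (\<lambda>v. indicat_real A v * W v)"
proof (rule Bochner_Integration.integrable_bound)
  interpret product_sigma_finite "\<lambda>_. lborel :: real measure" ..
  define g where "g i x = \<bar>poly (f i) x\<bar> * exp (- \<delta> * \<bar>x\<bar>) * (1 + \<bar>x\<bar> powr (- (1 / 2)))" for i x
  show "integrable M (\<lambda>v. \<bar>C\<bar> * (\<Prod>i<d. g i (v i)))"
    unfolding g_def
    by (intro integrable_mult_right product_integrable_prod poly_exp_powr_integrable assms) auto
  show "AE v in M. norm (indicat_real A v * W v) \<le> norm (\<bar>C\<bar> * (\<Prod>i<d. g i (v i)))"
  proof (rule AE_I2)
    fix v
    have "\<bar>W v\<bar> \<le> \<bar>C\<bar> * (\<Prod>i<d. g i (v i))" if "v \<in> A"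
    proof -
      \<comment> \<open>Giving every coordinate a singular factor lets the same kind of one-variable
        function serve all of them.\<close>
      have "(\<Prod>j<n. 1 + \<bar>v j\<bar> powr (- (1 / 2))) \<le> (\<Prod>j<d. 1 + \<bar>v j\<bar> powr (- (1 / 2)))"
        by (rule prod_mono2) auto
      then have "C * \<bar>pf f v\<bar> * exp (- \<delta> * (\<Sum>j<d. \<bar>v j\<bar>)) * (\<Prod>j<n. 1 + \<bar>v j\<bar> powr (- (1 / 2))) \<le>
          \<bar>C\<bar> * \<bar>pf f v\<bar> * exp (- \<delta> * (\<Sum>j<d. \<bar>v j\<bar>)) * (\<Prod>j<d. 1 + \<bar>v j\<bar> powr (- (1 / 2)))"
        by (intro mult_mono) (auto intro!: prod_nonneg)
      also have "\<dots> = \<bar>C\<bar> * (\<Prod>i<d. g i (v i))"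
        unfolding g_def pf_def prod.distrib abs_prod sum_distrib_left exp_sum[OF finite_lessThan] by simp
      finally show ?thesis using bnd[OF that] by simp
    qed
    moreover have "0 \<le> (\<Prod>i<d. g i (v i))" by (auto intro!: prod_nonneg simp: g_def)
    ultimately show "norm (indicat_real A v * W v) \<le> norm (\<bar>C\<bar> * (\<Prod>i<d. g i (v i)))"
      by (auto simp: indicator_def abs_mult)
  qed
  show "(\<lambda>v. indicat_real A v * W v) \<in> borel_measurable M" using A by measurable
qed

lemma prod_powr_ge_1: fixes v :: "nat \<Rightarrow> real" shows "1 \<le> (\<Prod>j<n. 1 + \<bar>v j\<bar> powr (- (1 / 2)))"
  using prod_mono[of "{..<n}" "\<lambda>_. 1" "\<lambda>j. 1 + \<bar>v j\<bar> powr (- (1 / 2))"] by simp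

text \<open>By \<open>growth\<close> and \<open>L_lower\<close> a sublevel set of \<open>L\<close>
  is bounded, so a decaying exponential can be inserted there at the cost of a constant
  factor.\<close>

lemma adm_bounded:
  assumes [measurable]: "W \<in> borel_measurable M" and bnd: "\<And>v. v \<in> D \<Longrightarrow> \<bar>W v\<bar> \<le> C * \<bar>pf f v\<bar>"
  shows "adm W"
  unfolding adm_def
proof (intro conjI allI assms(1))
  fix b
  obtain C1 where C1: "\<And>v. v \<in> D \<Longrightarrow> Nmax v - C1 \<le> L v" by (rule L_lower) blast
  show "integrable M (\<lambda>v. indicat_real (sub b) v * W v)"
  proof (rule integrable_dominated[OF c_pos assms(1)])
    fix v assume v: "v \<in> sub b"
    then have vD: "v \<in> D" by (simp add: sub_def)
    have "c * (\<Sum>j<d. \<bar>v j\<bar>) \<le> b + C1"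
      using growth[OF vD] C1[OF vD] v by (simp add: sub_def)
    then have "1 \<le> exp (b + C1) * exp (- c * (\<Sum>j<d. \<bar>v j\<bar>))"
      by (simp flip: exp_add)
    then have "1 * 1 \<le> exp (b + C1) * exp (- c * (\<Sum>j<d. \<bar>v j\<bar>)) * (\<Prod>j<n. 1 + \<bar>v j\<bar> powr (- (1 / 2)))"
      by (intro mult_mono prod_powr_ge_1) auto
    then have "\<bar>W v\<bar> * 1 \<le> \<bar>W v\<bar> * (exp (b + C1) * exp (- c * (\<Sum>j<d. \<bar>v j\<bar>)) * (\<Prod>j<n. 1 + \<bar>v j\<bar> powr (- (1 / 2))))"
      by (intro mult_left_mono) auto
    also have "\<dots> \<le> (C * \<bar>pf f v\<bar>) * (exp (b + C1) * exp (- c * (\<Sum>j<d. \<bar>v j\<bar>)) * (\<Prod>j<n. 1 + \<bar>v j\<bar> powr (- (1 / 2))))"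
      by (intro mult_right_mono bnd vD) (auto intro!: mult_nonneg_nonneg prod_nonneg)
    finally show "\<bar>W v\<bar> \<le> (C * exp (b + C1)) * \<bar>pf f v\<bar> * exp (- c * (\<Sum>j<d. \<bar>v j\<bar>)) * (\<Prod>j<n. 1 + \<bar>v j\<bar> powr (- (1 / 2)))"
      by (simp add: mult_ac)
  qed (auto simp: sub_def)
qed

text \<open>The factor exp (\<epsilon> * L) costs exp (\<epsilon> * Nmax), which the faster decay of
  \<open>w\<close> pays for, and a singularity at each x-face, which is integrable under the last
  condition on \<open>\<epsilon>\<close>.\<close>

lemma integrable_exp_small:
  fixes \<epsilon> \<epsilon>0 C :: real
  assumes [measurable]: "w \<in> borel_measurable M"
    and bnd: "\<And>v. v \<in> D \<Longrightarrow> \<bar>w v\<bar> \<le> C * exp (- \<epsilon>0 * Nmax v)"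
    and \<epsilon>: "0 < \<epsilon>" "\<epsilon> < \<epsilon>0" "\<And>j. j < n \<Longrightarrow> 2 * e j * \<epsilon> \<le> 1 / 2"
  shows "integrable M (\<lambda>v. indicat_real D v * (w v * pf f v * exp (\<epsilon> * L v)))"
proof -
  obtain C2 where C2: "\<And>v. v \<in> D \<Longrightarrow> L v \<le> Nmax v + C2 - (\<Sum>j<n. 2 * e j * ln (1 - exp (- v j)))"
    by (rule L_upper) blast
  show ?thesis
  proof (rule integrable_dominated)
    show "0 < (\<epsilon>0 - \<epsilon>) * c" using \<epsilon> c_pos by simp
    show "(\<lambda>v. w v * pf f v * exp (\<epsilon> * L v)) \<in> borel_measurable M" by measurable
    fix v assume v: "v \<in> D"
    have "\<epsilon> * L v \<le> \<epsilon> * (Nmax v + C2 - (\<Sum>j<n. 2 * e j * ln (1 - exp (- v j))))"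
      using C2[OF v] \<epsilon>(1) by (intro mult_left_mono) auto
    also have "\<dots> = \<epsilon> * Nmax v + \<epsilon> * C2 + (\<Sum>j<n. - (2 * e j * \<epsilon>) * ln (1 - exp (- v j)))"
      by (simp add: algebra_simps sum_distrib_left sum_negf)
    also have "(\<Sum>j<n. - (2 * e j * \<epsilon>) * ln (1 - exp (- v j))) \<le> (\<Sum>j<n. ln (1 + \<bar>v j\<bar> powr (- (1 / 2))))"
    proof (rule sum_mono)
      fix j assume j: "j \<in> {..<n}"
      then have "0 < v j" using v by (auto simp: length_dom_def)
      with minus_ln_one_minus_exp_le[of "v j" "2 * e j * \<epsilon>"] \<epsilon>(1) \<epsilon>(3)[of j] j
      show "- (2 * e j * \<epsilon>) * ln (1 - exp (- v j)) \<le> ln (1 + \<bar>v j\<bar> powr (- (1 / 2)))" by simp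
    qed
    also have "\<dots> = ln (\<Prod>j<n. 1 + \<bar>v j\<bar> powr (- (1 / 2)))"
      by (rule ln_prod[symmetric]) (simp, smt (verit) powr_ge_zero)
    finally have "\<epsilon> * L v \<le> \<epsilon> * Nmax v + \<epsilon> * C2 + ln (\<Prod>j<n. 1 + \<bar>v j\<bar> powr (- (1 / 2)))" by simp
    then have "exp (\<epsilon> * L v) \<le> exp (\<epsilon> * Nmax v + \<epsilon> * C2 + ln (\<Prod>j<n. 1 + \<bar>v j\<bar> powr (- (1 / 2))))" by simp
    also have "\<dots> = exp (\<epsilon> * Nmax v) * exp (\<epsilon> * C2) * (\<Prod>j<n. 1 + \<bar>v j\<bar> powr (- (1 / 2)))"
      using prod_powr_ge_1[of v] by (simp add: exp_add)
    finally have "\<bar>w v\<bar> * exp (\<epsilon> * L v) \<le>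
        (C * exp (- \<epsilon>0 * Nmax v)) * (exp (\<epsilon> * Nmax v) * exp (\<epsilon> * C2) * (\<Prod>j<n. 1 + \<bar>v j\<bar> powr (- (1 / 2))))"
      using bnd[OF v] by (intro mult_mono) auto
    also have "\<dots> = C * exp (\<epsilon> * C2) * exp (- (\<epsilon>0 - \<epsilon>) * Nmax v) * (\<Prod>j<n. 1 + \<bar>v j\<bar> powr (- (1 / 2)))"
    proof -
      have "exp (- \<epsilon>0 * Nmax v) * exp (\<epsilon> * Nmax v) = exp (- (\<epsilon>0 - \<epsilon>) * Nmax v)"
        by (simp add: algebra_simps flip: exp_add)
      then show ?thesis by (simp add: mult_ac)
    qed
    also have "\<dots> \<le> C * exp (\<epsilon> * C2) * exp (- ((\<epsilon>0 - \<epsilon>) * c) * (\<Sum>j<d. \<bar>v j\<bar>)) * (\<Prod>j<n. 1 + \<bar>v j\<bar> powr (- (1 / 2)))"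
    proof (intro mult_right_mono mult_left_mono)
      have "(\<epsilon>0 - \<epsilon>) * (c * (\<Sum>j<d. \<bar>v j\<bar>)) \<le> (\<epsilon>0 - \<epsilon>) * Nmax v"
        using growth[OF v] \<epsilon> by (intro mult_left_mono) auto
      then show "exp (- (\<epsilon>0 - \<epsilon>) * Nmax v) \<le> exp (- ((\<epsilon>0 - \<epsilon>) * c) * (\<Sum>j<d. \<bar>v j\<bar>))"
        by (simp add: algebra_simps)
      have "0 \<le> C * exp (- \<epsilon>0 * Nmax v)" using bnd[OF v] by (meson abs_ge_zero order_trans)
      then have "0 \<le> C" by (simp add: zero_le_mult_iff)
      then show "0 \<le> C * exp (\<epsilon> * C2)" by simp
    qed (use prod_powr_ge_1[of v] in auto)
    finally have *: "\<bar>w v\<bar> * exp (\<epsilon> * L v) \<le> C * exp (\<epsilon> * C2) * exp (- ((\<epsilon>0 - \<epsilon>) * c) * (\<Sum>j<d. \<bar>v j\<bar>)) *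
        (\<Prod>j<n. 1 + \<bar>v j\<bar> powr (- (1 / 2)))" .
    have "\<bar>w v * pf f v * exp (\<epsilon> * L v)\<bar> = (\<bar>w v\<bar> * exp (\<epsilon> * L v)) * \<bar>pf f v\<bar>"
      by (simp add: abs_mult)
    also have "\<dots> \<le> (C * exp (\<epsilon> * C2) * exp (- ((\<epsilon>0 - \<epsilon>) * c) * (\<Sum>j<d. \<bar>v j\<bar>)) *
        (\<Prod>j<n. 1 + \<bar>v j\<bar> powr (- (1 / 2)))) * \<bar>pf f v\<bar>"
      by (intro mult_right_mono *) auto
    finally show "\<bar>w v * pf f v * exp (\<epsilon> * L v)\<bar> \<le> (C * exp (\<epsilon> * C2)) * \<bar>pf f v\<bar> *
        exp (- ((\<epsilon>0 - \<epsilon>) * c) * (\<Sum>j<d. \<bar>v j\<bar>)) * (\<Prod>j<n. 1 + \<bar>v j\<bar> powr (- (1 / 2)))"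
      by (simp add: mult_ac)
  qed (auto simp: D_sets)
qed

end

section \<open>Absolute continuity of the push-forward\<close>

text \<open>The inverse function is differentiable, and differentiable maps send null sets to null
  sets.\<close>

lemma negligible_preimage_inj:
  fixes \<phi> \<phi>' :: "real \<Rightarrow> real"
  assumes "open S" "inj_on \<phi> S" "\<And>x. x \<in> S \<Longrightarrow> (\<phi> has_real_derivative \<phi>' x) (at x)"
    "\<And>x. x \<in> S \<Longrightarrow> \<phi>' x \<noteq> 0" "negligible B"
  shows "negligible {x \<in> S. \<phi> x \<in> B}"
proof -
  define g where "g = the_inv_into S \<phi>"
  have g: "g (\<phi> x) = x" if "x \<in> S" for x
    unfolding g_def by (rule the_inv_into_f_f[OF assms(2) that])
  have cont: "continuous_on S \<phi>"
    using assms(1,3) by (meson DERIV_isCont continuous_at_imp_continuous_on)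
  have "g differentiable (at (\<phi> x))" if x: "x \<in> S" for x
  proof -
    have "(g has_derivative (\<lambda>z. z / \<phi>' x)) (at (\<phi> x))"
    proof (rule has_derivative_inverse_strong[OF assms(1) x cont g])
      show "(\<phi> has_derivative (\<lambda>z. \<phi>' x * z)) (at x)"
        using assms(3)[OF x] by (simp add: has_field_derivative_def)
      show "(\<lambda>z. \<phi>' x * z) \<circ> (\<lambda>z. z / \<phi>' x) = id" using assms(4)[OF x] by auto
    qed
    then show ?thesis by (auto simp: differentiable_def)
  qed
  then have "g differentiable_on (B \<inter> \<phi> ` S)"
    by (auto simp: differentiable_on_def intro: differentiable_at_withinI)
  then have "negligible (g ` (B \<inter> \<phi> ` S))"
    by (intro negligible_differentiable_image_negligible negligible_subset[OF assms(5)]) auto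
  moreover have "{x \<in> S. \<phi> x \<in> B} = g ` (B \<inter> \<phi> ` S)"
    using g by force
  ultimately show ?thesis by simp
qed

text \<open>Away from the critical points the domain is covered by countably many rational intervals
  on which the derivative has constant sign, so the function is injective on each; the critical
  points themselves form a null set.\<close>

lemma negligible_preimage:
  fixes \<phi> \<phi>' :: "real \<Rightarrow> real"
  assumes "open S" and der: "\<And>x. x \<in> S \<Longrightarrow> (\<phi> has_real_derivative \<phi>' x) (at x)"
    and cont: "continuous_on S \<phi>'" and cnt: "countable {x \<in> S. \<phi>' x = 0}" and "negligible B"
  shows "negligible {x \<in> S. \<phi> x \<in> B}"
proof -
  define P where "P = {(p, q). p \<in> \<rat> \<and> q \<in> \<rat> \<and> {p<..<q} \<subseteq> S \<and>
    ((\<forall>x\<in>{p<..<q}. 0 < \<phi>' x) \<or> (\<forall>x\<in>{p<..<q}. \<phi>' x < 0))}"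
  have "P \<subseteq> \<rat> \<times> \<rat>" by (auto simp: P_def)
  then have P: "countable P" using countable_rat by (meson countable_SIGMA countable_subset)
  have int: "negligible {x \<in> {p<..<q}. \<phi> x \<in> B}" if "(p, q) \<in> P" for p q
  proof (rule negligible_preimage_inj)
    have pq: "{p<..<q} \<subseteq> S" and sgn: "(\<forall>x\<in>{p<..<q}. 0 < \<phi>' x) \<or> (\<forall>x\<in>{p<..<q}. \<phi>' x < 0)"
      using that by (auto simp: P_def)
    show "\<And>x. x \<in> {p<..<q} \<Longrightarrow> (\<phi> has_real_derivative \<phi>' x) (at x)" using der pq by auto
    show "\<And>x. x \<in> {p<..<q} \<Longrightarrow> \<phi>' x \<noteq> 0" using sgn by force
    have ne: "\<phi> x \<noteq> \<phi> y" if xy: "x \<in> {p<..<q}" "y \<in> {p<..<q}" "x < y" for x y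
      using sgn
    proof
      assume pos: "\<forall>x\<in>{p<..<q}. 0 < \<phi>' x"
      have "\<phi> x < \<phi> y"
      proof (rule DERIV_pos_imp_increasing[OF xy(3)])
        fix z assume "x \<le> z" "z \<le> y"
        then have "z \<in> {p<..<q}" using xy by auto
        then show "\<exists>l. (\<phi> has_real_derivative l) (at z) \<and> 0 < l" using pos der pq by blast
      qed
      then show ?thesis by simp
    next
      assume neg: "\<forall>x\<in>{p<..<q}. \<phi>' x < 0"
      have "\<phi> y < \<phi> x"
      proof (rule DERIV_neg_imp_decreasing[OF xy(3)])
        fix z assume "x \<le> z" "z \<le> y"
        then have "z \<in> {p<..<q}" using xy by auto
        then show "\<exists>l. (\<phi> has_real_derivative l) (at z) \<and> l < 0" using neg der pq by blast
      qed
      then show ?thesis by simp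
    qed
    show "inj_on \<phi> {p<..<q}"
    proof (rule inj_onI, rule ccontr)
      fix x y assume "x \<in> {p<..<q}" "y \<in> {p<..<q}" "\<phi> x = \<phi> y" "x \<noteq> y"
      then show False using ne[of x y] ne[of y x] by (cases "x < y") auto
    qed
  qed (use assms in auto)
  have "{x \<in> S. \<phi> x \<in> B} \<subseteq> {x \<in> S. \<phi>' x = 0} \<union> (\<Union>(p, q)\<in>P. {x \<in> {p<..<q}. \<phi> x \<in> B})"
  proof
    fix x assume x: "x \<in> {x \<in> S. \<phi> x \<in> B}"
    show "x \<in> {x \<in> S. \<phi>' x = 0} \<union> (\<Union>(p, q)\<in>P. {x \<in> {p<..<q}. \<phi> x \<in> B})"
    proof (cases "\<phi>' x = 0")
      case False
      define U where "U = S \<inter> \<phi>' -` (if 0 < \<phi>' x then {0<..} else {..<0})"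
      have "open U" unfolding U_def by (rule continuous_open_preimage[OF cont assms(1)]) auto
      moreover have "x \<in> U" using x False by (auto simp: U_def)
      ultimately obtain \<delta> where \<delta>: "0 < \<delta>" "ball x \<delta> \<subseteq> U" by (meson openE)
      obtain p where p: "p \<in> \<rat>" "x - \<delta> < p" "p < x" using Rats_dense_in_real[of "x - \<delta>" x] \<delta> by auto
      obtain q where q: "q \<in> \<rat>" "x < q" "q < x + \<delta>" using Rats_dense_in_real[of x "x + \<delta>"] \<delta> by auto
      have "{p<..<q} \<subseteq> ball x \<delta>" using p q by (auto simp: dist_real_def)
      then have "{p<..<q} \<subseteq> U" using \<delta> by auto
      then have "(p, q) \<in> P" using p q by (auto simp: P_def U_def split: if_splits)
      then show ?thesis using x p q by auto
    qed (use x in auto)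
  qed
  moreover have "negligible ({x \<in> S. \<phi>' x = 0} \<union> (\<Union>(p, q)\<in>P. {x \<in> {p<..<q}. \<phi> x \<in> B}))"
  proof (rule negligible_Un)
    show "negligible {x \<in> S. \<phi>' x = 0}" 
      using countable_imp_null_set_lborel[OF cnt] by (simp add: negligible_iff_null_sets null_sets_completionI)
    show "negligible (\<Union>(p, q)\<in>P. {x \<in> {p<..<q}. \<phi> x \<in> B})"
      by (rule negligible_countable_Union) (use P int in auto)
  qed
  ultimately show ?thesis by (rule negligible_subset[rotated])
qed

text \<open>The deviations from the mean average to 0, so a constant may be subtracted from the last
  factor.\<close>

lemma weighted_variance:
  fixes p x :: "'a \<Rightarrow> real"
  assumes "(\<Sum>i\<in>A. p i) = 1" "m = (\<Sum>i\<in>A. p i * x i)"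
  shows "(\<Sum>i\<in>A. p i * (x i - m) * x i) = (\<Sum>i\<in>A. p i * (x i - m)\<^sup>2)"
proof -
  have "(\<Sum>i\<in>A. p i * (x i - m)\<^sup>2) = (\<Sum>i\<in>A. p i * (x i - m) * x i) - m * (\<Sum>i\<in>A. p i * (x i - m))"
    unfolding sum_distrib_left sum_subtractf[symmetric]
    by (intro sum.cong) (auto simp: power2_eq_square algebra_simps)
  also have "(\<Sum>i\<in>A. p i * (x i - m)) = (\<Sum>i\<in>A. p i * x i) - m * (\<Sum>i\<in>A. p i)"
    by (simp add: right_diff_distrib sum_subtractf sum_distrib_left mult.commute)
  also have "\<dots> = 0" using assms by simp
  finally show ?thesis by simp
qed

context length_form
begin

definition "var r i v = (\<Sum>T\<in>G i. \<rho> i T v * (T r - \<mu> r i v)\<^sup>2)"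
text \<open>The second derivative of 2 * ln Z in coordinate \<open>r\<close>: half the variance
  between the groups plus the mean variance inside them. The factor 1/2 stems from the square
  roots.\<close>

definition "dnu r v = (\<Sum>i\<in>I. q i v * (\<mu> r i v - \<nu> r v)\<^sup>2) / 2 + (\<Sum>i\<in>I. q i v * var r i v)"

lemma pd_\<mu>:
  assumes "r < d" "i \<in> I" shows "pd r (\<mu> r i) (var r i)"
proof -
  have "pd r (\<lambda>v. \<Sum>T\<in>G i. \<rho> i T v * T r) (\<lambda>v. \<Sum>T\<in>G i. \<rho> i T v * (T r - \<mu> r i v) * T r)"
  proof (rule pd_sum, rule pdI)
    fix T v assume "T \<in> G i" and v: "v \<in> Dx"
    then show "((\<lambda>x. \<rho> i T (v(r := x)) * T r) has_real_derivative \<rho> i T v * (T r - \<mu> r i v) * T r) (at (v r))"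
      using DERIV_cmult_right[OF pdD[OF pd_\<rho>[OF assms] v]] by simp
  qed
  moreover have "\<mu> r i = (\<lambda>v. \<Sum>T\<in>G i. \<rho> i T v * T r)" by (simp add: fun_eq_iff \<mu>_def)
  ultimately have "pd r (\<mu> r i) (\<lambda>v. \<Sum>T\<in>G i. \<rho> i T v * (T r - \<mu> r i v) * T r)" by (simp only:)
  then show ?thesis
    by (rule pd_cong) (simp add: var_def weighted_variance sum_\<rho>[OF assms(2)] \<mu>_def)
qed

lemma pd_\<nu>:
  assumes "r < d" shows "pd r (\<nu> r) (dnu r)"
proof -
  have "pd r (\<lambda>v. \<Sum>i\<in>I. q i v * \<mu> r i v)
     (\<lambda>v. \<Sum>i\<in>I. q i v * ((\<mu> r i v - \<nu> r v) / 2) * \<mu> r i v + q i v * var r i v)"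
    by (intro pd_sum pd_mult pd_q pd_\<mu> assms)
  moreover have "\<nu> r = (\<lambda>v. \<Sum>i\<in>I. q i v * \<mu> r i v)" by (simp add: fun_eq_iff \<nu>_def)
  ultimately have "pd r (\<nu> r)
     (\<lambda>v. \<Sum>i\<in>I. q i v * ((\<mu> r i v - \<nu> r v) / 2) * \<mu> r i v + q i v * var r i v)" by (simp only:)
  then show ?thesis
  proof (rule pd_cong)
    fix v
    have "(\<Sum>i\<in>I. q i v * ((\<mu> r i v - \<nu> r v) / 2) * \<mu> r i v) = (\<Sum>i\<in>I. q i v * (\<mu> r i v - \<nu> r v) * \<mu> r i v) / 2"
      by (simp add: sum_divide_distrib)
    also have "(\<Sum>i\<in>I. q i v * (\<mu> r i v - \<nu> r v) * \<mu> r i v) = (\<Sum>i\<in>I. q i v * (\<mu> r i v - \<nu> r v)\<^sup>2)"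
      by (rule weighted_variance[OF sum_q]) (simp add: \<nu>_def)
    finally show "(\<Sum>i\<in>I. q i v * ((\<mu> r i v - \<nu> r v) / 2) * \<mu> r i v + q i v * var r i v) = dnu r v"
      by (simp add: dnu_def sum.distrib)
  qed
qed

lemma dnu_nonneg: "0 \<le> dnu r v"
  unfolding dnu_def var_def using q_pos \<rho>_pos
  by (intro add_nonneg_nonneg divide_nonneg_nonneg sum_nonneg mult_nonneg_nonneg) (auto simp: less_imp_le)

text \<open>All weights are positive, so vanishing of both variances forces every form to have the
  same coefficient in coordinate \<open>r\<close>.\<close>

lemma dnu_pos:
  assumes "i1 \<in> I" "T1 \<in> G i1" "i2 \<in> I" "T2 \<in> G i2" "T1 r \<noteq> T2 r"
  shows "0 < dnu r v"
proof (rule ccontr)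
  assume "\<not> 0 < dnu r v"
  then have 0: "dnu r v = 0" using dnu_nonneg[of r v] by simp
  have var: "0 \<le> var r i v" if "i \<in> I" for i
    unfolding var_def using \<rho>_pos that by (intro sum_nonneg mult_nonneg_nonneg) (auto simp: less_imp_le)
  have a1: "0 \<le> (\<Sum>i\<in>I. q i v * (\<mu> r i v - \<nu> r v)\<^sup>2)" and a2: "0 \<le> (\<Sum>i\<in>I. q i v * var r i v)"
    using q_pos var by (auto intro!: sum_nonneg mult_nonneg_nonneg simp: less_imp_le)
  have s1: "(\<Sum>i\<in>I. q i v * (\<mu> r i v - \<nu> r v)\<^sup>2) = 0" and s2: "(\<Sum>i\<in>I. q i v * var r i v) = 0"
    using 0 a1 a2 unfolding dnu_def by linarith+
  have "T r = \<nu> r v" if iT: "i \<in> I" "T \<in> G i" for i T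
  proof -
    have "q i v * (\<mu> r i v - \<nu> r v)\<^sup>2 = 0"
      using s1 iT(1) fin_I q_pos by (subst (asm) sum_nonneg_eq_0_iff) (auto simp: less_imp_le)
    then have 1: "\<mu> r i v = \<nu> r v" using q_pos[OF iT(1), of v] by simp
    have "q i v * var r i v = 0"
      using s2 iT(1) fin_I q_pos var by (subst (asm) sum_nonneg_eq_0_iff) (auto simp: less_imp_le)
    then have "var r i v = 0" using q_pos[OF iT(1), of v] by simp
    then have "\<rho> i T v * (T r - \<mu> r i v)\<^sup>2 = 0"
      unfolding var_def using iT fin_G \<rho>_pos by (subst (asm) sum_nonneg_eq_0_iff) (auto simp: less_imp_le)
    then show ?thesis using \<rho>_pos[OF iT, of v] 1 by simp
  qed
  then show False using assms by metis
qed

end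

section \<open>Preimages of null sets under \<open>L\<close>\<close>

context proper_form
begin

text \<open>The second derivative of \<open>L\<close> in coordinate 0. It is nonnegative, so
  \<open>L\<close> is convex there. Coordinate 0 is an x-coordinate if n > 0 and a y-coordinate
  otherwise.\<close>

definition "ddL v = dnu 0 v + (if 0 < n then e 0 / (2 * (sinh (v 0 / 2))\<^sup>2) else 0)"

lemma pd_dL: "pd 0 (dL 0) ddL"
proof (rule pdI)
  fix v assume v: "v \<in> Dx"
  have 1: "((\<lambda>x. \<nu> 0 (v(0 := x))) has_real_derivative dnu 0 v) (at (v 0))"
    by (rule pdD[OF pd_\<nu>[OF dim_pos] v])
  show "((\<lambda>x. dL 0 (v(0 := x))) has_real_derivative ddL v) (at (v 0))"
  proof (cases "0 < n")
    case True
    then have v0: "0 < v 0" using v by (simp add: Dx_def)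
    have "((\<lambda>x. e 0 * (cosh (x / 2) / sinh (x / 2))) has_real_derivative
       e 0 * ((sinh (v 0 / 2) * (1 / 2) * sinh (v 0 / 2) - cosh (v 0 / 2) * (cosh (v 0 / 2) * (1 / 2))) /
         (sinh (v 0 / 2) * sinh (v 0 / 2)))) (at (v 0))"
      using v0 by (auto intro!: derivative_eq_intros simp: algebra_simps)
    also have "sinh (v 0 / 2) * (1 / 2) * sinh (v 0 / 2) - cosh (v 0 / 2) * (cosh (v 0 / 2) * (1 / 2)) = - (1 / 2)"
      using cosh_square_eq[of "v 0 / 2"] by (simp add: power2_eq_square algebra_simps)
    finally have 2: "((\<lambda>x. e 0 * (cosh (x / 2) / sinh (x / 2))) has_real_derivative
       - (e 0 / (2 * (sinh (v 0 / 2))\<^sup>2))) (at (v 0))" by (simp add: power2_eq_square)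
    show ?thesis using DERIV_diff[OF 1 2] True by (simp add: dL_def ddL_def)
  next
    case False
    with 1 show ?thesis unfolding dL_def ddL_def by simp
  qed
qed

text \<open>Where the second derivative is positive on the whole section, the first one has at most
  one zero. Otherwise n = 0 and all forms share one coefficient \<open>t\<close> in coordinate 0;
  then the first derivative is constantly \<open>t\<close>, and linear growth along that axis makes
  \<open>t\<close> positive.\<close>

lemma dL_zeros:
  assumes v: "v \<in> Dx"
  shows "countable {y. v(0 := y) \<in> Dx \<and> dL 0 (v(0 := y)) = 0}"
proof -
  define S where "S = {y. v(0 := y) \<in> Dx}"
  have S: "S = (if 0 < n then {0<..} else UNIV)" using v by (auto simp: S_def Dx_def)
  have der: "((\<lambda>x. dL 0 (v(0 := x))) has_real_derivative ddL (v(0 := y))) (at y)" if "y \<in> S" for y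
    using pdD[OF pd_dL, of "v(0 := y)"] that by (simp add: S_def)
  show ?thesis
  proof (cases "\<forall>y\<in>S. 0 < ddL (v(0 := y))")
    case True
    have lt: "dL 0 (v(0 := x)) < dL 0 (v(0 := y))" if "x \<in> S" "y \<in> S" "x < y" for x y
    proof (rule DERIV_pos_imp_increasing[OF that(3)])
      fix z assume "x \<le> z" "z \<le> y"
      then have "z \<in> S" using that S by (auto split: if_splits)
      then show "\<exists>l. ((\<lambda>x. dL 0 (v(0 := x))) has_real_derivative l) (at z) \<and> 0 < l" using der True by blast
    qed
    have "\<exists>z. {y \<in> S. dL 0 (v(0 := y)) = 0} \<subseteq> {z}"
    proof (cases "{y \<in> S. dL 0 (v(0 := y)) = 0} = {}")
      case False
      then obtain z where z: "z \<in> S" "dL 0 (v(0 := z)) = 0" by auto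
      have "y = z" if "y \<in> S" "dL 0 (v(0 := y)) = 0" for y
        using lt[of y z] lt[of z y] z that by (metis less_irrefl linorder_neqE_linordered_idom)
      then show ?thesis by blast
    qed auto
    then have "countable {y \<in> S. dL 0 (v(0 := y)) = 0}" by (meson countable_empty countable_insert countable_subset)
    then show ?thesis by (simp add: S_def)
  next
    case False
    then obtain y where y: "y \<in> S" "\<not> 0 < ddL (v(0 := y))" by blast
    have n0: "n = 0"
    proof (rule ccontr)
      assume "n \<noteq> 0"
      then have "0 < y" "1 \<le> e 0" using y(1) S e_pos[of 0] by auto
      then have "0 < e 0 / (2 * (sinh ((v(0 := y)) 0 / 2))\<^sup>2)" by simp
      then show False
        using y(2) dnu_nonneg[of 0 "v(0 := y)"] \<open>n \<noteq> 0\<close> unfolding ddL_def by simp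
    qed
    have "\<exists>t. \<forall>i\<in>I. \<forall>T\<in>G i. T 0 = t"
    proof (rule ccontr)
      assume *: "\<not> ?thesis"
      obtain i1 where "i1 \<in> I" using I_ne by blast
      then obtain T1 where 1: "i1 \<in> I" "T1 \<in> G i1" using G_ne by blast
      have "\<not> (\<forall>i\<in>I. \<forall>T\<in>G i. T 0 = T1 0)" using spec[OF *[unfolded not_ex], of "T1 0"] .
      then obtain i2 T2 where "i2 \<in> I" "T2 \<in> G i2" "T2 0 \<noteq> T1 0" by blast
      then have "0 < dnu 0 (v(0 := y))" using 1 by (intro dnu_pos) auto
      then show False using y(2) n0 unfolding ddL_def by simp
    qed
    then obtain t where t': "\<forall>i\<in>I. \<forall>T\<in>G i. T 0 = t" by (rule exE)
    have t: "T 0 = t" if "i \<in> I" "T \<in> G i" for i T using t' that by simp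
    have "\<mu> 0 i w = t" if "i \<in> I" for i w
    proof -
      have "\<mu> 0 i w = (\<Sum>T\<in>G i. \<rho> i T w * t)" unfolding \<mu>_def using t[OF that] by (intro sum.cong) auto
      then show ?thesis using sum_\<rho>[OF that, of w] by (simp flip: sum_distrib_right)
    qed
    then have "\<nu> 0 w = t" for w using sum_q[of w] by (simp add: \<nu>_def flip: sum_distrib_right)
    then have dL: "dL 0 w = t" for w using n0 unfolding dL_def by simp
    have "0 < t"
    proof -
      \<comment> \<open>The unit vector of coordinate 0 lies in \<open>D\<close> because n = 0, and
        \<open>Nmax\<close> takes the value \<open>t\<close> on it.\<close>
      define u where "u = restrict (\<lambda>j. if j = 0 then 1 else 0 :: real) {..<d}"
      have u: "u \<in> D" using n0 by (auto simp: u_def length_dom_def)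
      obtain i T where iT: "i \<in> I" "T \<in> G i" "Nmax u = NF T u" by (rule Nmax_attained)
      have "NF T u = (\<Sum>j<d. if j = 0 then T 0 else 0)"
        unfolding NF_def lin_form_def nf_def using n0 by (intro sum.cong) (auto simp: u_def)
      also have "\<dots> = t" using dim_pos t[OF iT(1,2)] by simp
      finally have "c * (\<Sum>j<d. \<bar>u j\<bar>) \<le> t" using growth[OF u] iT(3) by simp
      moreover have "(\<Sum>j<d. \<bar>u j\<bar>) = (\<Sum>j<d. if j = 0 then 1 else 0)"
        by (intro sum.cong) (auto simp: u_def)
      ultimately show ?thesis using c_pos dim_pos by simp
    qed
    then show ?thesis by (simp add: dL)
  qed
qed

lemma L_section_null:
  assumes B: "B \<in> null_sets lborel"
  shows "AE y in lborel. \<not> (x(0 := y) \<in> D \<and> L (x(0 := y)) \<in> B)"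
proof (cases "\<exists>y. x(0 := y) \<in> Dx")
  case False
  then show ?thesis using D_subset by (intro AE_I2) blast
next
  case True
  then obtain y0 where y0: "x(0 := y0) \<in> Dx" by blast
  define S where "S = {y. x(0 := y) \<in> Dx}"
  have S: "S = (if 0 < n then {0<..} else UNIV)" using y0 by (auto simp: S_def Dx_def)
  have neg: "negligible B"
    using B by (simp add: negligible_iff_null_sets null_sets_completionI)
  have "negligible {y \<in> S. L (x(0 := y)) \<in> B}"
  proof (rule negligible_preimage[where \<phi>' = "\<lambda>y. dL 0 (x(0 := y))"])
    show "open S" by (simp add: S)
    show "((\<lambda>y. L (x(0 := y))) has_real_derivative dL 0 (x(0 := y))) (at y)" if "y \<in> S" for y
      using pdD[OF pd_L[OF dim_pos], of "x(0 := y)"] that by (simp add: S_def)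
    show "continuous_on S (\<lambda>y. dL 0 (x(0 := y)))"
    proof (rule continuous_at_imp_continuous_on, rule ballI)
      fix y assume "y \<in> S"
      then show "isCont (\<lambda>y. dL 0 (x(0 := y))) y"
        using pdD[OF pd_dL, of "x(0 := y)"] by (auto simp: S_def intro: DERIV_isCont)
    qed
    show "countable {y \<in> S. dL 0 (x(0 := y)) = 0}"
      using dL_zeros[OF y0] by (simp add: S_def)
  qed (rule neg)
  then have "{y \<in> S. L (x(0 := y)) \<in> B} \<in> null_sets lebesgue" by (simp add: negligible_iff_null_sets)
  then have "AE y in lebesgue. y \<notin> {y \<in> S. L (x(0 := y)) \<in> B}" by (rule AE_not_in)
  then have "AE y in lborel. y \<notin> {y \<in> S. L (x(0 := y)) \<in> B}" by (simp add: AE_completion_iff)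
  then show ?thesis by eventually_elim (use D_subset in \<open>auto simp: S_def\<close>)
qed

text \<open>By Fubini it suffices to treat the sections in coordinate 0. This is the absolute
  continuity of push-forwards by \<open>L\<close>.\<close>

lemma L_preimage_null:
  assumes B: "B \<in> null_sets lborel"
  shows "AE v in M. v \<in> D \<longrightarrow> L v \<notin> B"
proof -
  interpret product_sigma_finite "\<lambda>_. lborel :: real measure" ..
  have [measurable]: "B \<in> sets borel" using B by auto
  define J where "J = {..<d} - {0}"
  have J: "{..<d} = insert 0 J" "finite J" "0 \<notin> J" using dim_pos by (auto simp: J_def)
  define E where "E = {v \<in> space M. v \<in> D \<and> L v \<in> B}"
  have E [measurable]: "E \<in> sets M"
  proof -
    have "E = D \<inter> {v \<in> space M. L v \<in> B}" using D_space by (auto simp: E_def)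
    then show ?thesis by simp
  qed
  have "(\<integral>\<^sup>+ v. indicator E v \<partial>M) = (\<integral>\<^sup>+ x. (\<integral>\<^sup>+ y. indicator E (x(0 := y)) \<partial>lborel) \<partial>PiM J (\<lambda>_. lborel :: real measure))"
    unfolding J(1)
    by (rule product_nn_integral_insert[OF J(2,3)]) (use E J(1) in auto)
  also have "\<dots> = (\<integral>\<^sup>+ x. 0 \<partial>PiM J (\<lambda>_. lborel :: real measure))"
  proof (rule nn_integral_cong)
    fix x
    have "AE y in lborel. indicator E (x(0 := y)) = (0 :: ennreal)"
      using L_section_null[OF B, of x] by eventually_elim (auto simp: E_def)
    then have "(\<integral>\<^sup>+ y. indicator E (x(0 := y)) \<partial>lborel) = (\<integral>\<^sup>+ y. 0 \<partial>(lborel :: real measure))"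
      by (rule nn_integral_cong_AE)
    then show "(\<integral>\<^sup>+ y. indicator E (x(0 := y)) \<partial>lborel) = 0" by simp
  qed
  finally have "emeasure M E = 0" by simp
  then have "E \<in> null_sets M" using E by auto
  then have "AE v in M. v \<notin> E" by (rule AE_not_in)
  moreover have "AE v in M. v \<in> space M" by (rule AE_space)
  ultimately show ?thesis by eventually_elim (auto simp: E_def)
qed

end

section \<open>Push-forwards with polynomial densities up to exponentially small terms\<close>

lemma pderiv_sum: "pderiv (\<Sum>i\<in>A. f i) = (\<Sum>i\<in>A. pderiv (f i))"
  by (induction A rule: infinite_finite_induct) (auto simp: pderiv_add)

lemma poly_antiderivative:
  fixes P :: "real poly"
  obtains Q where "pderiv Q = P" "degree Q \<le> Suc (degree P)" "P = 0 \<Longrightarrow> Q = 0"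
proof -
  define Q where "Q = (\<Sum>i\<le>degree P. monom (coeff P i / real (Suc i)) (Suc i))"
  show ?thesis
  proof (rule that[of Q])
    have "pderiv Q = (\<Sum>i\<le>degree P. monom (coeff P i) i)"
      unfolding Q_def by (simp add: pderiv_monom pderiv_sum del: of_nat_Suc)
    then show "pderiv Q = P" by (simp add: poly_as_sum_of_monoms)
    show "degree Q \<le> Suc (degree P)"
      unfolding Q_def by (intro degree_sum_le) (auto intro: order_trans[OF degree_monom_le])
    show "P = 0 \<Longrightarrow> Q = 0" by (simp add: Q_def)
  qed
qed

lemma integral_poly:
  fixes Q :: "real poly"
  assumes "0 \<le> t"
  shows "(\<integral>x. indicat_real {0..t} x * poly (pderiv Q) x \<partial>lborel) = poly Q t - poly Q 0"
  using integral_FTC_atLeastAtMost[of 0 t "poly Q" "poly (pderiv Q)"] assms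
  by (simp add: has_real_derivative_iff_has_vector_derivative[symmetric] poly_DERIV
      has_field_derivative_at_within continuous_intros)

lemma integrable_poly_Icc: "integrable lborel (\<lambda>x. indicat_real {a..b} x * poly P x)" for P :: "real poly"
  using borel_integrable_atLeastAtMost'[of a b "poly P"]
  by (simp add: set_integrable_def continuous_intros)

context proper_form
begin

sublocale M: sigma_finite_measure M
proof -
  interpret product_sigma_finite "\<lambda>_. lborel :: real measure" ..
  show "sigma_finite_measure M" by (rule sigma_finite) simp
qed

text \<open>A density statement in integrated form, since distribution functions are what
  integration by parts produces. For \<open>m = 0\<close> the density consists of the remainder
  alone.\<close>

definition nice :: "real \<Rightarrow> nat \<Rightarrow> ((nat \<Rightarrow> real) \<Rightarrow> real) \<Rightarrow> bool" where
  "nice \<epsilon> m W \<longleftrightarrow> adm W \<and> (\<exists>P r. (P = 0 \<or> degree P < m) \<and> r \<in> borel_measurable borel \<and>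
     integrable lborel (\<lambda>l. indicat_real {0..} l * (exp (\<epsilon> * l) * r l)) \<and>
     (\<forall>b\<ge>0. V W b = (\<integral>l. indicat_real {0..b} l * (poly P l + r l) \<partial>lborel)))"

lemma admD: "adm W \<Longrightarrow> W \<in> borel_measurable M" "adm W \<Longrightarrow> integrable M (\<lambda>v. indicat_real (sub b) v * W v)"
  by (auto simp: adm_def)

lemma adm_add: "adm W \<Longrightarrow> adm W' \<Longrightarrow> adm (\<lambda>v. W v + W' v)"
  by (auto simp: adm_def distrib_left)

lemma adm_cmult: "adm W \<Longrightarrow> adm (\<lambda>v. x * W v)"
  by (auto simp: adm_def mult.left_commute[of _ x])

lemma V_add: "adm W \<Longrightarrow> adm W' \<Longrightarrow> V (\<lambda>v. W v + W' v) b = V W b + V W' b"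
  unfolding V_def distrib_left by (intro Bochner_Integration.integral_add admD)

lemma V_cmult: "V (\<lambda>v. x * W v) b = x * V W b"
  unfolding V_def by (simp add: mult.left_commute[of _ x])

lemma integrable_weight_Icc:
  fixes r :: "real \<Rightarrow> real"
  assumes "0 \<le> \<epsilon>" and [measurable]: "r \<in> borel_measurable borel"
    and "integrable lborel (\<lambda>l. indicat_real {0..} l * (exp (\<epsilon> * l) * r l))"
    and "A \<subseteq> {0..}" "A \<in> sets borel"
  shows "integrable lborel (\<lambda>l. indicat_real A l * r l)"
proof (rule Bochner_Integration.integrable_bound[OF assms(3)])
  show "(\<lambda>l. indicat_real A l * r l) \<in> borel_measurable lborel" using assms(2,5) by simp
  show "AE l in lborel. norm (indicat_real A l * r l) \<le> norm (indicat_real {0..} l * (exp (\<epsilon> * l) * r l))"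
  proof (rule AE_I2)
    fix l :: real
    show "norm (indicat_real A l * r l) \<le> norm (indicat_real {0..} l * (exp (\<epsilon> * l) * r l))"
    proof (cases "l \<in> A")
      case True
      then have "0 \<le> l" using assms(4) by auto
      then have "1 * \<bar>r l\<bar> \<le> exp (\<epsilon> * l) * \<bar>r l\<bar>" using assms(1) by (intro mult_right_mono) auto
      then show ?thesis using True \<open>0 \<le> l\<close> by (simp add: abs_mult)
    qed auto
  qed
qed

lemma nice_add:
  assumes "0 \<le> \<epsilon>" "nice \<epsilon> m W" "nice \<epsilon> m W'"
  shows "nice \<epsilon> m (\<lambda>v. W v + W' v)"
proof -
  obtain P r where W: "adm W" "P = 0 \<or> degree P < m" and r [measurable]: "r \<in> borel_measurable borel"
    and ir: "integrable lborel (\<lambda>l. indicat_real {0..} l * (exp (\<epsilon> * l) * r l))"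
    and V: "\<And>b. b\<ge>0 \<Longrightarrow> V W b = (\<integral>l. indicat_real {0..b} l * (poly P l + r l) \<partial>lborel)"
    using assms(2) by (auto simp: nice_def)
  obtain P' r' where W': "adm W'" "P' = 0 \<or> degree P' < m" and r' [measurable]: "r' \<in> borel_measurable borel"
    and ir': "integrable lborel (\<lambda>l. indicat_real {0..} l * (exp (\<epsilon> * l) * r' l))"
    and V': "\<And>b. b\<ge>0 \<Longrightarrow> V W' b = (\<integral>l. indicat_real {0..b} l * (poly P' l + r' l) \<partial>lborel)"
    using assms(3) by (auto simp: nice_def)
  show ?thesis
    unfolding nice_def
  proof (intro conjI adm_add W W' exI[of _ "P + P'"] exI[of _ "\<lambda>l. r l + r' l"] allI impI)
    show "P + P' = 0 \<or> degree (P + P') < m"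
      using W W' degree_add_le_max[of P P'] by auto
    show "integrable lborel (\<lambda>l. indicat_real {0..} l * (exp (\<epsilon> * l) * (r l + r' l)))"
      using Bochner_Integration.integrable_add[OF ir ir'] by (simp add: algebra_simps)
    fix b :: real assume b: "0 \<le> b"
    have i: "integrable lborel (\<lambda>l. indicat_real {0..b} l * (poly P l + r l))"
      "integrable lborel (\<lambda>l. indicat_real {0..b} l * (poly P' l + r' l))"
      unfolding distrib_left
      by (intro Bochner_Integration.integrable_add integrable_poly_Icc
          integrable_weight_Icc[OF assms(1) r ir] integrable_weight_Icc[OF assms(1) r' ir']; simp)+
    have "V (\<lambda>v. W v + W' v) b = (\<integral>l. indicat_real {0..b} l * (poly P l + r l) +
        indicat_real {0..b} l * (poly P' l + r' l) \<partial>lborel)"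
      using V[OF b] V'[OF b] W W' i by (simp add: V_add)
    also have "\<dots> = (\<integral>l. indicat_real {0..b} l * (poly (P + P') l + (r l + r' l)) \<partial>lborel)"
      by (rule Bochner_Integration.integral_cong) (auto simp: algebra_simps)
    finally show "V (\<lambda>v. W v + W' v) b = (\<integral>l. indicat_real {0..b} l * (poly (P + P') l + (r l + r' l)) \<partial>lborel)" .
  qed measurable
qed

lemma nice_cmult:
  assumes "nice \<epsilon> m W" shows "nice \<epsilon> m (\<lambda>v. x * W v)"
proof -
  obtain P r where W: "adm W" "P = 0 \<or> degree P < m" and r [measurable]: "r \<in> borel_measurable borel"
    and ir: "integrable lborel (\<lambda>l. indicat_real {0..} l * (exp (\<epsilon> * l) * r l))"
    and V: "\<And>b. b\<ge>0 \<Longrightarrow> V W b = (\<integral>l. indicat_real {0..b} l * (poly P l + r l) \<partial>lborel)"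
    using assms by (auto simp: nice_def)
  show ?thesis
    unfolding nice_def
  proof (intro conjI adm_cmult W exI[of _ "smult x P"] exI[of _ "\<lambda>l. x * r l"] allI impI)
    show "smult x P = 0 \<or> degree (smult x P) < m" using W by auto
    show "integrable lborel (\<lambda>l. indicat_real {0..} l * (exp (\<epsilon> * l) * (x * r l)))"
      using integrable_mult_right[OF ir, of x] by (simp add: mult_ac)
    fix b :: real assume b: "0 \<le> b"
    have "V (\<lambda>v. x * W v) b = (\<integral>l. x * (indicat_real {0..b} l * (poly P l + r l)) \<partial>lborel)"
      using V[OF b] by (simp add: V_cmult)
    then show "V (\<lambda>v. x * W v) b = (\<integral>l. indicat_real {0..b} l * (poly (smult x P) l + x * r l) \<partial>lborel)"
      by (simp add: algebra_simps)
  qed measurable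
qed

lemma nice_0: "nice \<epsilon> m (\<lambda>_. 0)"
  unfolding nice_def adm_def V_def by (auto intro!: exI[of _ "0 :: real poly"] exI[of _ "\<lambda>_. 0"])

lemma nice_mono: "nice \<epsilon> m W \<Longrightarrow> m \<le> m' \<Longrightarrow> nice \<epsilon> m' W"
proof -
  assume "nice \<epsilon> m W" "m \<le> m'"
  then have "\<exists>P r. (P = 0 \<or> degree P < m') \<and> r \<in> borel_measurable borel \<and>
     integrable lborel (\<lambda>l. indicat_real {0..} l * (exp (\<epsilon> * l) * r l)) \<and>
     (\<forall>b\<ge>0. V W b = (\<integral>l. indicat_real {0..b} l * (poly P l + r l) \<partial>lborel))"
    unfolding nice_def by (elim conjE exE) (intro exI conjI; auto)
  then show ?thesis using \<open>nice \<epsilon> m W\<close> by (simp only: nice_def simp_thms)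
qed

lemma nice_sum:
  assumes "0 \<le> \<epsilon>" "\<And>i. i \<in> A \<Longrightarrow> nice \<epsilon> m (W i)"
  shows "nice \<epsilon> m (\<lambda>v. \<Sum>i\<in>A. W i v)"
  using assms(2) by (induction A rule: infinite_finite_induct) (auto intro!: nice_0 nice_add assms(1))

lemma V_cong: "(\<And>v. v \<in> D \<Longrightarrow> W v = W' v) \<Longrightarrow> V W b = V W' b"
  unfolding V_def by (intro Bochner_Integration.integral_cong refl) (auto simp: indicator_def sub_def)

lemma nice_cong:
  assumes "nice \<epsilon> m W" "\<And>v. v \<in> D \<Longrightarrow> W v = W' v" "W' \<in> borel_measurable M"
  shows "nice \<epsilon> m W'"
proof -
  have eq: "(\<lambda>v. indicat_real (sub b) v * W v) = (\<lambda>v. indicat_real (sub b) v * W' v)" for b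
    using assms(2) by (auto simp: indicator_def sub_def fun_eq_iff)
  have "adm W'" using assms(1,3) unfolding nice_def adm_def eq by blast
  moreover have "V W = V W'" using V_cong[OF assms(2)] by (simp add: fun_eq_iff)
  ultimately show ?thesis using assms(1) by (simp only: nice_def simp_thms)
qed

text \<open>Null preimages make the push-forward absolutely continuous, and Radon-Nikodym supplies a
  density. Its integrability against exp (\<epsilon> * l) is the assumed integrability of
  \<open>E v * exp (\<epsilon> * L v)\<close>, transported.\<close>

lemma nice_exp_small_nonneg:
  assumes \<epsilon>: "0 < \<epsilon>" and E [measurable]: "E \<in> borel_measurable M" and E0: "\<And>v. 0 \<le> E v"
    and int: "integrable M (\<lambda>v. indicat_real D v * (E v * exp (\<epsilon> * L v)))"
  shows "nice \<epsilon> 0 E"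
proof -
  have adm: "adm E"
    unfolding adm_def
  proof (intro conjI allI E)
    fix b
    show "integrable M (\<lambda>v. indicat_real (sub b) v * E v)"
    proof (rule Bochner_Integration.integrable_bound[OF int])
      show "AE v in M. norm (indicat_real (sub b) v * E v) \<le> norm (indicat_real D v * (E v * exp (\<epsilon> * L v)))"
      proof (rule AE_I2)
        fix v
        show "norm (indicat_real (sub b) v * E v) \<le> norm (indicat_real D v * (E v * exp (\<epsilon> * L v)))"
        proof (cases "v \<in> sub b")
          case True
          then have v: "v \<in> D" by (simp add: sub_def)
          have "E v * 1 \<le> E v * exp (\<epsilon> * L v)"
            using L_nonneg[OF v] \<epsilon> E0 by (intro mult_left_mono) auto
          then show ?thesis using True v E0 by (simp add: abs_mult)
        qed auto
      qed
    qed measurable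
  qed
  define N where "N = distr (density M (\<lambda>v. ennreal (indicat_real D v * E v))) borel L"
  have sN [simp]: "sets N = sets borel" by (simp add: N_def)
  have nnN: "(\<integral>\<^sup>+ l. g l \<partial>N) = (\<integral>\<^sup>+ v. ennreal (indicat_real D v * E v) * g (L v) \<partial>M)"
    if [measurable]: "g \<in> borel_measurable borel" for g :: "real \<Rightarrow> ennreal"
    unfolding N_def by (subst nn_integral_distr) (auto simp: nn_integral_density)
  have "absolutely_continuous lborel N"
    unfolding absolutely_continuous_def
  proof
    fix B :: "real set" assume B: "B \<in> null_sets lborel"
    then have [measurable]: "B \<in> sets borel" by auto
    have "emeasure N B = (\<integral>\<^sup>+ l. indicator B l \<partial>N)" by simp
    also have "\<dots> = (\<integral>\<^sup>+ v. ennreal (indicat_real D v * E v) * indicator B (L v) \<partial>M)"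
      by (rule nnN) simp
    also have "\<dots> = (\<integral>\<^sup>+ v. 0 \<partial>M)"
      using L_preimage_null[OF B] by (intro nn_integral_cong_AE) (auto elim!: eventually_mono simp: indicator_def)
    finally show "B \<in> null_sets N" using \<open>B \<in> sets borel\<close> by (auto intro: null_setsI)
  qed
  \<comment> \<open>In the rest of this argument \<open>\<rho>\<close> is the Radon-Nikodym density
    and not the softmax weight.\<close>
  then obtain \<rho> where \<rho> [measurable]: "\<rho> \<in> borel_measurable borel" and N: "density lborel \<rho> = N"
    using sigma_finite_measure.Radon_Nikodym[OF sigma_finite_lborel, of N] by auto
  have nn: "(\<integral>\<^sup>+ l. \<rho> l * g l \<partial>lborel) = (\<integral>\<^sup>+ v. ennreal (indicat_real D v * E v) * g (L v) \<partial>M)"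
    if [measurable]: "g \<in> borel_measurable borel" for g :: "real \<Rightarrow> ennreal"
    using nnN[OF that] by (simp add: N[symmetric] nn_integral_density)
  define r where "r l = enn2real (\<rho> l)" for l
  have [measurable]: "r \<in> borel_measurable borel" unfolding r_def[abs_def] by measurable
  have fin: "(\<integral>\<^sup>+ l. \<rho> l * ennreal (exp (\<epsilon> * l)) \<partial>lborel) < \<infinity>"
  proof -
    have "(\<integral>\<^sup>+ l. \<rho> l * ennreal (exp (\<epsilon> * l)) \<partial>lborel) =
        (\<integral>\<^sup>+ v. ennreal (indicat_real D v * (E v * exp (\<epsilon> * L v))) \<partial>M)"
      by (subst nn) (auto intro!: nn_integral_cong simp: E0 mult.assoc simp flip: ennreal_mult)
    also have "\<dots> < \<infinity>" using int E0 by (simp add: integrable_iff_bounded abs_mult)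
    finally show ?thesis .
  qed
  have "AE l in lborel. \<rho> l * ennreal (exp (\<epsilon> * l)) \<noteq> \<infinity>"
    by (rule nn_integral_PInf_AE) (use fin in auto)
  then have \<rho>r: "AE l in lborel. \<rho> l = ennreal (r l)"
    by eventually_elim (auto simp: r_def ennreal_mult_eq_top_iff less_top)
  have neg: "AE l in lborel. l < 0 \<longrightarrow> r l = 0"
  proof -
    have "(\<integral>\<^sup>+ l. \<rho> l * indicator {..<0} l \<partial>lborel) = (\<integral>\<^sup>+ v. ennreal (indicat_real D v * E v) * indicator {..<0} (L v) \<partial>M)"
      by (rule nn) simp
    also have "\<dots> = (\<integral>\<^sup>+ v. 0 \<partial>M)"
      using L_nonneg by (intro nn_integral_cong) (auto simp: indicator_def not_less)
    finally have "AE l in lborel. \<rho> l * indicator {..<0} l = 0"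
      by (simp add: nn_integral_0_iff_AE)
    then show ?thesis by eventually_elim (auto simp: r_def)
  qed
  have r0: "0 \<le> r l" for l by (simp add: r_def)
  show ?thesis
    unfolding nice_def
  proof (intro conjI adm exI[of _ "0 :: real poly"] exI[of _ r] allI impI)
    show "integrable lborel (\<lambda>l. indicat_real {0..} l * (exp (\<epsilon> * l) * r l))"
    proof (rule integrableI_nonneg)
      have "(\<integral>\<^sup>+ l. ennreal (indicat_real {0..} l * (exp (\<epsilon> * l) * r l)) \<partial>lborel) \<le>
          (\<integral>\<^sup>+ l. \<rho> l * ennreal (exp (\<epsilon> * l)) \<partial>lborel)"
        using \<rho>r by (intro nn_integral_mono_AE)
          (auto elim!: eventually_mono simp: indicator_def r0 mult.commute simp flip: ennreal_mult)
      then show "(\<integral>\<^sup>+ l. ennreal (indicat_real {0..} l * (exp (\<epsilon> * l) * r l)) \<partial>lborel) < \<infinity>"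
        using fin by (rule le_less_trans)
    qed (auto simp: r0)
    fix b :: real assume b: "0 \<le> b"
    have "ennreal (V E b) = (\<integral>\<^sup>+ v. ennreal (indicat_real (sub b) v * E v) \<partial>M)"
      unfolding V_def using admD(2)[OF adm] E0 by (intro nn_integral_eq_integral[symmetric]) auto
    also have "\<dots> = (\<integral>\<^sup>+ v. ennreal (indicat_real D v * E v) * indicator {..b} (L v) \<partial>M)"
      by (intro nn_integral_cong) (auto simp: indicator_def sub_def)
    also have "\<dots> = (\<integral>\<^sup>+ l. \<rho> l * indicator {..b} l \<partial>lborel)" by (rule nn[symmetric]) simp
    also have "\<dots> = (\<integral>\<^sup>+ l. ennreal (indicat_real {0..b} l * r l) \<partial>lborel)"
      using \<rho>r neg by (intro nn_integral_cong_AE) (auto elim!: eventually_elim2 simp: indicator_def)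
    finally have eq: "ennreal (V E b) = (\<integral>\<^sup>+ l. ennreal (indicat_real {0..b} l * r l) \<partial>lborel)" .
    have "0 \<le> V E b" unfolding V_def using E0 by (intro Bochner_Integration.integral_nonneg) auto
    then have "has_bochner_integral lborel (\<lambda>l. indicat_real {0..b} l * r l) (V E b)"
      using eq r0 by (intro has_bochner_integral_nn_integral) auto
    then show "V E b = (\<integral>l. indicat_real {0..b} l * (poly 0 l + r l) \<partial>lborel)"
      by (simp add: has_bochner_integral_integral_eq)
  qed auto
qed

text \<open>Positive and negative part are treated separately, because the density was obtained for
  a measure.\<close>

lemma nice_exp_small:
  assumes \<epsilon>: "0 < \<epsilon>" and E [measurable]: "E \<in> borel_measurable M"
    and int: "integrable M (\<lambda>v. indicat_real D v * (E v * exp (\<epsilon> * L v)))"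
  shows "nice \<epsilon> 0 E"
proof -
  have part: "nice \<epsilon> 0 (\<lambda>v. max 0 (x * E v))" if "\<bar>x\<bar> = 1" for x
  proof (rule nice_exp_small_nonneg[OF \<epsilon>])
    show "integrable M (\<lambda>v. indicat_real D v * (max 0 (x * E v) * exp (\<epsilon> * L v)))"
    proof (rule Bochner_Integration.integrable_bound[OF int])
      show "AE v in M. norm (indicat_real D v * (max 0 (x * E v) * exp (\<epsilon> * L v))) \<le>
          norm (indicat_real D v * (E v * exp (\<epsilon> * L v)))"
      proof (rule AE_I2)
        fix v
        have "\<bar>max 0 (x * E v)\<bar> \<le> \<bar>x * E v\<bar>" by linarith
        also have "\<dots> = \<bar>E v\<bar>" using that by (simp add: abs_mult)
        finally show "norm (indicat_real D v * (max 0 (x * E v) * exp (\<epsilon> * L v))) \<le>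
          norm (indicat_real D v * (E v * exp (\<epsilon> * L v)))"
          by (auto simp: abs_mult indicator_def)
      qed
    qed measurable
  qed auto
  have "nice \<epsilon> 0 (\<lambda>v. max 0 (1 * E v) + (-1) * max 0 ((-1) * E v))"
    using \<epsilon> by (intro nice_add nice_cmult part) auto
  moreover have "(\<lambda>v. max 0 (1 * E v) + (-1) * max 0 ((-1) * E v)) = E" by (auto simp: fun_eq_iff max_def)
  ultimately show ?thesis by (simp only:)
qed

text \<open>A layer-cake formula: \<open>max 0 (b - L v)\<close> is the length of the set of
  \<open>t\<close> in [0, b] with \<open>L v \<le> t\<close>, by nonnegativity of \<open>L\<close>.
  Fubini exchanges the two integrations.\<close>

lemma integral_V:
  assumes "adm W" "0 \<le> b"
  shows "(\<integral>v. indicat_real D v * (max 0 (b - L v) * W v) \<partial>M) = (\<integral>t. indicat_real {0..b} t * V W t \<partial>lborel)"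
proof -
  note [measurable] = admD(1)[OF assms(1)]
  interpret P: pair_sigma_finite M "lborel :: real measure" ..
  define H where "H v t = indicat_real D v * indicat_real {L v..} t * indicat_real {0..b} t * W v" for v t
  have in1: "(\<integral>t. x * (indicat_real {L v..} t * indicat_real {0..b} t) \<partial>lborel) = x * max 0 (b - L v)" if "v \<in> D" for v and x :: real
  proof -
    have "(\<integral>t. indicat_real {L v..} t * indicat_real {0..b} t \<partial>lborel) = (\<integral>t. indicat_real {L v..b} t \<partial>lborel)"
      using L_nonneg[OF that] by (intro Bochner_Integration.integral_cong) (auto simp: indicator_def)
    also have "\<dots> = max 0 (b - L v)" by (simp add: measure_def max_def)
    finally show ?thesis by simp
  qed
  have Hint: "integrable lborel (\<lambda>t. x * (indicat_real {L v..} t * indicat_real {0..b} t))" for v x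
  proof -
    have "integrable lborel (\<lambda>t. indicat_real ({L v..} \<inter> {0..b}) t)"
    proof (rule integrable_real_indicator)
      have "emeasure lborel ({L v..} \<inter> {0..b}) \<le> emeasure lborel {0..b}"
        by (rule emeasure_mono) auto
      also have "\<dots> < \<infinity>" by (simp add: emeasure_lborel_Icc_eq)
      finally show "emeasure lborel ({L v..} \<inter> {0..b}) < \<infinity>" .
    qed simp
    moreover have "(\<lambda>t. indicat_real {L v..} t * indicat_real {0..b} t) = (\<lambda>t. indicat_real ({L v..} \<inter> {0..b}) t)"
      by (auto simp: indicator_def fun_eq_iff)
    ultimately have "integrable lborel (\<lambda>t. indicat_real {L v..} t * indicat_real {0..b} t)" by (simp only:)
    then show ?thesis by (rule integrable_mult_right)
  qed
  have int: "integrable (M \<Otimes>\<^sub>M lborel) (case_prod H)"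
  proof (rule P.Fubini_integrable)
    have [measurable]: "(\<lambda>p. indicat_real {L (fst p)..} (snd p)) \<in> borel_measurable (M \<Otimes>\<^sub>M borel)"
    proof -
      have "{p \<in> space (M \<Otimes>\<^sub>M borel). L (fst p) \<le> snd p} \<in> sets (M \<Otimes>\<^sub>M borel)" by measurable
      then have "(\<lambda>p. indicat_real {p \<in> space (M \<Otimes>\<^sub>M borel). L (fst p) \<le> snd p} p) \<in> borel_measurable (M \<Otimes>\<^sub>M borel)"
        by simp
      then show ?thesis by (rule measurable_cong[THEN iffD1, rotated]) (auto simp: indicator_def)
    qed
    show "case_prod H \<in> borel_measurable (M \<Otimes>\<^sub>M lborel)"
      unfolding H_def split_beta' by measurable
    have "(\<integral>t. norm (case_prod H (v, t)) \<partial>lborel) = indicat_real D v * (max 0 (b - L v) * \<bar>W v\<bar>)" for v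
    proof (cases "v \<in> D")
      case True
      then have "(\<integral>t. norm (case_prod H (v, t)) \<partial>lborel) =
          (\<integral>t. \<bar>W v\<bar> * (indicat_real {L v..} t * indicat_real {0..b} t) \<partial>lborel)"
        by (intro Bochner_Integration.integral_cong) (auto simp: H_def abs_mult)
      then show ?thesis using in1[OF True, of "\<bar>W v\<bar>"] True by simp
    qed (simp add: H_def)
    moreover have "integrable M (\<lambda>v. indicat_real D v * (max 0 (b - L v) * \<bar>W v\<bar>))"
    proof (rule Bochner_Integration.integrable_bound)
      show "integrable M (\<lambda>v. b * (indicat_real (sub b) v * W v))"
        using admD(2)[OF assms(1)] by simp
      show "AE v in M. norm (indicat_real D v * (max 0 (b - L v) * \<bar>W v\<bar>)) \<le> norm (b * (indicat_real (sub b) v * W v))"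
      proof (rule AE_I2)
        fix v
        show "norm (indicat_real D v * (max 0 (b - L v) * \<bar>W v\<bar>)) \<le> norm (b * (indicat_real (sub b) v * W v))"
        proof (cases "v \<in> sub b")
          case True
          then have "v \<in> D" "L v \<le> b" "0 \<le> L v" using L_nonneg by (auto simp: sub_def)
          then have "max 0 (b - L v) * \<bar>W v\<bar> \<le> b * \<bar>W v\<bar>" by (intro mult_right_mono) auto
          then show ?thesis using True \<open>v \<in> D\<close> assms(2) by (simp add: abs_mult)
        next
          case False
          then show ?thesis by (auto simp: sub_def indicator_def)
        qed
      qed
    qed measurable
    ultimately show "integrable M (\<lambda>v. \<integral>t. norm (case_prod H (v, t)) \<partial>lborel)" by simp
    show "AE v in M. integrable lborel (\<lambda>t. case_prod H (v, t))"
    proof (rule AE_I2)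
      fix v
      have "H v = (\<lambda>t. (indicat_real D v * W v) * (indicat_real {L v..} t * indicat_real {0..b} t))"
        by (simp add: H_def fun_eq_iff)
      then show "integrable lborel (\<lambda>t. case_prod H (v, t))" using Hint by simp
    qed
  qed
  have "(\<integral>v. indicat_real D v * (max 0 (b - L v) * W v) \<partial>M) = (\<integral>v. (\<integral>t. H v t \<partial>lborel) \<partial>M)"
  proof (rule Bochner_Integration.integral_cong[OF refl])
    fix v
    show "indicat_real D v * (max 0 (b - L v) * W v) = (\<integral>t. H v t \<partial>lborel)"
    proof (cases "v \<in> D")
      case True
      have "(\<integral>t. H v t \<partial>lborel) = (\<integral>t. W v * (indicat_real {L v..} t * indicat_real {0..b} t) \<partial>lborel)"
        using True by (intro Bochner_Integration.integral_cong) (auto simp: H_def)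
      also have "\<dots> = W v * max 0 (b - L v)" by (rule in1[OF True])
      finally show ?thesis using True by (simp add: mult.commute)
    qed (simp add: H_def)
  qed
  also have "\<dots> = (\<integral>t. (\<integral>v. H v t \<partial>M) \<partial>lborel)"
    by (rule trans[OF P.integral_fst[OF int] P.integral_snd[OF int, symmetric]])
  also have "\<dots> = (\<integral>t. indicat_real {0..b} t * V W t \<partial>lborel)"
  proof (rule Bochner_Integration.integral_cong[OF refl])
    fix t
    have "(\<integral>v. H v t \<partial>M) = (\<integral>v. indicat_real {0..b} t * (indicat_real (sub t) v * W v) \<partial>M)"
      by (intro Bochner_Integration.integral_cong refl) (auto simp: H_def indicator_def sub_def)
    then show "(\<integral>v. H v t \<partial>M) = indicat_real {0..b} t * V W t" by (simp add: V_def)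
  qed
  finally show ?thesis .
qed

text \<open>By \<open>integral_V\<close> the distribution function of \<open>W\<close> is the
  density of \<open>W2\<close>, that is, a primitive of the density of \<open>W\<close>. The
  remainder is integrated from infinity, which preserves its decay, and its total mass
  \<open>R0\<close> moves into the polynomial.\<close>

lemma nice_integrate:
  assumes \<epsilon>: "0 < \<epsilon>" and W: "nice \<epsilon> m W" and W2: "adm W2"
    and V2: "\<And>b. 0 \<le> b \<Longrightarrow> V W2 b = (\<integral>v. indicat_real D v * (max 0 (b - L v) * W v) \<partial>M)"
  shows "nice \<epsilon> (Suc m) W2"
proof -
  obtain P r where adm: "adm W" and P: "P = 0 \<or> degree P < m" and r [measurable]: "r \<in> borel_measurable borel"
    and ir: "integrable lborel (\<lambda>l. indicat_real {0..} l * (exp (\<epsilon> * l) * r l))"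
    and V: "\<And>b. b\<ge>0 \<Longrightarrow> V W b = (\<integral>l. indicat_real {0..b} l * (poly P l + r l) \<partial>lborel)"
    using W by (auto simp: nice_def)
  obtain Q where Q: "pderiv Q = P" "degree Q \<le> Suc (degree P)" "P = 0 \<Longrightarrow> Q = 0"
    by (rule poly_antiderivative[of P]) blast
  have ri: "integrable lborel (\<lambda>l. indicat_real A l * r l)" if "A \<subseteq> {0..}" "A \<in> sets borel" for A
    using integrable_weight_Icc[OF _ r ir that] \<epsilon> by simp
  define R0 where "R0 = (\<integral>l. indicat_real {0..} l * r l \<partial>lborel)"
  \<comment> \<open>The maximum with 0 keeps the integration inside [0, \<infinity>), where
    \<open>r\<close> is controlled.\<close>
  define r2 where "r2 t = - (\<integral>l. indicat_real {l. max 0 t < l} l * r l \<partial>lborel)" for t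
  define P2 where "P2 = Q + [:R0 - poly Q 0:]"
  have VW: "V W t = poly P2 t + r2 t" if t: "0 \<le> t" for t
  proof -
    have "V W t = (\<integral>l. indicat_real {0..t} l * poly P l \<partial>lborel) + (\<integral>l. indicat_real {0..t} l * r l \<partial>lborel)"
      unfolding V[OF t] distrib_left by (intro Bochner_Integration.integral_add integrable_poly_Icc ri) auto
    also have "(\<integral>l. indicat_real {0..t} l * poly P l \<partial>lborel) = poly Q t - poly Q 0"
      using integral_poly[OF t, of Q] Q(1) by simp
    also have "(\<integral>l. indicat_real {0..t} l * r l \<partial>lborel) =
        (\<integral>l. indicat_real {0..} l * r l - indicat_real {l. max 0 t < l} l * r l \<partial>lborel)"
      using t by (intro Bochner_Integration.integral_cong) (auto simp: indicator_def)
    also have "\<dots> = R0 + r2 t"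
      unfolding R0_def r2_def
      by (subst Bochner_Integration.integral_diff) (auto intro!: ri)
    finally show ?thesis by (simp add: P2_def)
  qed
  have r2m [measurable]: "r2 \<in> borel_measurable borel"
  proof -
    have "(\<lambda>t. \<integral>l. (if max 0 t < l then r l else 0) \<partial>lborel) \<in> borel_measurable borel"
      by (rule lborel.borel_measurable_lebesgue_integral) measurable
    moreover have "r2 = (\<lambda>t. - (\<integral>l. (if max 0 t < l then r l else 0) \<partial>lborel))"
      unfolding r2_def by (intro ext arg_cong[where f = uminus] Bochner_Integration.integral_cong) auto
    ultimately show ?thesis by simp
  qed
  have ir2: "integrable lborel (\<lambda>t. indicat_real {0..} t * (exp (\<epsilon> * t) * r2 t))"
  proof -
    \<comment> \<open>Fubini on the region 0 \<le> t < l. Integrating exp (\<epsilon> * t) over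
      \<open>t\<close> gives (exp (\<epsilon> * l) - 1) / \<epsilon>, so a positive rate survives
      the primitive without loss.\<close>
    define H where "H l t = (if 0 \<le> t \<and> t < l then exp (\<epsilon> * t) * r l else 0)" for l t
    have inn: "(\<integral>t. norm (H l t) \<partial>lborel) = indicat_real {0..} l * ((exp (\<epsilon> * l) - 1) / \<epsilon> * \<bar>r l\<bar>)"
      and inn': "integrable lborel (H l)" for l
    proof -
      have *: "has_bochner_integral lborel (\<lambda>t. (if 0 \<le> t \<and> t < l then exp (\<epsilon> * t) else 0)) (indicat_real {0..} l * ((exp (\<epsilon> * l) - 1) / \<epsilon>))"
      proof (cases "0 \<le> l")
        case True
        have "integrable lborel (\<lambda>t. indicat_real {0..l} t * exp (\<epsilon> * t))"
          using borel_integrable_atLeastAtMost'[of 0 l "\<lambda>t. exp (\<epsilon> * t)"]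
          by (simp add: set_integrable_def continuous_intros)
        moreover have "(\<integral>t. indicat_real {0..l} t * exp (\<epsilon> * t) \<partial>lborel) = exp (\<epsilon> * l) / \<epsilon> - exp (\<epsilon> * 0) / \<epsilon>"
        proof -
          have "((\<lambda>t. exp (\<epsilon> * t) / \<epsilon>) has_vector_derivative exp (\<epsilon> * x)) (at x within {0..l})" for x
            unfolding has_real_derivative_iff_has_vector_derivative[symmetric]
            using \<epsilon> by (auto intro!: derivative_eq_intros)
          then show ?thesis
            using integral_FTC_atLeastAtMost[OF True, of "\<lambda>t. exp (\<epsilon> * t) / \<epsilon>" "\<lambda>t. exp (\<epsilon> * t)"]
            by (simp add: continuous_intros)
        qed
        ultimately have "has_bochner_integral lborel (\<lambda>t. indicat_real {0..l} t * exp (\<epsilon> * t)) ((exp (\<epsilon> * l) - 1) / \<epsilon>)"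
          by (simp add: has_bochner_integral_iff diff_divide_distrib)
        moreover have "AE t in lborel. indicat_real {0..l} t * exp (\<epsilon> * t) = (if 0 \<le> t \<and> t < l then exp (\<epsilon> * t) else 0)"
          using AE_lborel_singleton[of l] by eventually_elim (auto simp: indicator_def)
        ultimately show ?thesis
          using True by (subst has_bochner_integral_cong_AE[where g = "\<lambda>t. indicat_real {0..l} t * exp (\<epsilon> * t)"])
            (auto elim: eventually_mono)
      next
        case False
        then have "(\<lambda>t. (if 0 \<le> t \<and> t < l then exp (\<epsilon> * t) else 0)) = (\<lambda>_. 0)" by (auto simp: fun_eq_iff)
        then show ?thesis using False by (simp add: has_bochner_integral_zero)
      qed
      have eq: "norm (H l t) = \<bar>r l\<bar> * (if 0 \<le> t \<and> t < l then exp (\<epsilon> * t) else 0)"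
        "H l t = r l * (if 0 \<le> t \<and> t < l then exp (\<epsilon> * t) else 0)" for t
        by (auto simp: H_def abs_mult)
      show "(\<integral>t. norm (H l t) \<partial>lborel) = indicat_real {0..} l * ((exp (\<epsilon> * l) - 1) / \<epsilon> * \<bar>r l\<bar>)"
        unfolding eq(1) using has_bochner_integral_integral_eq[OF *] by simp
      show "integrable lborel (H l)"
      proof -
        have "H l = (\<lambda>t. r l * (if 0 \<le> t \<and> t < l then exp (\<epsilon> * t) else 0))" using eq(2) by (rule ext)
        then show ?thesis using * by (simp only: integrable_mult_right has_bochner_integral_iff)
      qed
    qed
    have "integrable (lborel \<Otimes>\<^sub>M lborel) (case_prod H)"
    proof (rule lborel_pair.Fubini_integrable)
      show "case_prod H \<in> borel_measurable (lborel \<Otimes>\<^sub>M lborel)"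
        unfolding H_def split_beta' by measurable
      have "integrable lborel (\<lambda>l. \<bar>indicat_real {0..} l * (exp (\<epsilon> * l) * r l) - indicat_real {0..} l * r l\<bar> / \<epsilon>)"
        by (intro integrable_divide integrable_abs Bochner_Integration.integrable_diff ir ri) auto
      moreover have "\<bar>indicat_real {0..} l * (exp (\<epsilon> * l) * r l) - indicat_real {0..} l * r l\<bar> / \<epsilon> =
          indicat_real {0..} l * ((exp (\<epsilon> * l) - 1) / \<epsilon> * \<bar>r l\<bar>)" for l
      proof (cases "0 \<le> l")
        case True
        then have "0 \<le> exp (\<epsilon> * l) - 1" using \<epsilon> by simp
        moreover have "exp (\<epsilon> * l) * r l - r l = (exp (\<epsilon> * l) - 1) * r l" by (simp add: algebra_simps)
        ultimately show ?thesis using True by (simp add: abs_mult)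
      qed simp
      ultimately show "integrable lborel (\<lambda>l. \<integral>t. norm (case_prod H (l, t)) \<partial>lborel)"
        by (simp only: inn prod.case)
    qed (simp add: inn')
    then have "integrable lborel (\<lambda>t. \<integral>l. H l t \<partial>lborel)" by (rule lborel_pair.integrable_snd)
    moreover have "(\<integral>l. H l t \<partial>lborel) = - (indicat_real {0..} t * (exp (\<epsilon> * t) * r2 t))" for t
    proof (cases "0 \<le> t")
      case True
      have "(\<integral>l. H l t \<partial>lborel) = (\<integral>l. exp (\<epsilon> * t) * (indicat_real {l. max 0 t < l} l * r l) \<partial>lborel)"
        using True by (intro Bochner_Integration.integral_cong) (auto simp: H_def indicator_def)
      then show ?thesis using True by (simp add: r2_def)
    qed (simp add: H_def)
    ultimately show ?thesis by simp
  qed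
  show ?thesis
    unfolding nice_def
  proof (intro conjI W2 exI[of _ P2] exI[of _ r2] allI impI r2m ir2)
    show "P2 = 0 \<or> degree P2 < Suc m"
    \<comment> \<open>For \<open>P = 0\<close> the new polynomial is the constant \<open>R0\<close>,
      which fits below \<open>Suc m\<close> even when \<open>m = 0\<close>.\<close>
    proof (cases "P = 0")
      case True
      then show ?thesis using Q(3) by (simp add: P2_def)
    next
      case False
      then have "degree Q \<le> m" using P Q(2) by linarith
      then have "degree P2 \<le> m" unfolding P2_def by (intro degree_add_le) auto
      then show ?thesis by simp
    qed
    fix b :: real assume b: "0 \<le> b"
    have "V W2 b = (\<integral>t. indicat_real {0..b} t * V W t \<partial>lborel)"
      unfolding V2[OF b] by (rule integral_V[OF adm b])
    also have "\<dots> = (\<integral>t. indicat_real {0..b} t * (poly P2 t + r2 t) \<partial>lborel)"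
      by (rule Bochner_Integration.integral_cong) (auto simp: VW indicator_def)
    finally show "V W2 b = (\<integral>t. indicat_real {0..b} t * (poly P2 t + r2 t) \<partial>lborel)" .
  qed
qed

end

section \<open>Integration by parts\<close>

text \<open>By convexity the increment lies between \<open>h\<close> times the derivatives at the
  two ends.\<close>

lemma sq_pos_part_diff:
  fixes x h :: real
  assumes "0 < h"
  shows "h * max 0 x \<le> ((max 0 (x + h))\<^sup>2 - (max 0 x)\<^sup>2) / 2"
    and "((max 0 (x + h))\<^sup>2 - (max 0 x)\<^sup>2) / 2 \<le> h * max 0 (x + h)"
proof -
  define p where "p = max 0 x"
  define q where "q = max 0 (x + h)"
  have pq: "(0 \<le> x \<and> p = x \<and> q = p + h) \<or> (p = 0 \<and> 0 \<le> q \<and> q \<le> h)"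
    using assms unfolding p_def q_def by linarith
  have "h * p \<le> (q\<^sup>2 - p\<^sup>2) / 2 \<and> (q\<^sup>2 - p\<^sup>2) / 2 \<le> h * q"
  proof (cases "0 \<le> x \<and> p = x \<and> q = p + h")
    case True
    then have "(q\<^sup>2 - p\<^sup>2) / 2 = h * p + h * h / 2" by (simp add: power2_eq_square algebra_simps)
    moreover have "h * q = h * p + h * h" using True by (simp add: algebra_simps)
    moreover have "0 \<le> h * h" using assms by simp
    ultimately show ?thesis by linarith
  next
    case False
    with pq have *: "p = 0" "0 \<le> q" "q \<le> h" by auto
    have "q * q \<le> h * q" using * by (intro mult_right_mono) auto
    moreover have "0 \<le> q * q" by simp
    ultimately have "(q * q) / 2 \<le> h * q" "0 \<le> q * q / 2" by linarith+
    then show ?thesis using *(1) by (simp add: power2_eq_square)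
  qed
  then show "h * max 0 x \<le> ((max 0 (x + h))\<^sup>2 - (max 0 x)\<^sup>2) / 2"
    "((max 0 (x + h))\<^sup>2 - (max 0 x)\<^sup>2) / 2 \<le> h * max 0 (x + h)"
    by (simp_all add: p_def q_def)
qed

text \<open>Squaring removes the corner at 0, so the fundamental theorem of calculus applies across
  the level set \<open>L = b\<close>.\<close>

lemma DERIV_sq_pos_part:
  fixes x :: real
  shows "((\<lambda>x. (max 0 x)\<^sup>2 / 2) has_real_derivative max 0 x) (at x)"
proof -
  consider "x < 0" | "0 < x" | "x = 0" by linarith
  then show ?thesis
  proof cases
    case 1
    have "((\<lambda>x. 0) has_real_derivative 0) (at x)" by simp
    then have "((\<lambda>x. (max 0 x)\<^sup>2 / 2) has_real_derivative 0) (at x)"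
      by (rule has_field_derivative_transform_within_open[of _ _ _ "{..<0}"]) (use 1 in auto)
    then show ?thesis using 1 by simp
  next
    case 2
    have "((\<lambda>x. x\<^sup>2 / 2) has_real_derivative x) (at x)" by (auto intro!: derivative_eq_intros)
    then have "((\<lambda>x. (max 0 x)\<^sup>2 / 2) has_real_derivative x) (at x)"
      by (rule has_field_derivative_transform_within_open[of _ _ _ "{0<..}"]) (use 2 in auto)
    then show ?thesis using 2 by simp
  next
    case 3
    have "(\<lambda>h::real. (max 0 h)\<^sup>2 / 2 / h) \<midarrow>0\<rightarrow> 0"
    proof (rule tendsto_sandwich[of "\<lambda>h. - \<bar>h\<bar>" _ _ "\<lambda>h. \<bar>h\<bar>"])
      have *: "\<bar>(max 0 h)\<^sup>2 / 2 / h\<bar> \<le> \<bar>h\<bar>" for h :: real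
        by (cases "h \<le> 0") (auto simp: power2_eq_square)
      show "\<forall>\<^sub>F h in at 0. - \<bar>h\<bar> \<le> (max 0 h)\<^sup>2 / 2 / (h::real)"
        using * by (intro always_eventually allI) (smt (verit))
      show "\<forall>\<^sub>F h in at 0. (max 0 h)\<^sup>2 / 2 / (h::real) \<le> \<bar>h\<bar>"
        using * by (intro always_eventually allI) (smt (verit))
    qed (auto intro!: tendsto_eq_intros)
    then show ?thesis using 3 by (simp add: DERIV_def)
  qed
qed

context proper_form
begin

section \<open>One-variable sections of the domain\<close>

lemma D_iff: "v \<in> D \<longleftrightarrow> v \<in> {..<d} \<rightarrow>\<^sub>E UNIV \<and> (\<forall>j. (j < n \<longrightarrow> 0 < v j) \<and> (2 * n \<le> j \<and> j < d \<longrightarrow> 0 \<le> v j))"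
  unfolding length_dom_def by auto

lemma section_D:
  assumes "r < d" "x(r := y0) \<in> D"
  shows "{y. x(r := y) \<in> D} = (if r < n then {0<..} else if r < 2 * n then UNIV else {0..})"
proof -
  have 1: "(j < n \<longrightarrow> 0 < (x(r := y0)) j) \<and> (2 * n \<le> j \<and> j < d \<longrightarrow> 0 \<le> (x(r := y0)) j)" for j
    using assms(2) unfolding D_iff by simp
  have 2: "x(r := y) \<in> {..<d} \<rightarrow>\<^sub>E UNIV" for y
    using assms by (auto simp: length_dom_def PiE_def extensional_def)
  have "x(r := y) \<in> D \<longleftrightarrow> (r < n \<longrightarrow> 0 < y) \<and> (2 * n \<le> r \<longrightarrow> 0 \<le> y)" for y
  proof
    assume "x(r := y) \<in> D"
    then have "(r < n \<longrightarrow> 0 < (x(r := y)) r) \<and> (2 * n \<le> r \<and> r < d \<longrightarrow> 0 \<le> (x(r := y)) r)"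
      unfolding D_iff by blast
    then show "(r < n \<longrightarrow> 0 < y) \<and> (2 * n \<le> r \<longrightarrow> 0 \<le> y)" using assms(1) by simp
  next
    assume y: "(r < n \<longrightarrow> 0 < y) \<and> (2 * n \<le> r \<longrightarrow> 0 \<le> y)"
    have "(j < n \<longrightarrow> 0 < (x(r := y)) j) \<and> (2 * n \<le> j \<and> j < d \<longrightarrow> 0 \<le> (x(r := y)) j)" for j
      using 1[of j] y by (cases "j = r") simp_all
    then show "x(r := y) \<in> D" unfolding D_iff using 2 by blast
  qed
  then show ?thesis by auto
qed

lemma L_section_lower:
  assumes "r < d" "x(r := y0) \<in> D"
  obtains R where "0 < R" "\<And>y. x(r := y) \<in> D \<Longrightarrow> R \<le> \<bar>y\<bar> \<Longrightarrow> b \<le> L (x(r := y))"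
proof -
  obtain C1 where C1: "\<And>v. v \<in> D \<Longrightarrow> Nmax v - C1 \<le> L v" by (rule L_lower) blast
  show ?thesis
  proof (rule that[of "1 + (\<bar>b\<bar> + \<bar>C1\<bar>) / c"])
    show "0 < 1 + (\<bar>b\<bar> + \<bar>C1\<bar>) / c" using c_pos by (intro add_pos_nonneg) auto
    fix y assume y: "x(r := y) \<in> D" "1 + (\<bar>b\<bar> + \<bar>C1\<bar>) / c \<le> \<bar>y\<bar>"
    have "(\<bar>b\<bar> + \<bar>C1\<bar>) / c \<le> \<bar>y\<bar>" using y(2) by linarith
    then have "\<bar>b\<bar> + \<bar>C1\<bar> \<le> c * \<bar>y\<bar>" using c_pos by (simp add: field_simps)
    also have "c * \<bar>y\<bar> \<le> c * (\<Sum>j<d. \<bar>(x(r := y)) j\<bar>)"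
      using member_le_sum[of r "{..<d}" "\<lambda>j. \<bar>(x(r := y)) j\<bar>"] assms(1) c_pos by simp
    also have "\<dots> \<le> Nmax (x(r := y))" by (rule growth[OF y(1)])
    finally show "b \<le> L (x(r := y))" using C1[OF y(1)] by linarith
  qed
qed

text \<open>As \<open>y\<close> decreases to 0, the term - 2 * e r * ln (sinh (y / 2)) tends to
  infinity because \<open>e r \<ge> 1\<close>, and the rest is bounded below. Hence functions cut
  off at \<open>L = b\<close> vanish near the x-faces.\<close>

lemma L_section_at_0:
  assumes r: "r < n"
  shows "\<exists>\<delta>>0. \<forall>y. 0 < y \<longrightarrow> y \<le> \<delta> \<longrightarrow> b \<le> L (x(r := y))"
proof -
  have rd: "r < d" using r by simp
  obtain i where i: "i \<in> I" using I_ne by blast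
  then obtain T where T: "T \<in> G i" using G_ne by blast
  \<comment> \<open>\<open>A\<close> is a lower bound for 2 * ln Z uniform in 0 < y \<le> 1, and
    \<open>B\<close> collects the sinh factors that do not involve \<open>y\<close>.\<close>
  define A where "A = ln (a i T) + lin_form d T x - \<bar>T r\<bar> * (1 + \<bar>x r\<bar>)"
  define B where "B = (\<Sum>j\<in>{..<n} - {r}. e j * ln (sinh (x j / 2)))"
  have low: "A - 2 * B - 2 * (e r * ln (sinh (y / 2))) \<le> L (x(r := y))" if y: "0 < y" "y \<le> 1" for y
  proof -
    have "\<bar>y - x r\<bar> \<le> 1 + \<bar>x r\<bar>" using y by linarith
    then have "\<bar>T r * (y - x r)\<bar> \<le> \<bar>T r\<bar> * (1 + \<bar>x r\<bar>)"
      unfolding abs_mult by (intro mult_left_mono) auto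
    then have "A \<le> ln (a i T) + lin_form d T (x(r := y))"
      unfolding A_def lin_form_upd[OF rd] by linarith
    also have "\<dots> = ln (a i T * exp (lin_form d T (x(r := y))))" using a_pos[OF i T] by (simp add: ln_mult)
    also have "\<dots> \<le> ln (S i (x(r := y)))"
      using S_ge[OF i T] a_pos[OF i T] S_pos[OF i] by (subst ln_le_cancel_iff) auto
    also have "\<dots> = 2 * ln (sqrt (S i (x(r := y))))" using S_pos[OF i, of "x(r := y)"] by (simp add: ln_sqrt)
    also have "ln (sqrt (S i (x(r := y)))) \<le> ln (Z (x(r := y)))"
      using Z_ge[OF i] S_pos[OF i] Z_pos by (subst ln_le_cancel_iff) auto
    finally have 1: "A \<le> 2 * ln (Z (x(r := y)))" by simp
    have "(\<Sum>j<n. e j * ln (sinh ((x(r := y)) j / 2))) = e r * ln (sinh (y / 2)) +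
        (\<Sum>j\<in>{..<n} - {r}. e j * ln (sinh ((x(r := y)) j / 2)))"
      using r by (subst sum.remove[of _ r]) auto
    also have "(\<Sum>j\<in>{..<n} - {r}. e j * ln (sinh ((x(r := y)) j / 2))) = B"
      unfolding B_def by (intro sum.cong) auto
    finally have 2: "(\<Sum>j<n. e j * ln (sinh ((x(r := y)) j / 2))) = e r * ln (sinh (y / 2)) + B" .
    have "0 \<le> 2 * ln (2 :: real)" by simp
    with 1 show ?thesis unfolding L_def 2 distrib_left by linarith
  qed
  have "filterlim (\<lambda>y::real. ln (sinh (y / 2))) at_bot (at_right 0)"
  proof (rule filterlim_compose[OF ln_at_0])
    show "filterlim (\<lambda>y::real. sinh (y / 2)) (at_right 0) (at_right 0)"
    proof (rule filterlim_at[THEN iffD2], intro conjI)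
      have "((\<lambda>y::real. sinh (y / 2)) \<longlongrightarrow> sinh (0 / 2)) (at_right 0)"
        by (intro tendsto_intros) auto
      then show "((\<lambda>y::real. sinh (y / 2)) \<longlongrightarrow> 0) (at_right 0)" by simp
      show "\<forall>\<^sub>F y in at_right 0. sinh (y / 2) \<in> {0<..} \<and> sinh (y / 2) \<noteq> (0::real)"
        using eventually_at_right_less[of "0::real"] by eventually_elim auto
    qed
  qed
  then have "\<forall>\<^sub>F y in at_right 0. ln (sinh (y / 2)) \<le> min 0 ((A - 2 * B - b) / 2)"
    unfolding filterlim_at_bot by blast
  then obtain \<delta>0 where \<delta>0: "0 < \<delta>0" "\<And>y. 0 < y \<Longrightarrow> y < \<delta>0 \<Longrightarrow> ln (sinh (y / 2)) \<le> min 0 ((A - 2 * B - b) / 2)"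
    unfolding eventually_at_right_field by auto
  show ?thesis
  proof (intro exI[of _ "min 1 (\<delta>0 / 2)"] conjI allI impI)
    show "0 < min 1 (\<delta>0 / 2)" using \<delta>0(1) by simp
    fix y assume y: "0 < y" "y \<le> min 1 (\<delta>0 / 2)"
    have l: "ln (sinh (y / 2)) \<le> 0" "2 * ln (sinh (y / 2)) \<le> A - 2 * B - b" using \<delta>0(2)[of y] y \<delta>0(1) by auto
    have "e r * ln (sinh (y / 2)) \<le> 1 * ln (sinh (y / 2))"
      using e_pos[OF r] l(1) by (intro mult_right_mono_neg) auto
    then show "b \<le> L (x(r := y))" using low[of y] y l(2) by simp
  qed
qed

text \<open>The integral is a difference of end values of \<open>H\<close>. These vanish where
  \<open>L \<ge> b\<close>, that is far out and near an x-face, and on a y-face by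
  assumption.\<close>

lemma section_integral_zero:
  assumes r: "r < d"
    and H: "pd r H K"
    and zero: "\<And>v. v \<in> D \<Longrightarrow> b \<le> L v \<Longrightarrow> H v = 0" "\<And>v. v \<in> D \<Longrightarrow> b \<le> L v \<Longrightarrow> K v = 0"
    and bd: "\<And>v. v \<in> D \<Longrightarrow> 2 * n \<le> r \<Longrightarrow> v r = 0 \<Longrightarrow> H v = 0"
  shows "(\<integral>y. indicat_real D (x(r := y)) * K (x(r := y)) \<partial>lborel) = 0"
proof (cases "\<exists>y0. x(r := y0) \<in> D")
  case False
  then show ?thesis by simp
next
  case True
  then obtain y0 where y0: "x(r := y0) \<in> D" by blast
  note sec = section_D[OF r y0]
  have inD: "x(r := y) \<in> D \<longleftrightarrow> y \<in> (if r < n then {0<..} else if r < 2 * n then UNIV else {0..})" for y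
    using sec by blast
  obtain R where R: "0 < R" "\<And>y. x(r := y) \<in> D \<Longrightarrow> R \<le> \<bar>y\<bar> \<Longrightarrow> b \<le> L (x(r := y))"
    by (rule L_section_lower[OF r y0]) blast
  define f where "f y = indicat_real D (x(r := y)) * K (x(r := y))" for y
  have "\<exists>\<alpha> \<beta>. \<alpha> \<le> \<beta> \<and> (\<forall>y\<in>{\<alpha>..\<beta>}. x(r := y) \<in> D) \<and> H (x(r := \<alpha>)) = 0 \<and> H (x(r := \<beta>)) = 0 \<and>
      (\<forall>y. y \<notin> {\<alpha>..\<beta>} \<longrightarrow> f y = 0)"
  proof -
    consider "r < n" | "n \<le> r" "r < 2 * n" | "2 * n \<le> r" by linarith
    then show ?thesis
    proof cases
      case 1
      have D: "x(r := y) \<in> D \<longleftrightarrow> 0 < y" for y using inD 1 by simp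
      obtain \<delta> where \<delta>: "0 < \<delta>" "\<And>y. 0 < y \<Longrightarrow> y \<le> \<delta> \<Longrightarrow> b \<le> L (x(r := y))"
        using L_section_at_0[OF 1, of b x] by blast
      have z: "H (x(r := y)) = 0 \<and> K (x(r := y)) = 0" if "0 < y" "y \<le> \<delta> \<or> R \<le> y" for y
        using zero[of "x(r := y)"] D[of y] \<delta>(2)[of y] R(2)[of y] that by auto
      show ?thesis
      proof (rule exI[of _ "\<delta>"], rule exI[of _ "\<delta> + R"], intro conjI ballI allI impI)
        show "\<delta> \<le> \<delta> + R" using R by simp
        show "H (x(r := \<delta>)) = 0" "H (x(r := \<delta> + R)) = 0" using z[of \<delta>] z[of "\<delta> + R"] \<delta> R by auto
        show "x(r := y) \<in> D" if "y \<in> {\<delta>..\<delta> + R}" for y using that \<delta>(1) D by auto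
        show "f y = 0" if "y \<notin> {\<delta>..\<delta> + R}" for y
          using z[of y] D[of y] that \<delta>(1) by (cases "0 < y") (auto simp: f_def)
      qed
    next
      case 2
      have D: "x(r := y) \<in> D" for y using inD 2 by simp
      have z: "H (x(r := y)) = 0 \<and> K (x(r := y)) = 0" if "R \<le> \<bar>y\<bar>" for y
        using zero[of "x(r := y)"] D[of y] R(2)[of y] that by auto
      show ?thesis
      proof (rule exI[of _ "- R"], rule exI[of _ R], intro conjI ballI allI impI)
        show "- R \<le> R" using R by simp
        show "H (x(r := - R)) = 0" "H (x(r := R)) = 0" using z[of "- R"] z[of R] R by auto
        show "f y = 0" if "y \<notin> {- R..R}" for y
        proof -
          have "R \<le> \<bar>y\<bar>" using that by (simp add: not_le) linarith
          then show ?thesis using z[of y] by (simp add: f_def)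
        qed
      qed (rule D)
    next
      case 3
      have D: "x(r := y) \<in> D \<longleftrightarrow> 0 \<le> y" for y using inD 3 by simp
      have z: "H (x(r := y)) = 0 \<and> K (x(r := y)) = 0" if "R \<le> y" for y
        using zero[of "x(r := y)"] D[of y] R(1) R(2)[of y] that by auto
      show ?thesis
      proof (rule exI[of _ 0], rule exI[of _ R], intro conjI ballI allI impI)
        show "0 \<le> R" using R by simp
        show "H (x(r := 0)) = 0" using bd[of "x(r := 0)"] D[of 0] 3 by simp
        show "H (x(r := R)) = 0" using z[of R] by simp
        show "x(r := y) \<in> D" if "y \<in> {0..R}" for y using that D by auto
        show "f y = 0" if "y \<notin> {0..R}" for y
          using z[of y] D[of y] that by (cases "0 \<le> y") (auto simp: f_def)
      qed
    qed
  qed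
  then obtain \<alpha> \<beta> where \<alpha>\<beta>: "\<alpha> \<le> \<beta>" "\<And>y. y \<in> {\<alpha>..\<beta>} \<Longrightarrow> x(r := y) \<in> D" "H (x(r := \<alpha>)) = 0" "H (x(r := \<beta>)) = 0"
      "\<And>y. y \<notin> {\<alpha>..\<beta>} \<Longrightarrow> f y = 0"
    by blast
  have "((\<lambda>y. K (x(r := y))) has_integral (H (x(r := \<beta>)) - H (x(r := \<alpha>)))) {\<alpha>..\<beta>}"
  proof (rule fundamental_theorem_of_calculus[OF \<alpha>\<beta>(1)])
    fix y assume "y \<in> {\<alpha>..\<beta>}"
    then have "x(r := y) \<in> Dx" using \<alpha>\<beta>(2) D_subset by blast
    from pdD[OF H this] have "((\<lambda>z. H (x(r := z))) has_real_derivative K (x(r := y))) (at y)" by simp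
    then show "((\<lambda>z. H (x(r := z))) has_vector_derivative K (x(r := y))) (at y within {\<alpha>..\<beta>})"
      by (simp add: has_real_derivative_iff_has_vector_derivative has_vector_derivative_at_within)
  qed
  then have "((\<lambda>y. K (x(r := y))) has_integral 0) {\<alpha>..\<beta>}" using \<alpha>\<beta> by simp
  then have "(f has_integral 0) {\<alpha>..\<beta>}"
    by (rule has_integral_eq[rotated]) (use \<alpha>\<beta>(2) in \<open>auto simp: f_def\<close>)
  then have *: "(f has_integral 0) UNIV"
    by (rule has_integral_on_superset) (use \<alpha>\<beta>(5) in auto)
  have "integral\<^sup>L lborel f = 0"
  \<comment> \<open>A function that is not integrable has Bochner integral 0 by convention, so the
    claim holds in either case.\<close>
  proof (cases "integrable lborel f")
    case True
    then show ?thesis using has_integral_integral_lborel[OF True] * has_integral_unique by blast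
  qed (rule not_integrable_integral_eq)
  then show ?thesis by (simp add: f_def[abs_def])
qed

lemma integral_pd_zero:
  assumes r: "r < d"
    and H: "pd r H K"
    and zero: "\<And>v. v \<in> D \<Longrightarrow> b \<le> L v \<Longrightarrow> H v = 0" "\<And>v. v \<in> D \<Longrightarrow> b \<le> L v \<Longrightarrow> K v = 0"
    and bd: "\<And>v. v \<in> D \<Longrightarrow> 2 * n \<le> r \<Longrightarrow> v r = 0 \<Longrightarrow> H v = 0"
    and int: "integrable M (\<lambda>v. indicat_real D v * K v)"
  shows "(\<integral>v. indicat_real D v * K v \<partial>M) = 0"
proof -
  interpret product_sigma_finite "\<lambda>_. lborel :: real measure" ..
  define J where "J = {..<d} - {r}"
  have J: "{..<d} = insert r J" "finite J" "r \<notin> J" using r by (auto simp: J_def)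
  have "(\<integral>v. indicat_real D v * K v \<partial>M) =
      (\<integral>x. (\<integral>y. indicat_real D (x(r := y)) * K (x(r := y)) \<partial>lborel) \<partial>PiM J (\<lambda>_. lborel))"
    unfolding J(1) by (rule product_integral_insert[OF J(2,3)]) (use int J(1) in simp)
  also have "\<dots> = 0"
    by (subst section_integral_zero[OF r H zero bd]) simp_all
  finally show ?thesis .
qed

lemma integrable_pos_part:
  assumes "adm W" and [measurable]: "\<phi> \<in> borel_measurable borel"
    and "\<And>t. t \<le> b \<Longrightarrow> 0 \<le> t \<Longrightarrow> \<bar>\<phi> t\<bar> \<le> C" "\<And>t. b < t \<Longrightarrow> \<phi> t = 0"
  shows "integrable M (\<lambda>v. indicat_real D v * (\<phi> (L v) * W v))"
proof (rule Bochner_Integration.integrable_bound)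
  note [measurable] = admD(1)[OF assms(1)]
  show "integrable M (\<lambda>v. C * (indicat_real (sub b) v * W v))" using admD(2)[OF assms(1)] by simp
  show "(\<lambda>v. indicat_real D v * (\<phi> (L v) * W v)) \<in> borel_measurable M" by measurable
  show "AE v in M. norm (indicat_real D v * (\<phi> (L v) * W v)) \<le> norm (C * (indicat_real (sub b) v * W v))"
  proof (rule AE_I2)
    fix v
    show "norm (indicat_real D v * (\<phi> (L v) * W v)) \<le> norm (C * (indicat_real (sub b) v * W v))"
    proof (cases "v \<in> sub b")
      case True
      then have v: "v \<in> D" "L v \<le> b" by (auto simp: sub_def)
      then have "\<bar>\<phi> (L v)\<bar> \<le> C" using assms(3)[of "L v"] L_nonneg[of v] by blast
      then have "\<bar>\<phi> (L v)\<bar> \<le> \<bar>C\<bar>" by linarith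
      then have "\<bar>\<phi> (L v)\<bar> * \<bar>W v\<bar> \<le> \<bar>C\<bar> * \<bar>W v\<bar>" by (rule mult_right_mono) simp
      then show ?thesis using True v by (simp add: abs_mult)
    next
      case False
      then have "v \<notin> D \<or> \<phi> (L v) = 0" using assms(4)[of "L v"] by (auto simp: sub_def)
      then show ?thesis using False by auto
    qed
  qed
qed

text \<open>The difference of the two integrands is the partial derivative of half the squared
  positive part of \<open>b - L\<close> times \<open>F\<close>, which has no boundary terms.\<close>

lemma by_parts_smooth:
  assumes r: "r < d" and F: "pd r F F'"
    and bd: "\<And>v. v \<in> D \<Longrightarrow> 2 * n \<le> r \<Longrightarrow> v r = 0 \<Longrightarrow> F v = 0"
    and adm: "adm F'" "adm (\<lambda>v. dL r v * F v)" and b: "0 \<le> b"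
  shows "(\<integral>v. indicat_real D v * (max 0 (b - L v) * (dL r v * F v)) \<partial>M) =
    (\<integral>v. indicat_real D v * ((max 0 (b - L v))\<^sup>2 / 2 * F' v) \<partial>M)"
proof -
  define H where "H v = (max 0 (b - L v))\<^sup>2 / 2 * F v" for v
  define K where "K v = (max 0 (b - L v))\<^sup>2 / 2 * F' v - max 0 (b - L v) * (dL r v * F v)" for v
  have pd: "pd r H K"
  proof (rule pdI)
    fix v assume v: "v \<in> Dx"
    have "((\<lambda>x. b - L (v(r := x))) has_real_derivative 0 - dL r v) (at (v r))"
      by (rule DERIV_diff[OF DERIV_const pdD[OF pd_L[OF r] v]])
    from DERIV_chain2[OF DERIV_sq_pos_part this]
    have "((\<lambda>x. (max 0 (b - L (v(r := x))))\<^sup>2 / 2) has_real_derivative max 0 (b - L v) * (0 - dL r v)) (at (v r))"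
      by simp
    from DERIV_mult[OF this pdD[OF F v]]
    show "((\<lambda>x. H (v(r := x))) has_real_derivative K v) (at (v r))"
      unfolding H_def K_def by (simp add: algebra_simps)
  qed
  have i1: "integrable M (\<lambda>v. indicat_real D v * ((max 0 (b - L v))\<^sup>2 / 2 * F' v))"
  proof (rule integrable_pos_part[OF adm(1), of "\<lambda>t. (max 0 (b - t))\<^sup>2 / 2" b "b\<^sup>2"])
    fix t assume "t \<le> b" "0 \<le> t"
    then have "(b - t)\<^sup>2 \<le> b\<^sup>2" by (intro power_mono) auto
    moreover have "max 0 (b - t) = b - t" using \<open>t \<le> b\<close> by simp
    ultimately show "\<bar>(max 0 (b - t))\<^sup>2 / 2\<bar> \<le> b\<^sup>2" by (simp add: abs_le_iff) (smt (verit) zero_le_power2)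
  qed auto
  have i2: "integrable M (\<lambda>v. indicat_real D v * (max 0 (b - L v) * (dL r v * F v)))"
    by (rule integrable_pos_part[OF adm(2), of "\<lambda>t. max 0 (b - t)" b b]) auto
  have "(\<integral>v. indicat_real D v * K v \<partial>M) = 0"
  proof (rule integral_pd_zero[OF r pd])
    show "\<And>v. v \<in> D \<Longrightarrow> b \<le> L v \<Longrightarrow> H v = 0" by (simp add: H_def)
    show "\<And>v. v \<in> D \<Longrightarrow> b \<le> L v \<Longrightarrow> K v = 0" by (simp add: K_def)
    show "\<And>v. v \<in> D \<Longrightarrow> 2 * n \<le> r \<Longrightarrow> v r = 0 \<Longrightarrow> H v = 0" using bd by (simp add: H_def)
    show "integrable M (\<lambda>v. indicat_real D v * K v)"
      using Bochner_Integration.integrable_diff[OF i1 i2] by (simp add: K_def right_diff_distrib)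
  qed
  then have "(\<integral>v. indicat_real D v * ((max 0 (b - L v))\<^sup>2 / 2 * F' v) -
      indicat_real D v * (max 0 (b - L v) * (dL r v * F v)) \<partial>M) = 0"
    by (simp add: K_def right_diff_distrib)
  then show ?thesis using i1 i2 by simp
qed

text \<open>Differentiation in \<open>b\<close> under the integral, by dominated convergence along
  the increments 1 / (k + 1). All integrands live on the sublevel set of \<open>b + 1\<close>, which
  provides the majorant.\<close>

lemma diff_quotient_limit:
  fixes \<phi> \<psi> :: "real \<Rightarrow> real"
  assumes adm: "adm W" and b: "0 \<le> b"
    and [measurable]: "\<phi> \<in> borel_measurable borel" "\<psi> \<in> borel_measurable borel"
    and int: "\<And>b. 0 \<le> b \<Longrightarrow> integrable M (\<lambda>v. indicat_real D v * (\<phi> (b - L v) * W v))"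
    and lim: "\<And>x. (\<lambda>k. real (Suc k) * (\<phi> (x + 1 / real (Suc k)) - \<phi> x)) \<longlonglongrightarrow> \<psi> x"
    and bnd: "\<And>x k. x \<le> b \<Longrightarrow> \<bar>real (Suc k) * (\<phi> (x + 1 / real (Suc k)) - \<phi> x)\<bar> \<le> C"
    and zero: "\<And>x k. x < -1 \<Longrightarrow> \<phi> (x + 1 / real (Suc k)) - \<phi> x = 0"
  shows "(\<lambda>k. real (Suc k) * ((\<integral>v. indicat_real D v * (\<phi> (b + 1 / real (Suc k) - L v) * W v) \<partial>M) -
      (\<integral>v. indicat_real D v * (\<phi> (b - L v) * W v) \<partial>M))) \<longlonglongrightarrow> (\<integral>v. indicat_real D v * (\<psi> (b - L v) * W v) \<partial>M)"
proof -
  note [measurable] = admD(1)[OF adm]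
  define s where "s k v = indicat_real D v * ((real (Suc k) * (\<phi> (b - L v + 1 / real (Suc k)) - \<phi> (b - L v))) * W v)" for k v
  have "(\<lambda>k. \<integral>v. s k v \<partial>M) \<longlonglongrightarrow> (\<integral>v. indicat_real D v * (\<psi> (b - L v) * W v) \<partial>M)"
  proof (rule integral_dominated_convergence[where w = "\<lambda>v. C * \<bar>indicat_real (sub (b + 1)) v * W v\<bar>"])
    show "integrable M (\<lambda>v. C * \<bar>indicat_real (sub (b + 1)) v * W v\<bar>)"
      using admD(2)[OF adm] by (intro integrable_mult_right integrable_abs)
    show "(\<lambda>v. indicat_real D v * (\<psi> (b - L v) * W v)) \<in> borel_measurable M" by measurable
    show "s k \<in> borel_measurable M" for k unfolding s_def[abs_def] by measurable
    show "AE v in M. (\<lambda>k. s k v) \<longlonglongrightarrow> indicat_real D v * (\<psi> (b - L v) * W v)"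
      unfolding s_def by (intro AE_I2 tendsto_mult tendsto_const lim)
    show "AE v in M. norm (s k v) \<le> C * \<bar>indicat_real (sub (b + 1)) v * W v\<bar>" for k
    proof (rule AE_I2)
      fix v
      have C0: "0 \<le> C" using bnd[OF order_refl, of 0] by linarith
      show "norm (s k v) \<le> C * \<bar>indicat_real (sub (b + 1)) v * W v\<bar>"
      proof (cases "v \<in> sub (b + 1)")
        case True
        then have v: "v \<in> D" by (simp add: sub_def)
        then have "\<bar>real (Suc k) * (\<phi> (b - L v + 1 / real (Suc k)) - \<phi> (b - L v))\<bar> \<le> C"
          using L_nonneg[OF v] by (intro bnd) auto
        then have "\<bar>real (Suc k) * (\<phi> (b - L v + 1 / real (Suc k)) - \<phi> (b - L v))\<bar> * \<bar>W v\<bar> \<le> C * \<bar>W v\<bar>"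
          by (rule mult_right_mono) simp
        then show ?thesis using True v unfolding s_def by (simp only: real_norm_def abs_mult indicator_simps) simp
      next
        case False
        then have "v \<notin> D \<or> b - L v < -1" by (auto simp: sub_def)
        then have "s k v = 0" unfolding s_def using zero[of "b - L v" k] by auto
        then show ?thesis using C0 by simp
      qed
    qed
  qed
  moreover have "(\<integral>v. s k v \<partial>M) = real (Suc k) * ((\<integral>v. indicat_real D v * (\<phi> (b + 1 / real (Suc k) - L v) * W v) \<partial>M) -
      (\<integral>v. indicat_real D v * (\<phi> (b - L v) * W v) \<partial>M))" for k
  proof -
    have "(\<integral>v. s k v \<partial>M) = (\<integral>v. real (Suc k) * (indicat_real D v * (\<phi> (b + 1 / real (Suc k) - L v) * W v) -
      indicat_real D v * (\<phi> (b - L v) * W v)) \<partial>M)"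
    proof (rule Bochner_Integration.integral_cong[OF refl])
      fix v
      have "b - L v + 1 / real (Suc k) = b + 1 / real (Suc k) - L v" by simp
      then show "s k v = real (Suc k) * (indicat_real D v * (\<phi> (b + 1 / real (Suc k) - L v) * W v) -
        indicat_real D v * (\<phi> (b - L v) * W v))"
        unfolding s_def by (simp only:) (simp add: algebra_simps)
    qed
    also have "\<dots> = real (Suc k) * ((\<integral>v. indicat_real D v * (\<phi> (b + 1 / real (Suc k) - L v) * W v) \<partial>M) -
      (\<integral>v. indicat_real D v * (\<phi> (b - L v) * W v) \<partial>M))"
      using b by (subst integral_mult_right_zero, subst Bochner_Integration.integral_diff) (auto intro!: int)
    finally show ?thesis .
  qed
  ultimately show ?thesis by simp
qed

text \<open>Right derivative in \<open>b\<close> of the identity in \<open>by_parts_smooth\<close>: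
  the positive part turns into the indicator of \<open>L \<le> b\<close>, and half its square into
  the positive part.\<close>

lemma by_parts:
  assumes r: "r < d" and F: "pd r F F'"
    and bd: "\<And>v. v \<in> D \<Longrightarrow> 2 * n \<le> r \<Longrightarrow> v r = 0 \<Longrightarrow> F v = 0"
    and adm: "adm F'" "adm (\<lambda>v. dL r v * F v)" and b: "0 \<le> b"
  shows "V (\<lambda>v. dL r v * F v) b = (\<integral>v. indicat_real D v * (max 0 (b - L v) * F' v) \<partial>M)"
proof -
  \<comment> \<open>The value 1 at 0 is the limit of the right difference quotients, and it matches
    the closed sublevel sets in \<open>V\<close>.\<close>
  define \<theta> where "\<theta> x = (if 0 \<le> x then 1 else 0 :: real)" for x :: real
  have inv: "1 / real (Suc k) \<le> 1" "0 < 1 / real (Suc k)" for k by auto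
  have lim1: "(\<lambda>k. real (Suc k) * ((\<integral>v. indicat_real D v * (max 0 (b + 1 / real (Suc k) - L v) * (dL r v * F v)) \<partial>M) -
      (\<integral>v. indicat_real D v * (max 0 (b - L v) * (dL r v * F v)) \<partial>M)))
      \<longlonglongrightarrow> (\<integral>v. indicat_real D v * (\<theta> (b - L v) * (dL r v * F v)) \<partial>M)"
  proof (rule diff_quotient_limit[OF adm(2) b, where C = 1 and \<phi> = "\<lambda>x. max 0 x" and \<psi> = \<theta>])
    show "integrable M (\<lambda>v. indicat_real D v * (max 0 (b - L v) * (dL r v * F v)))" if "0 \<le> b" for b
      by (rule integrable_pos_part[OF adm(2), of "\<lambda>t. max 0 (b - t)" b b]) (use that in auto)
    show "\<theta> \<in> borel_measurable borel" unfolding \<theta>_def[abs_def] by measurable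
    show "(\<lambda>k. real (Suc k) * (max 0 (x + 1 / real (Suc k)) - max 0 x)) \<longlonglongrightarrow> \<theta> x" for x
    proof (rule tendsto_eventually)
      show "\<forall>\<^sub>F k in sequentially. real (Suc k) * (max 0 (x + 1 / real (Suc k)) - max 0 x) = \<theta> x"
      proof (cases "0 \<le> x")
        case True
        have "real (Suc k) * (max 0 (x + 1 / real (Suc k)) - max 0 x) = \<theta> x" for k
        proof -
          have "max 0 (x + 1 / real (Suc k)) - max 0 x = 1 / real (Suc k)"
            using True inv(2)[of k] by linarith
          then show ?thesis using True by (simp add: \<theta>_def)
        qed
        then show ?thesis by simp
      next
        case False
        have "(\<lambda>k. inverse (real (Suc k))) \<longlonglongrightarrow> 0" by (rule LIMSEQ_inverse_real_of_nat)
        moreover have "0 < - x" using False by simp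
        ultimately have "\<forall>\<^sub>F k in sequentially. inverse (real (Suc k)) < - x" by (rule order_tendstoD(2))
        then show ?thesis
        proof eventually_elim
          case (elim k)
          then have "max 0 (x + 1 / real (Suc k)) = 0" "max 0 x = 0"
            using False by (auto simp: inverse_eq_divide)
          then show ?case using False by (simp add: \<theta>_def)
        qed
      qed
    qed
    show "\<bar>real (Suc k) * (max 0 (x + 1 / real (Suc k)) - max 0 x)\<bar> \<le> 1" for x k
    proof -
      have "\<bar>max 0 (x + 1 / real (Suc k)) - max 0 x\<bar> \<le> 1 / real (Suc k)"
        using inv(2)[of k] by linarith
      then have "real (Suc k) * \<bar>max 0 (x + 1 / real (Suc k)) - max 0 x\<bar> \<le> real (Suc k) * (1 / real (Suc k))"
        by (intro mult_left_mono) auto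
      then show ?thesis by (simp add: abs_mult)
    qed
    show "max 0 (x + 1 / real (Suc k)) - max 0 x = 0" if "x < -1" for x k
      using inv(1)[of k] that by linarith
  qed measurable
  have V: "(\<integral>v. indicat_real D v * (\<theta> (b - L v) * (dL r v * F v)) \<partial>M) = V (\<lambda>v. dL r v * F v) b"
    unfolding V_def by (intro Bochner_Integration.integral_cong refl) (auto simp: \<theta>_def sub_def indicator_def)
  have lim2: "(\<lambda>k. real (Suc k) * ((\<integral>v. indicat_real D v * ((max 0 (b + 1 / real (Suc k) - L v))\<^sup>2 / 2 * F' v) \<partial>M) -
      (\<integral>v. indicat_real D v * ((max 0 (b - L v))\<^sup>2 / 2 * F' v) \<partial>M)))
      \<longlonglongrightarrow> (\<integral>v. indicat_real D v * (max 0 (b - L v) * F' v) \<partial>M)"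
  proof (rule diff_quotient_limit[OF adm(1) b, where C = "b + 1" and \<phi> = "\<lambda>x. (max 0 x)\<^sup>2 / 2" and \<psi> = "\<lambda>x. max 0 x"])
    have q: "max 0 x \<le> real (Suc k) * ((max 0 (x + 1 / real (Suc k)))\<^sup>2 / 2 - (max 0 x)\<^sup>2 / 2)"
      "real (Suc k) * ((max 0 (x + 1 / real (Suc k)))\<^sup>2 / 2 - (max 0 x)\<^sup>2 / 2) \<le> max 0 (x + 1 / real (Suc k))" for x k
      using mult_left_mono[OF sq_pos_part_diff(1)[OF inv(2)[of k], of x], of "real (Suc k)"]
        mult_left_mono[OF sq_pos_part_diff(2)[OF inv(2)[of k], of x], of "real (Suc k)"]
      by (simp_all add: diff_divide_distrib del: of_nat_Suc)
    show "integrable M (\<lambda>v. indicat_real D v * ((max 0 (b - L v))\<^sup>2 / 2 * F' v))" if b: "0 \<le> b" for b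
    proof (rule integrable_pos_part[OF adm(1), of "\<lambda>t. (max 0 (b - t))\<^sup>2 / 2" b "b\<^sup>2"])
      fix t assume "t \<le> b" "0 \<le> t"
      then have "(b - t)\<^sup>2 \<le> b\<^sup>2" by (intro power_mono) auto
      moreover have "max 0 (b - t) = b - t" using \<open>t \<le> b\<close> by simp
      ultimately show "\<bar>(max 0 (b - t))\<^sup>2 / 2\<bar> \<le> b\<^sup>2" by (simp add: abs_le_iff) (smt (verit) zero_le_power2)
    qed auto
    show "(\<lambda>k. real (Suc k) * ((max 0 (x + 1 / real (Suc k)))\<^sup>2 / 2 - (max 0 x)\<^sup>2 / 2)) \<longlonglongrightarrow> max 0 x" for x
    proof (rule tendsto_sandwich[of "\<lambda>_. max 0 x" _ _ "\<lambda>k. max 0 (x + 1 / real (Suc k))"])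
      show "(\<lambda>k. max 0 (x + 1 / real (Suc k))) \<longlonglongrightarrow> max 0 x"
      proof -
        have "(\<lambda>k. max 0 (x + 1 / real (Suc k))) \<longlonglongrightarrow> max 0 (x + 0)"
          using LIMSEQ_inverse_real_of_nat by (intro tendsto_intros) (simp add: inverse_eq_divide)
        then show ?thesis by simp
      qed
      show "(\<lambda>k. max 0 x) \<longlonglongrightarrow> max 0 x" by simp
    qed (intro always_eventually allI q)+
    show "\<bar>real (Suc k) * ((max 0 (x + 1 / real (Suc k)))\<^sup>2 / 2 - (max 0 x)\<^sup>2 / 2)\<bar> \<le> b + 1" if "x \<le> b" for x k
      using q(1)[where x = x and k = k] q(2)[where x = x and k = k] that inv(1)[of k] b by linarith
    show "(max 0 (x + 1 / real (Suc k)))\<^sup>2 / 2 - (max 0 x)\<^sup>2 / 2 = 0" if "x < -1" for x k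
    proof -
      have "max 0 (x + 1 / real (Suc k)) = 0" "max 0 x = 0" using inv(1)[of k] that by linarith+
      then show ?thesis by simp
    qed
  qed measurable
  have eq: "(\<integral>v. indicat_real D v * (max 0 (b' - L v) * (dL r v * F v)) \<partial>M) =
    (\<integral>v. indicat_real D v * ((max 0 (b' - L v))\<^sup>2 / 2 * F' v) \<partial>M)" if "0 \<le> b'" for b'
    by (rule by_parts_smooth[OF r F bd adm that])
  have b': "0 \<le> b + 1 / real (Suc k)" for k using b by simp
  show ?thesis
    using LIMSEQ_unique[OF lim1[unfolded eq[OF b] eq[OF b'] V] lim2] .
qed

end

section \<open>Induction on the rank\<close>

context proper_form
begin

section \<open>Factors vanishing on the boundary faces\<close>

definition "\<xi> H v = (\<Prod>j\<in>H. 1 - exp (- v j))" for H :: "nat set" and v :: "nat \<Rightarrow> real"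
definition "ex S v = (\<Prod>j\<in>S. exp (- v j))" for S :: "nat set" and v :: "nat \<Rightarrow> real"

lemma Bd_finite: "finite Bd" by (simp add: Bd_def)

lemma \<xi>_measurable: "H \<subseteq> Bd \<Longrightarrow> \<xi> H \<in> borel_measurable M"
  unfolding \<xi>_def[abs_def]
proof (intro borel_measurable_prod)
  fix j assume "H \<subseteq> Bd" "j \<in> H"
  then have [measurable]: "(\<lambda>v. v j) \<in> borel_measurable M" using Bd_less by auto
  show "(\<lambda>v. 1 - exp (- v j)) \<in> borel_measurable M" by measurable
qed

lemma \<xi>_bounds: "H \<subseteq> Bd \<Longrightarrow> v \<in> D \<Longrightarrow> 0 \<le> \<xi> H v \<and> \<xi> H v \<le> 1"
  unfolding \<xi>_def using D_Bd_nonneg by (auto intro!: prod_nonneg prod_le_1)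

lemma \<xi>_remove: "H \<subseteq> Bd \<Longrightarrow> j \<in> H \<Longrightarrow> \<xi> H v = (1 - exp (- v j)) * \<xi> (H - {j}) v"
  unfolding \<xi>_def using Bd_finite finite_subset by (intro prod.remove) auto

lemma wt_ex:
  fixes S :: "nat set"
  assumes "wt A J Q w" "finite S" "S \<subseteq> Bd"
  shows "wt A (J \<union> S) Q (\<lambda>v. w v * ex S v)"
  using assms(2,3)
proof (induction S)
  case empty
  then show ?case using assms(1) by (simp add: ex_def)
next
  case (insert j S)
  then have "wt A (insert j (J \<union> S)) Q (\<lambda>v. (w v * ex S v) * exp (- v j))"
    by (intro wt_exp) auto
  moreover have "(\<lambda>v. (w v * ex S v) * exp (- v j)) = (\<lambda>v. w v * ex (insert j S) v)"
    using insert.hyps by (auto simp: ex_def fun_eq_iff)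
  ultimately show ?case by simp
qed

lemma \<xi>_expand: "H \<subseteq> Bd \<Longrightarrow> \<xi> H v = (\<Sum>S\<in>Pow H. (- 1) ^ card S * ex S v)"
  unfolding \<xi>_def ex_def
  using prod_diff_conv_sum[of H "\<lambda>_. 1 :: real" "\<lambda>j. exp (- v j)"] finite_subset[OF _ Bd_finite] by simp

text \<open>Expanding the product over subsets leaves only factors exp(- v j), which the rules of
  \<open>wt\<close> allow.\<close>

lemma nice_\<xi>:
  assumes "0 \<le> \<epsilon>" "H \<subseteq> Bd" "\<And>S. S \<subseteq> H \<Longrightarrow> nice \<epsilon> m (\<lambda>v. w v * ex S v * g v)"
  shows "nice \<epsilon> m (\<lambda>v. w v * \<xi> H v * g v)"
proof -
  have "nice \<epsilon> m (\<lambda>v. \<Sum>S\<in>Pow H. (- 1) ^ card S * (w v * ex S v * g v))"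
    using assms by (intro nice_sum nice_cmult) auto
  moreover have "(\<lambda>v. \<Sum>S\<in>Pow H. (- 1) ^ card S * (w v * ex S v * g v)) = (\<lambda>v. w v * \<xi> H v * g v)"
    by (simp add: fun_eq_iff \<xi>_expand[OF assms(2)] sum_distrib_left sum_distrib_right mult_ac)
  ultimately show ?thesis by (simp only:)
qed

text \<open>After the constant 1 cancels, every term of the expansion carries some exp(- v j) with
  \<open>j\<close> in \<open>H\<close>; this is the source of additional rank.\<close>

lemma nice_one_minus_\<xi>:
  assumes "0 \<le> \<epsilon>" "H \<subseteq> Bd" "\<And>S. S \<subseteq> H \<Longrightarrow> S \<noteq> {} \<Longrightarrow> nice \<epsilon> m (\<lambda>v. w v * ex S v * g v)"
  shows "nice \<epsilon> m (\<lambda>v. w v * (1 - \<xi> H v) * g v)"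
proof -
  have "nice \<epsilon> m (\<lambda>v. \<Sum>S\<in>Pow H - {{}}. (- ((- 1) ^ card S)) * (w v * ex S v * g v))"
    using assms by (intro nice_sum nice_cmult) auto
  moreover have "(\<lambda>v. \<Sum>S\<in>Pow H - {{}}. (- ((- 1) ^ card S)) * (w v * ex S v * g v)) = (\<lambda>v. w v * (1 - \<xi> H v) * g v)"
  proof
    fix v
    have "\<xi> H v = 1 + (\<Sum>S\<in>Pow H - {{}}. (- 1) ^ card S * ex S v)"
      unfolding \<xi>_expand[OF assms(2)] using finite_subset[OF assms(2) Bd_finite]
      by (subst sum.remove[of _ "{}"]) (auto simp: ex_def)
    then show "(\<Sum>S\<in>Pow H - {{}}. (- ((- 1) ^ card S)) * (w v * ex S v * g v)) = w v * (1 - \<xi> H v) * g v"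
      by (simp add: sum_distrib_left sum_distrib_right mult_ac sum_negf)
  qed
  ultimately show ?thesis by (simp only:)
qed

lemma pd_\<xi>:
  assumes "H \<subseteq> Bd"
  shows "pd r (\<xi> H) (\<lambda>v. if r \<in> H then exp (- v r) * \<xi> (H - {r}) v else 0)"
proof (rule pdI)
  fix v :: "nat \<Rightarrow> real"
  have up: "\<xi> H' (v(r := x)) = \<xi> H' v" if "r \<notin> H'" for H' x
    unfolding \<xi>_def using that by (intro prod.cong) auto
  show "((\<lambda>x. \<xi> H (v(r := x))) has_real_derivative (if r \<in> H then exp (- v r) * \<xi> (H - {r}) v else 0)) (at (v r))"
  proof (cases "r \<in> H")
    case True
    have "(\<lambda>x. \<xi> H (v(r := x))) = (\<lambda>x. (1 - exp (- x)) * \<xi> (H - {r}) v)"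
      using \<xi>_remove[OF assms True, of "v(r := x)" for x] up[of "H - {r}"] by (simp add: fun_eq_iff)
    moreover have "((\<lambda>x. (1 - exp (- x)) * \<xi> (H - {r}) v) has_real_derivative exp (- v r) * \<xi> (H - {r}) v) (at (v r))"
      by (auto intro!: derivative_eq_intros)
    ultimately show ?thesis using True by (simp only: if_True)
  next
    case False
    then show ?thesis using up[OF False] by simp
  qed
qed

lemma pd_pf:
  assumes "r < d"
  shows "pd r (pf f) (pf (f(r := pderiv (f r))))"
proof (rule pdI)
  fix v :: "nat \<Rightarrow> real"
  have rem: "pf g v' = poly (g r) (v' r) * (\<Prod>i\<in>{..<d} - {r}. poly (g i) (v' i))" for g v'
    unfolding pf_def using assms by (intro prod.remove) auto
  have "(\<lambda>x. pf f (v(r := x))) = (\<lambda>x. poly (f r) x * (\<Prod>i\<in>{..<d} - {r}. poly (f i) (v i)))"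
    unfolding rem by (simp add: fun_eq_iff)
  moreover have "((\<lambda>x. poly (f r) x * (\<Prod>i\<in>{..<d} - {r}. poly (f i) (v i))) has_real_derivative
      poly (pderiv (f r)) (v r) * (\<Prod>i\<in>{..<d} - {r}. poly (f i) (v i))) (at (v r))"
    by (rule DERIV_cmult_right[OF poly_DERIV])
  moreover have "pf (f(r := pderiv (f r))) v = poly (pderiv (f r)) (v r) * (\<Prod>i\<in>{..<d} - {r}. poly (f i) (v i))"
    unfolding rem by simp
  ultimately show "((\<lambda>x. pf f (v(r := x))) has_real_derivative pf (f(r := pderiv (f r))) v) (at (v r))"
    by (simp only:)
qed

text \<open>A rate common to all weights with inconsistent constraints. No polynomial enters, so the
  exponent obtained in the end is independent of them.\<close>

definition good :: "real \<Rightarrow> bool" where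
  "good \<epsilon> \<longleftrightarrow> 0 < \<epsilon> \<and> (\<forall>j<n. 2 * real (e j) * \<epsilon> \<le> 1 / 2) \<and>
  (\<exists>\<epsilon>0 C. \<epsilon> < \<epsilon>0 \<and> (\<forall>A J Q w. wt A J Q w \<longrightarrow> urow d \<in> fspan (crows A J) \<longrightarrow>
     (\<forall>v\<in>D. w v \<le> C * exp (- \<epsilon>0 * Nmax v))))"

lemma good_exists: "\<exists>\<epsilon>. good \<epsilon> \<and> \<epsilon> \<le> 1 / 2"
proof -
  obtain \<epsilon>0 C where 0: "0 < \<epsilon>0" "\<And>A J Q w v. wt A J Q w \<Longrightarrow> urow d \<in> fspan (crows A J) \<Longrightarrow> v \<in> D \<Longrightarrow>
    0 \<le> Nmax v \<Longrightarrow> w v \<le> C * exp (- \<epsilon>0 * Nmax v)"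
    by (rule wt_exp_small) blast
  define m where "m = 1 + (\<Sum>j<n. real (e j))"
  have m: "1 \<le> m" unfolding m_def by (simp add: sum_nonneg)
  \<comment> \<open>The gap below \<open>\<epsilon>0\<close> leaves room for the polynomials; 1 / (4
    * m) keeps the singularities at the x-faces integrable and also gives
    \<open>\<epsilon> \<le> 1 / 2\<close>.\<close>
  define \<epsilon> where "\<epsilon> = min (\<epsilon>0 / 2) (1 / (4 * m))"
  have N: "0 \<le> Nmax v" if "v \<in> D" for v
    using growth[OF that] c_pos by (meson abs_ge_zero less_imp_le mult_nonneg_nonneg order_trans sum_nonneg)
  have "\<epsilon> \<le> 1 / (4 * m)" "1 / (4 * m) \<le> 1 / 2" "0 < \<epsilon>" "\<epsilon> < \<epsilon>0"
    using m 0(1) by (auto simp: \<epsilon>_def min_def field_simps)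
  moreover have "2 * real (e j) * \<epsilon> \<le> 1 / 2" if "j < n" for j
  proof -
    have "e j \<le> m" using member_le_sum[of j "{..<n}" "\<lambda>j. real (e j)"] that by (simp add: m_def)
    then have "2 * real (e j) * \<epsilon> \<le> 2 * m * (1 / (4 * m))"
      using \<open>\<epsilon> \<le> 1 / (4 * m)\<close> \<open>0 < \<epsilon>\<close> m by (intro mult_mono) auto
    then show ?thesis using m by simp
  qed
  moreover have "\<forall>A J Q w. wt A J Q w \<longrightarrow> urow d \<in> fspan (crows A J) \<longrightarrow> (\<forall>v\<in>D. w v \<le> C * exp (- \<epsilon>0 * Nmax v))"
    using 0(2) N by blast
  ultimately show ?thesis unfolding good_def by (intro exI[of _ \<epsilon>] conjI exI[of _ \<epsilon>0] exI[of _ C]) auto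
qed

lemma nice_inconsistent:
  assumes "good \<epsilon>" "wt A J Q w" "urow d \<in> fspan (crows A J)"
  shows "nice \<epsilon> m (\<lambda>v. w v * pf f v)"
proof -
  note [measurable] = wt_measurable[OF assms(2)]
  obtain \<epsilon>0 C where \<epsilon>: "0 < \<epsilon>" "\<forall>j<n. 2 * real (e j) * \<epsilon> \<le> 1 / 2" "\<epsilon> < \<epsilon>0" and
    bnd: "\<forall>v\<in>D. w v \<le> C * exp (- \<epsilon>0 * Nmax v)"
    using assms unfolding good_def by blast
  have "integrable M (\<lambda>v. indicat_real D v * (w v * pf f v * exp (\<epsilon> * L v)))"
  proof (rule integrable_exp_small[OF _ _ \<epsilon>(1,3)])
    show "\<bar>w v\<bar> \<le> C * exp (- \<epsilon>0 * Nmax v)" if "v \<in> D" for v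
      using bnd that wt_bounds[OF assms(2) that] by auto
  qed (use \<epsilon> in auto)
  then have "nice \<epsilon> 0 (\<lambda>v. w v * pf f v)"
    by (intro nice_exp_small \<epsilon>(1)) auto
  then show ?thesis by (rule nice_mono) simp
qed

lemma adm_sum: "(\<And>i. i \<in> A \<Longrightarrow> adm (W i)) \<Longrightarrow> adm (\<lambda>v. \<Sum>i\<in>A. W i v)"
  by (induction A rule: infinite_finite_induct) (auto intro!: adm_add simp: adm_def[of "\<lambda>_. 0"])

lemma V_sum: "finite A \<Longrightarrow> (\<And>i. i \<in> A \<Longrightarrow> adm (W i)) \<Longrightarrow> V (\<lambda>v. \<Sum>i\<in>A. W i v) b = (\<Sum>i\<in>A. V (W i) b)"
proof (induction A rule: finite_induct)
  case empty
  then show ?case by (simp add: V_def)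
next
  case (insert i A)
  have "V (\<lambda>v. W i v + (\<Sum>i\<in>A. W i v)) b = V (W i) b + V (\<lambda>v. \<Sum>i\<in>A. W i v) b"
    using insert.prems by (intro V_add adm_sum) auto
  then show ?case using insert by simp
qed

text \<open>Weights carrying the factor \<open>\<xi> H\<close> vanish on the boundary faces \<open>v\<^sub>j = 0\<close>, \<open>j \<in> H\<close>, and tame the
  singularity of \<open>\<partial>L / \<partial>v\<^sub>j\<close> there.\<close>

lemma nice_step:
  assumes \<epsilon>: "0 < \<epsilon>" and w: "wt A J Q w" and rank: "has_rank A J r" and u: "Sol u A J"
    and IH1: "\<And>A' J' Q' w'. wt A' J' Q' w' \<Longrightarrow> has_rank A' J' (Suc r) \<Longrightarrow> nice \<epsilon> m (\<lambda>v. w' v * pf f v)"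
    and IH2: "\<And>s J' w'. s < d \<Longrightarrow> wt A J' Q w' \<Longrightarrow> has_rank A J' r \<Longrightarrow>
      nice \<epsilon> m (\<lambda>v. w' v * pf (f(s := pderiv (f s))) v)"
  shows "nice \<epsilon> (Suc m) (\<lambda>v. w v * pf f v)"
proof -
  have JB: "J \<subseteq> Bd" and QI: "Q \<subseteq> I" using wt_sets[OF w] by auto
  note [measurable] = wt_measurable[OF w]
  \<comment> \<open>The faces to which \<open>u\<close> is transversal. None of them belongs to
    \<open>J\<close> since \<open>u\<close> vanishes there, so a factor exp(- v j) with
    \<open>j\<close> in \<open>H\<close> raises the rank.\<close>
  define H where "H = {j \<in> Bd. u j \<noteq> 0}"
  have H: "H \<subseteq> Bd" by (auto simp: H_def)
  note [measurable] = \<xi>_measurable[OF H]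
  obtain l where l: "log_deriv A J Q w l" using wt_log_deriv[OF w] by blast
  have pdw: "pd s w (\<lambda>v. w v * l s v)" and lm [measurable]: "l s \<in> borel_measurable M"
    and lb: "\<exists>C. \<forall>v. \<bar>l s v\<bar> \<le> C" if "s < d" for s
    using l that unfolding log_deriv_def by blast+
  obtain \<kappa> \<kappa>0 where \<kappa>: "\<And>i. i \<notin> Q \<Longrightarrow> \<kappa> i = 0" "\<And>v. (\<Sum>s<d. u s * l s v) = (\<Sum>i\<in>I. \<kappa> i * mm u i v) + \<kappa>0 * mt u v"
    using l u unfolding log_deriv_def by blast
  have wb: "0 < w v" "w v \<le> 1" if "v \<in> D" for v using wt_bounds[OF w that] by auto
  \<comment> \<open>The factor \<open>\<xi> H'\<close> expands into weights with more coordinates in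
    \<open>J'\<close>, and enlarging the constraints keeps the rank bound.\<close>
  have rank_term: "nice \<epsilon> m (\<lambda>v. w' v * \<xi> H' v * pf f v)"
    if "wt A' J' Q' w'" "has_rank A' J' (Suc r)" "H' \<subseteq> H" for A' J' Q' w' H'
  proof (rule nice_\<xi>)
    show "H' \<subseteq> Bd" using that H by blast
    fix S assume S: "S \<subseteq> H'"
    then have "S \<subseteq> Bd" using that H by blast
    then have "wt A' (J' \<union> S) Q' (\<lambda>v. w' v * ex S v)"
      using wt_ex[OF that(1)] finite_subset[OF _ Bd_finite] by blast
    moreover have "has_rank A' (J' \<union> S) (Suc r)" by (rule has_rank_mono[OF that(2)]) auto
    ultimately show "nice \<epsilon> m (\<lambda>v. w' v * ex S v * pf f v)" by (rule IH1)
  qed (use \<epsilon> in simp)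
  define wqr where "wqr i T v = w v * q i v * \<rho> i T v" for i T v
  define E where "E j v = w v * exp (- v j)" for j v
  have n_rho: "nice \<epsilon> m (\<lambda>v. \<tau> u T * ((w v * \<rho> i T v) * \<xi> H v * pf f v))" if "i \<in> Q" "T \<in> G i" for i T
  proof (cases "\<tau> u T = 0")
    case False
    show ?thesis
      by (intro nice_cmult rank_term[OF wt_rho[OF w that] has_rank_form[OF rank u JB False]]) simp
  qed (simp add: nice_0)
  have n_qrho: "nice \<epsilon> m (\<lambda>v. \<tau> u T * (wqr i T v * \<xi> H v * pf f v))" if "i \<in> I" "T \<in> G i" for i T
  proof (cases "\<tau> u T = 0")
    case False
    have "wt (insert T A) J (insert i Q) (\<lambda>v. w v * q i v * \<rho> i T v)"
      by (intro wt_rho wt_q w that) simp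
    then have "nice \<epsilon> m (\<lambda>v. (w v * q i v * \<rho> i T v) * \<xi> H v * pf f v)"
      by (rule rank_term[OF _ has_rank_form[OF rank u JB False]]) simp
    then show ?thesis unfolding wqr_def by (rule nice_cmult)
  qed (simp add: nice_0)
  have n_E: "nice \<epsilon> m (\<lambda>v. E j v * \<xi> (H - {j}) v * pf f v)" if "j \<in> H" for j
  proof -
    have j: "j \<in> Bd" "u j \<noteq> 0" using that by (auto simp: H_def)
    show ?thesis
      unfolding E_def
      by (rule rank_term[OF wt_exp[OF w j(1)] has_rank_urow[OF rank u JB j]]) auto
  qed
  have n_qrho_sum: "nice \<epsilon> m (\<lambda>v. \<Sum>i\<in>I. \<Sum>T\<in>G i. \<tau> u T * (wqr i T v * \<xi> H v * pf f v))"
    using \<epsilon> by (intro nice_sum n_qrho) auto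
  have qrho_sum: "(\<Sum>i\<in>I. \<Sum>T\<in>G i. \<tau> u T * (wqr i T v * \<xi> H v * pf f v)) = w v * \<xi> H v * pf f v * mt u v" for v
    unfolding mt_def mm_def wqr_def sum_distrib_left by (intro sum.cong refl) (simp add: mult_ac)
  have rho_sum: "(\<Sum>T\<in>G i. \<tau> u T * ((w v * \<rho> i T v) * \<xi> H v * pf f v)) = w v * \<xi> H v * pf f v * mm u i v" for i v
    unfolding mm_def sum_distrib_left by (intro sum.cong refl) (simp add: mult_ac)
  \<comment> \<open>Integration by parts is applied to \<open>F\<close> in place of
    \<open>w * pf f\<close>. Its derivative splits into \<open>F1\<close> from the weight,
    \<open>F2\<close> from \<open>\<xi> H\<close> and \<open>F3\<close> from the polynomials: summed
    along \<open>u\<close>, the first two gain rank, and the third loses degree.\<close>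
  define F where "F v = w v * \<xi> H v * pf f v" for v
  have [measurable]: "F \<in> borel_measurable M" unfolding F_def[abs_def] by measurable
  define F1 where "F1 s v = F v * l s v" for s v
  define F2 where "F2 s v = (if s \<in> H then E s v * \<xi> (H - {s}) v * pf f v else 0)" for s v
  define F3 where "F3 s v = w v * \<xi> H v * pf (f(s := pderiv (f s))) v" for s v
  define F' where "F' s v = F1 s v + F2 s v + F3 s v" for s v
  have F_bnd: "\<bar>F v\<bar> \<le> \<bar>pf f v\<bar>" and w\<xi>: "\<bar>w v * \<xi> H v\<bar> \<le> 1" if v: "v \<in> D" for v
  proof -
    show *: "\<bar>w v * \<xi> H v\<bar> \<le> 1"
      using wb[OF v] \<xi>_bounds[OF H v] by (simp add: abs_mult mult_le_one)
    show "\<bar>F v\<bar> \<le> \<bar>pf f v\<bar>"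
      unfolding F_def abs_mult[of _ "pf f v"] using * by (simp add: mult_left_le_one_le)
  qed
  have pdF: "pd s F (F' s)" if s: "s < d" for s
  proof -
    have "pd s (\<lambda>v. (w v * \<xi> H v) * pf f v)
      (\<lambda>v. ((w v * l s v) * \<xi> H v + w v * (if s \<in> H then exp (- v s) * \<xi> (H - {s}) v else 0)) * pf f v +
         (w v * \<xi> H v) * pf (f(s := pderiv (f s))) v)"
      by (intro pd_mult pdw[OF s] pd_\<xi>[OF H] pd_pf[OF s])
    then show ?thesis
      unfolding F_def[abs_def]
      by (rule pd_cong) (simp add: F'_def F1_def F2_def F3_def F_def E_def algebra_simps)
  qed
  have admF': "adm (F' s)" if s: "s < d" for s
  proof -
    note [measurable] = lm[OF s]
    obtain C where C: "\<And>v. \<bar>l s v\<bar> \<le> C" using lb[OF s] by blast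
    have 1: "adm (F1 s)"
    proof (rule adm_bounded)
      show "F1 s \<in> borel_measurable M" unfolding F1_def[abs_def] by measurable
      fix v assume v: "v \<in> D"
      have "\<bar>F v\<bar> * \<bar>l s v\<bar> \<le> \<bar>pf f v\<bar> * C" by (intro mult_mono F_bnd v C) auto
      then show "\<bar>F1 s v\<bar> \<le> C * \<bar>pf f v\<bar>" by (simp add: F1_def abs_mult mult.commute)
    qed
    have 2: "adm (F2 s)"
    proof (cases "s \<in> H")
      case True
      then have HB: "H - {s} \<subseteq> Bd" "s \<in> Bd" using H by auto
      note [measurable] = \<xi>_measurable[OF HB(1)] component_measurable[OF s]
      show ?thesis
      proof (rule adm_bounded)
        show "F2 s \<in> borel_measurable M" using True unfolding F2_def[abs_def] E_def[abs_def] by simp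
        fix v assume v: "v \<in> D"
        have "exp (- v s) \<le> 1" using D_Bd_nonneg[OF v HB(2)] by simp
        then have "\<bar>E s v * \<xi> (H - {s}) v\<bar> \<le> 1"
          using wb[OF v] \<xi>_bounds[OF HB(1) v] unfolding E_def abs_mult by (intro mult_le_one) auto
        then show "\<bar>F2 s v\<bar> \<le> 1 * \<bar>pf f v\<bar>"
          using True unfolding F2_def by (simp only: if_True abs_mult[of _ "pf f v"]) (rule mult_right_mono, auto)
      qed
    qed (simp add: F2_def[abs_def] adm_def)
    have 3: "adm (F3 s)"
    proof (rule adm_bounded)
      show "F3 s \<in> borel_measurable M" unfolding F3_def[abs_def] by measurable
      show "\<bar>F3 s v\<bar> \<le> 1 * \<bar>pf (f(s := pderiv (f s))) v\<bar>" if v: "v \<in> D" for v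
        using w\<xi>[OF v] unfolding F3_def abs_mult[of "w v * \<xi> H v"] by (rule mult_right_mono) simp
    qed
    show ?thesis unfolding F'_def[abs_def] by (intro adm_add 1 2 3)
  qed
  \<comment> \<open>At an x-face the pole of the coth is cancelled by the factor 1 - exp(- v s) of
    \<open>\<xi> H\<close>, which is present because \<open>u s\<close> is nonzero.\<close>
  have admdL: "adm (\<lambda>v. dL s v * F v)" if s: "s < d" and us: "u s \<noteq> 0" for s
  proof (rule adm_bounded)
    show "(\<lambda>v. dL s v * F v) \<in> borel_measurable M" using dL_measurable[OF s] by measurable
    fix v assume v: "v \<in> D"
    define B where "B = (\<Sum>i\<in>I. \<Sum>T\<in>G i. \<bar>T s\<bar>)"
    have 1: "\<bar>\<nu> s v * F v\<bar> \<le> B * \<bar>pf f v\<bar>"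
      unfolding abs_mult B_def by (intro mult_mono nu_bound F_bnd v) (auto intro!: sum_nonneg)
    have 2: "\<bar>(if s < n then e s * (cosh (v s / 2) / sinh (v s / 2)) else 0) * F v\<bar> \<le> 2 * e s * \<bar>pf f v\<bar>"
    proof (cases "s < n")
      case True
      then have sH: "s \<in> H" and vs: "0 < v s" using us v by (auto simp: H_def Bd_def length_dom_def)
      have HB: "H - {s} \<subseteq> Bd" using H by auto
      have "(1 + 2 * (exp (- v s) / (1 - exp (- v s)))) * (1 - exp (- v s)) = 1 + exp (- v s)"
        using vs by (simp add: field_simps)
      then have "cosh (v s / 2) / sinh (v s / 2) * \<xi> H v = (1 + exp (- v s)) * \<xi> (H - {s}) v"
        unfolding coth_half[OF vs] \<xi>_remove[OF H sH] by (simp only: mult.assoc[symmetric])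
      note coth\<xi> = this
      have "e s * (cosh (v s / 2) / sinh (v s / 2)) * F v =
          (cosh (v s / 2) / sinh (v s / 2) * \<xi> H v) * (e s * (w v * pf f v))"
        unfolding F_def by (simp only: mult_ac)
      also have "\<dots> = (1 + exp (- v s)) * (e s * (w v * \<xi> (H - {s}) v * pf f v))"
        unfolding coth\<xi> by (simp only: mult_ac)
      finally have eq: "e s * (cosh (v s / 2) / sinh (v s / 2)) * F v =
          (1 + exp (- v s)) * (e s * (w v * \<xi> (H - {s}) v * pf f v))" .
      have "\<bar>w v * \<xi> (H - {s}) v\<bar> \<le> 1"
        using wb[OF v] \<xi>_bounds[OF HB v] by (simp add: abs_mult mult_le_one)
      then have "\<bar>w v * \<xi> (H - {s}) v * pf f v\<bar> \<le> 1 * \<bar>pf f v\<bar>"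
        unfolding abs_mult[of _ "pf f v"] by (rule mult_right_mono) simp
      then have le: "e s * \<bar>w v * \<xi> (H - {s}) v * pf f v\<bar> \<le> e s * (1 * \<bar>pf f v\<bar>)"
        by (rule mult_left_mono) simp
      have two: "\<bar>1 + exp (- v s)\<bar> \<le> 2" using vs by simp
      have "\<bar>1 + exp (- v s)\<bar> * (e s * \<bar>w v * \<xi> (H - {s}) v * pf f v\<bar>) \<le> 2 * (e s * (1 * \<bar>pf f v\<bar>))"
        by (rule mult_mono[OF two le]) simp_all
      then show ?thesis
        unfolding if_P[OF True] eq abs_mult[of "1 + exp (- v s)"] abs_mult[of "real (e s)"] by simp
    qed simp
    have "dL s v * F v = \<nu> s v * F v - (if s < n then e s * (cosh (v s / 2) / sinh (v s / 2)) else 0) * F v"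
      by (simp add: dL_def left_diff_distrib)
    then show "\<bar>dL s v * F v\<bar> \<le> (B + 2 * e s) * \<bar>pf f v\<bar>"
      using 1 2 unfolding distrib_right by linarith
  qed
  \<comment> \<open>Coordinates with \<open>u s = 0\<close> are left out of the sums, because
    \<open>\<xi> H\<close> does not cancel the pole of \<open>dL s\<close> there.\<close>
  define R where "R = {s. s < d \<and> u s \<noteq> 0}"
  have finR: "finite R" by (simp add: R_def)
  have sumR: "(\<Sum>s\<in>R. u s * g s) = (\<Sum>s<d. u s * g s)" for g :: "nat \<Rightarrow> real"
    by (rule sum.mono_neutral_left) (auto simp: R_def)
  \<comment> \<open>\<open>W1\<close> is the derivative of \<open>F\<close> along \<open>u\<close>,
    and \<open>W2\<close> is \<open>F\<close> times the derivative of \<open>L\<close> along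
    \<open>u\<close>; integration by parts makes the density of \<open>W2\<close> a primitive of
    that of \<open>W1\<close>.\<close>
  define W1 where "W1 v = (\<Sum>s\<in>R. u s * F' s v)" for v
  define W2 where "W2 v = (\<Sum>s\<in>R. u s * (dL s v * F v))" for v
  have niceW1: "nice \<epsilon> m W1"
  proof -
    \<comment> \<open>In the first two sums only forms with nonzero defect survive. These and the
      terms of the third sum have rank \<open>Suc r\<close>; the last sum keeps the rank but
      contains a derived polynomial.\<close>
    have eq: "W1 v = (\<Sum>i\<in>Q. \<kappa> i * (\<Sum>T\<in>G i. \<tau> u T * ((w v * \<rho> i T v) * \<xi> H v * pf f v))) +
        \<kappa>0 * (\<Sum>i\<in>I. \<Sum>T\<in>G i. \<tau> u T * (wqr i T v * \<xi> H v * pf f v)) +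
        (\<Sum>s\<in>H. u s * (E s v * \<xi> (H - {s}) v * pf f v)) +
        (\<Sum>s\<in>R. u s * F3 s v)" for v
    proof -
      have "(\<Sum>s\<in>R. u s * F1 s v) = F v * (\<Sum>s<d. u s * l s v)"
        unfolding F1_def sumR sum_distrib_left by (intro sum.cong refl) (simp add: mult_ac)
      also have "\<dots> = (\<Sum>i\<in>I. \<kappa> i * (F v * mm u i v)) + \<kappa>0 * (F v * mt u v)"
        unfolding \<kappa>(2) distrib_left sum_distrib_left by (simp add: mult_ac)
      also have "(\<Sum>i\<in>I. \<kappa> i * (F v * mm u i v)) = (\<Sum>i\<in>Q. \<kappa> i * (F v * mm u i v))"
        using QI \<kappa>(1) fin_I by (intro sum.mono_neutral_right) auto
      finally have 1: "(\<Sum>s\<in>R. u s * F1 s v) = (\<Sum>i\<in>Q. \<kappa> i * (F v * mm u i v)) + \<kappa>0 * (F v * mt u v)" .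
      have "(\<Sum>s\<in>R. u s * F2 s v) = (\<Sum>s\<in>H. u s * F2 s v)"
        by (rule sum.mono_neutral_right) (use finR Bd_less in \<open>auto simp: R_def H_def F2_def\<close>)
      also have "\<dots> = (\<Sum>s\<in>H. u s * (E s v * \<xi> (H - {s}) v * pf f v))"
        by (intro sum.cong refl) (simp add: F2_def)
      finally have 2: "(\<Sum>s\<in>R. u s * F2 s v) = (\<Sum>s\<in>H. u s * (E s v * \<xi> (H - {s}) v * pf f v))" .
      show ?thesis
        unfolding W1_def F'_def distrib_left sum.distrib 1 2 rho_sum qrho_sum F_def[symmetric] by simp
    qed
    have n3: "nice \<epsilon> m (F3 s)" if "s < d" for s
      unfolding F3_def[abs_def]
    proof (rule nice_\<xi>[OF _ H])
      fix S assume S: "S \<subseteq> H"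
      then have SB: "S \<subseteq> Bd" using H by blast
      have "wt A (J \<union> S) Q (\<lambda>v. w v * ex S v)"
        by (rule wt_ex[OF w finite_subset[OF SB Bd_finite] SB])
      moreover have "has_rank A (J \<union> S) r" by (rule has_rank_mono[OF rank]) auto
      ultimately show "nice \<epsilon> m (\<lambda>v. w v * ex S v * pf (f(s := pderiv (f s))) v)"
        by (rule IH2[OF that])
    qed (use \<epsilon> in simp)
    have "nice \<epsilon> m (\<lambda>v. (\<Sum>i\<in>Q. \<kappa> i * (\<Sum>T\<in>G i. \<tau> u T * ((w v * \<rho> i T v) * \<xi> H v * pf f v))) +
        \<kappa>0 * (\<Sum>i\<in>I. \<Sum>T\<in>G i. \<tau> u T * (wqr i T v * \<xi> H v * pf f v)) +
        (\<Sum>s\<in>H. u s * (E s v * \<xi> (H - {s}) v * pf f v)) +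
        (\<Sum>s\<in>R. u s * F3 s v))"
      using \<epsilon> by (intro nice_add nice_sum nice_cmult n_rho n_qrho n_E n3) (auto simp: R_def)
    then show ?thesis by (simp only: eq[symmetric])
  qed
  have admW2: "adm W2"
    unfolding W2_def[abs_def] by (intro adm_sum adm_cmult admdL) (auto simp: R_def)
  have "nice \<epsilon> (Suc m) W2"
  proof (rule nice_integrate[OF \<epsilon> niceW1 admW2])
    fix b :: real assume b: "0 \<le> b"
    have bp: "V (\<lambda>v. dL s v * F v) b = (\<integral>v. indicat_real D v * (max 0 (b - L v) * F' s v) \<partial>M)" if "s \<in> R" for s
    proof (rule by_parts[OF _ pdF _ admF' admdL b])
      show "F v = 0" if v: "v \<in> D" "2 * n \<le> s" "v s = 0" for v
      proof -
        have "s \<in> H" using \<open>s \<in> R\<close> v(2) by (auto simp: R_def H_def Bd_def)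
        then have "\<xi> H v = 0" using \<xi>_remove[OF H, of s v] v(3) by simp
        then show ?thesis by (simp add: F_def)
      qed
    qed (use that in \<open>auto simp: R_def\<close>)
    have int: "integrable M (\<lambda>v. indicat_real D v * (max 0 (b - L v) * F' s v))" if "s \<in> R" for s
      by (rule integrable_pos_part[of "F' s" "\<lambda>t. max 0 (b - t)" b b])
         (use admF' that b in \<open>auto simp: R_def\<close>)
    have "V W2 b = (\<Sum>s\<in>R. u s * V (\<lambda>v. dL s v * F v) b)"
      unfolding W2_def[abs_def]
      by (subst V_sum[OF finR]) (auto intro!: adm_cmult admdL sum.cong V_cmult simp: R_def)
    also have "\<dots> = (\<Sum>s\<in>R. \<integral>v. u s * (indicat_real D v * (max 0 (b - L v) * F' s v)) \<partial>M)"
      using bp by (intro sum.cong refl) simp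
    also have "\<dots> = (\<integral>v. (\<Sum>s\<in>R. u s * (indicat_real D v * (max 0 (b - L v) * F' s v))) \<partial>M)"
      by (intro Bochner_Integration.integral_sum[symmetric] integrable_mult_right int)
    also have "\<dots> = (\<integral>v. indicat_real D v * (max 0 (b - L v) * W1 v) \<partial>M)"
      unfolding W1_def sum_distrib_left by (intro Bochner_Integration.integral_cong sum.cong refl) (simp add: mult_ac)
    finally show "V W2 b = (\<integral>v. indicat_real D v * (max 0 (b - L v) * W1 v) \<partial>M)" .
  qed
  moreover have "nice \<epsilon> (Suc m) (\<lambda>v. (- 1) * (\<Sum>i\<in>I. \<Sum>T\<in>G i. \<tau> u T * (wqr i T v * \<xi> H v * pf f v)))"
    by (intro nice_cmult nice_mono[OF n_qrho_sum]) simp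
  moreover have "nice \<epsilon> (Suc m) (\<lambda>v. \<Sum>j\<in>H \<inter> {..<n}. (2 * u j * e j) * (E j v * \<xi> (H - {j}) v * pf f v))"
    using \<epsilon> by (intro nice_sum nice_cmult nice_mono[OF n_E]) auto
  moreover have "nice \<epsilon> (Suc m) (\<lambda>v. w v * (1 - \<xi> H v) * pf f v)"
  proof (rule nice_one_minus_\<xi>[OF _ H])
    fix S assume S: "S \<subseteq> H" "S \<noteq> {}"
    then obtain j where j: "j \<in> S" by blast
    have SB: "S \<subseteq> Bd" using S H by blast
    have j': "j \<in> Bd" "u j \<noteq> 0" using S j by (auto simp: H_def)
    have "wt A (J \<union> S) Q (\<lambda>v. w v * ex S v)"
      by (rule wt_ex[OF w finite_subset[OF SB Bd_finite] SB])
    moreover have "has_rank A (J \<union> S) (Suc r)"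
      by (rule has_rank_urow[OF rank u JB j']) (use j in auto)
    ultimately have "nice \<epsilon> m (\<lambda>v. w v * ex S v * pf f v)" by (rule IH1)
    then show "nice \<epsilon> (Suc m) (\<lambda>v. w v * ex S v * pf f v)" by (rule nice_mono) simp
  qed (use \<epsilon> in simp)
  \<comment> \<open>The formula for the derivative of \<open>L\<close> along \<open>u\<close> is
    solved for \<open>w * pf f\<close>: it is \<open>W2\<close> plus corrections, all of larger rank
    than \<open>w\<close>.\<close>
  ultimately have "nice \<epsilon> (Suc m) (\<lambda>v. ((W2 v + (- 1) * (\<Sum>i\<in>I. \<Sum>T\<in>G i. \<tau> u T * (wqr i T v * \<xi> H v * pf f v))) +
      (\<Sum>j\<in>H \<inter> {..<n}. (2 * u j * e j) * (E j v * \<xi> (H - {j}) v * pf f v))) + w v * (1 - \<xi> H v) * pf f v)"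
    using \<epsilon> by (intro nice_add) auto
  then show ?thesis
  proof (rule nice_cong)
    fix v assume v: "v \<in> D"
    have "W2 v = F v * (\<Sum>s<d. u s * dL s v)"
      unfolding W2_def sumR sum_distrib_left by (intro sum.cong refl) (simp add: mult_ac)
    also have "\<dots> = F v + F v * mt u v - (\<Sum>s<n. F v * (u s * e s * (2 * (exp (- v s) / (1 - exp (- v s))))))"
      unfolding sum_u_dL[OF v] by (simp add: algebra_simps sum_distrib_left)
    also have "(\<Sum>s<n. F v * (u s * e s * (2 * (exp (- v s) / (1 - exp (- v s)))))) =
        (\<Sum>s\<in>H \<inter> {..<n}. F v * (u s * e s * (2 * (exp (- v s) / (1 - exp (- v s))))))"
      by (rule sum.mono_neutral_right) (auto simp: H_def Bd_def)
    also have "\<dots> = (\<Sum>j\<in>H \<inter> {..<n}. (2 * u j * e j) * (E j v * \<xi> (H - {j}) v * pf f v))"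
    proof (intro sum.cong refl)
      fix j assume j: "j \<in> H \<inter> {..<n}"
      then have "0 < v j" using v by (auto simp: length_dom_def)
      then have ne: "1 - exp (- v j) \<noteq> 0" by simp
      have "\<xi> H v * (exp (- v j) / (1 - exp (- v j))) = exp (- v j) * \<xi> (H - {j}) v"
        using \<xi>_remove[OF H, of j v] j ne by simp
      moreover have "F v * (u j * e j * (2 * (exp (- v j) / (1 - exp (- v j))))) =
          (2 * u j * e j) * (w v * (\<xi> H v * (exp (- v j) / (1 - exp (- v j)))) * pf f v)"
        unfolding F_def by (simp only: mult_ac)
      ultimately show "F v * (u j * e j * (2 * (exp (- v j) / (1 - exp (- v j))))) =
          (2 * u j * e j) * (E j v * \<xi> (H - {j}) v * pf f v)"
        unfolding E_def by (simp only: mult_ac)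
    qed
    finally have W2: "W2 v = F v + F v * mt u v - (\<Sum>j\<in>H \<inter> {..<n}. (2 * u j * e j) * (E j v * \<xi> (H - {j}) v * pf f v))" .
    have "w v * (1 - \<xi> H v) * pf f v = w v * pf f v - F v" by (simp add: F_def algebra_simps)
    then show "((W2 v + (- 1) * (\<Sum>i\<in>I. \<Sum>T\<in>G i. \<tau> u T * (wqr i T v * \<xi> H v * pf f v))) +
      (\<Sum>j\<in>H \<inter> {..<n}. (2 * u j * e j) * (E j v * \<xi> (H - {j}) v * pf f v))) + w v * (1 - \<xi> H v) * pf f v = w v * pf f v"
      unfolding qrho_sum F_def[symmetric] W2 by simp
  qed measurable
qed

lemma has_rank_le: "has_rank A J r \<Longrightarrow> r' \<le> r \<Longrightarrow> has_rank A J r'"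
  unfolding has_rank_def by (meson order_trans)

lemma pf_zero:
  assumes "s < d" "f s = 0" shows "pf f v = 0"
  unfolding pf_def using assms by (intro prod_zero bexI[of _ s]) auto

text \<open>Double induction on the corank \<open>j\<close> and, for fixed corank, on the total
  degree. Each use of \<open>nice_step\<close> adds one to the degree bound and leads to weights of
  smaller corank or polynomials of lower total degree. At corank 0 the constraints are
  inconsistent.\<close>

lemma nice_weight:
  assumes "good \<epsilon>"
  shows "wt A J Q w \<Longrightarrow> has_rank A J (Suc d - j) \<Longrightarrow> (\<Sum>i<d. degree (f i)) \<le> K \<Longrightarrow>
    nice \<epsilon> (j + K) (\<lambda>v. w v * pf f v)"
proof (induction j arbitrary: A J Q w f K)
  case 0
  then have "urow d \<in> fspan (crows A J)" using wt_sets[OF 0(1)] by (intro full_rank) auto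
  then show ?case by (rule nice_inconsistent[OF assms 0(1)])
next
  case (Suc j)
  note IHj = Suc.IH
  have "wt A J Q w \<Longrightarrow> has_rank A J (Suc d - Suc j) \<Longrightarrow> (\<Sum>i<d. degree (f i)) \<le> K \<Longrightarrow>
    nice \<epsilon> (Suc (j + K)) (\<lambda>v. w v * pf f v)" for A J Q w f K
  proof (induction K arbitrary: A J Q w f)
    case (0 A J Q w f)
    show ?case
    proof (cases "urow d \<in> fspan (crows A J)")
      case True
      then show ?thesis by (rule nice_inconsistent[OF assms 0(1)])
    next
      case False
      have "J \<subseteq> Bd" using wt_sets[OF 0(1)] by simp
      then obtain u where u: "Sol u A J" using False rows_dichotomy by blast
      show ?thesis
      proof (rule nice_step[OF _ 0(1,2) u])
        show "0 < \<epsilon>" using assms by (simp add: good_def)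
        show "nice \<epsilon> (j + 0) (\<lambda>v. w' v * pf f v)" if "wt A' J' Q' w'" "has_rank A' J' (Suc (Suc d - Suc j))" for A' J' Q' w'
          by (rule IHj[OF that(1) has_rank_le[OF that(2)] 0(3)]) simp
        show "nice \<epsilon> (j + 0) (\<lambda>v. w' v * pf (f(s := pderiv (f s))) v)" if "s < d" for s w'
        proof -
          have "degree (f s) = 0" using 0(3) that by simp
          then have "pderiv (f s) = 0" by (simp add: pderiv_eq_0_iff)
          then have "pf (f(s := pderiv (f s))) v = 0" for v using that by (intro pf_zero[OF that]) simp
          then show ?thesis by (simp add: nice_0)
        qed
      qed
    qed
  next
    case (Suc K A J Q w f)
    show ?case
    proof (cases "urow d \<in> fspan (crows A J)")
      case True
      then show ?thesis by (rule nice_inconsistent[OF assms Suc.prems(1)])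
    next
      case False
      have "J \<subseteq> Bd" using wt_sets[OF Suc.prems(1)] by simp
      then obtain u where u: "Sol u A J" using False rows_dichotomy by blast
      show ?thesis
      proof (rule nice_step[OF _ Suc.prems(1,2) u])
        show "0 < \<epsilon>" using assms by (simp add: good_def)
        show "nice \<epsilon> (j + Suc K) (\<lambda>v. w' v * pf f v)" if "wt A' J' Q' w'" "has_rank A' J' (Suc (Suc d - Suc j))" for A' J' Q' w'
          by (rule IHj[OF that(1) has_rank_le[OF that(2)] Suc.prems(3)]) simp
        show "nice \<epsilon> (j + Suc K) (\<lambda>v. w' v * pf (f(s := pderiv (f s))) v)"
          if s: "s < d" and w': "wt A J' Q w'" "has_rank A J' (Suc d - Suc j)" for s J' w'
        proof (cases "degree (f s) = 0")
          case True
          then have "pderiv (f s) = 0" by (simp add: pderiv_eq_0_iff)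
          then have "pf (f(s := pderiv (f s))) v = 0" for v by (intro pf_zero[OF s]) simp
          then show ?thesis by (simp add: nice_0)
        next
          case False
          have "(\<Sum>i<d. degree ((f(s := pderiv (f s))) i)) = degree (pderiv (f s)) + (\<Sum>i\<in>{..<d} - {s}. degree (f i))"
            using s by (subst sum.remove[of _ s]) auto
          moreover have "(\<Sum>i<d. degree (f i)) = degree (f s) + (\<Sum>i\<in>{..<d} - {s}. degree (f i))"
            using s by (intro sum.remove) auto
          ultimately have "(\<Sum>i<d. degree ((f(s := pderiv (f s))) i)) \<le> K"
            using Suc.prems(3) False by (simp add: degree_pderiv)
          from Suc.IH[OF w' this] show ?thesis unfolding add_Suc_right .
        qed
      qed
    qed
  qed
  from this[OF Suc.prems] show ?case by simp
qed

text \<open>The weights \<open>q i * \<rho> i T\<close> form a partition of unity. Each has rank at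
  least 1, hence corank at most \<open>d\<close>, which fixes the number of primitives.\<close>

theorem nice_pf:
  assumes "good \<epsilon>" "(\<Sum>i<d. degree (f i)) \<le> K"
  shows "nice \<epsilon> (d + K) (pf f)"
proof -
  have "nice \<epsilon> (d + K) (\<lambda>v. 1 * q i v * \<rho> i T v * pf f v)" if iT: "i \<in> I" "T \<in> G i" for i T
  proof (rule nice_weight[OF assms(1) _ _ assms(2)])
    show "wt (insert T {}) {} (insert i {}) (\<lambda>v. 1 * q i v * \<rho> i T v)"
      by (intro wt_rho wt_q wt_one iT) simp
    show "has_rank (insert T {}) {} (Suc d - d)" using has_rank_single by simp
  qed
  then have "nice \<epsilon> (d + K) (\<lambda>v. \<Sum>i\<in>I. \<Sum>T\<in>G i. 1 * q i v * \<rho> i T v * pf f v)"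
    using assms(1) by (intro nice_sum) (auto simp: good_def)
  moreover have "(\<lambda>v. \<Sum>i\<in>I. \<Sum>T\<in>G i. 1 * q i v * \<rho> i T v * pf f v) = pf f"
  proof
    fix v
    have "(\<Sum>i\<in>I. \<Sum>T\<in>G i. 1 * q i v * \<rho> i T v * pf f v) = (\<Sum>i\<in>I. q i v * (\<Sum>T\<in>G i. \<rho> i T v)) * pf f v"
      by (simp add: sum_distrib_left sum_distrib_right mult_ac)
    also have "\<dots> = pf f v" using sum_q[of v] by (simp add: sum_\<rho>)
    finally show "(\<Sum>i\<in>I. \<Sum>T\<in>G i. 1 * q i v * \<rho> i T v * pf f v) = pf f v" .
  qed
  ultimately show ?thesis by (simp only:)
qed

end

section \<open>From the logarithmic length to the length\<close>

text \<open>\<open>lam\<close> is 2 * ln (2 * cosh (t / 2)), written so that its distance from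
  \<open>t\<close> is visible; \<open>dlam\<close> is its derivative tanh (t / 2).\<close>

definition lam :: "real \<Rightarrow> real" where "lam t = t + 2 * ln (1 + exp (- t))"
definition dlam :: "real \<Rightarrow> real" where "dlam t = 1 - 2 * exp (- t) / (1 + exp (- t))"

lemma one_plus_exp_pos: "0 < 1 + exp (x :: real)"
  by (rule add_pos_pos) simp_all

lemma lam_cosh: "lam t = 2 * ln (2 * cosh (t / 2))"
proof -
  have "exp (t / 2) * exp (- t) = exp (- (t / 2))" by (simp flip: exp_add)
  then have "2 * cosh (t / 2) = exp (t / 2) * (1 + exp (- t))"
    by (simp add: cosh_field_def distrib_left)
  then show ?thesis using one_plus_exp_pos[of "- t"] by (simp add: lam_def ln_mult)
qed

lemma DERIV_lam: "(lam has_real_derivative dlam t) (at t)"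
  unfolding lam_def[abs_def] dlam_def using one_plus_exp_pos[of "- t"]
  by (auto intro!: derivative_eq_intros simp: field_simps)

lemma continuous_dlam: "continuous_on A dlam"
  unfolding dlam_def[abs_def] by (intro continuous_intros) (metis one_plus_exp_pos less_irrefl)

lemma dlam_bounds: "0 \<le> t \<Longrightarrow> 0 \<le> dlam t" "dlam t \<le> 1" "1 - dlam t \<le> 2 * exp (- t)"
proof -
  have p: "0 < 1 + exp (- t)" by (rule one_plus_exp_pos)
  show "dlam t \<le> 1" unfolding dlam_def using p by simp
  have "2 * exp (- t) / (1 + exp (- t)) \<le> 2 * exp (- t) / 1"
    using p by (intro divide_left_mono) auto
  then show "1 - dlam t \<le> 2 * exp (- t)" unfolding dlam_def by simp
  assume "0 \<le> t"
  then have "2 * exp (- t) / (1 + exp (- t)) \<le> 1" using p by (simp add: divide_le_eq_1)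
  then show "0 \<le> dlam t" unfolding dlam_def by simp
qed

lemma lam_ge: "t \<le> lam t" and lam_le: "lam t \<le> t + 2 * exp (- t)"
  unfolding lam_def using ln_add_one_self_le_self[of "exp (- t)"] by (simp_all add: add.commute)

lemma lam_less_iff:
  assumes "0 \<le> s" "0 \<le> t" shows "lam s < lam t \<longleftrightarrow> s < t"
proof -
  have less: "lam x < lam y" if "0 \<le> x" "x < y" for x y
  proof -
    have "cosh (x / 2) < cosh (y / 2)"
      using that by (intro cosh_real_strict_mono) auto
    then have "ln (2 * cosh (x / 2)) < ln (2 * cosh (y / 2))"
      by (subst ln_less_cancel_iff) (auto intro: cosh_real_pos)
    then show ?thesis by (simp add: lam_cosh)
  qed
  show ?thesis using less[of s t] less[of t s] assms by (cases s t rule: linorder_cases) auto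
qed

lemma lam_le_iff: "0 \<le> s \<Longrightarrow> 0 \<le> t \<Longrightarrow> lam s \<le> lam t \<longleftrightarrow> s \<le> t"
  using lam_less_iff[of t s] by (auto simp: not_less[symmetric])

context length_form
begin

text \<open>Moving a point of \<open>D\<close> far out along its ray and then by \<open>1\<close> in the \<open>x\<close>-coordinates stays away
  from the singular faces, so that a bounded sublevel set of \<open>L\<close> forces linear growth of \<open>Nmax\<close>.\<close>

lemma growth_of_bounded_sublevels:
  assumes bdd: "\<And>R. \<exists>B. \<forall>v\<in>D. L v \<le> R \<longrightarrow> (\<forall>j<d. \<bar>v j\<bar> \<le> B)"
  shows "\<exists>c>0. \<forall>v\<in>D. c * (\<Sum>j<d. \<bar>v j\<bar>) \<le> Nmax v"
proof -
  obtain C where C: "\<And>v. v \<in> D \<Longrightarrow> L v \<le> Nmax v + C - (\<Sum>j<n. 2 * e j * ln (1 - exp (- v j)))"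
    by (rule L_upper) blast
  \<comment> \<open>If all x-coordinates are at least 1, the logarithmic terms of
    \<open>L_upper\<close> are bounded by this constant.\<close>
  define C' where "C' = C - (\<Sum>j<n. 2 * e j * ln (1 - exp (- 1)))"
  have up: "L v \<le> Nmax v + C'" if v: "v \<in> D" and v1: "\<And>j. j < n \<Longrightarrow> 1 \<le> v j" for v
  proof -
    have "(\<Sum>j<n. 2 * e j * ln (1 - exp (- 1))) \<le> (\<Sum>j<n. 2 * e j * ln (1 - exp (- v j)))"
    proof (intro sum_mono mult_left_mono)
      fix j assume "j \<in> {..<n}"
      then have "exp (- v j) \<le> exp (- 1)" using v1[of j] by simp
      moreover have "exp (- 1 :: real) < 1" by simp
      ultimately show "ln (1 - exp (- 1)) \<le> ln (1 - exp (- v j))" by (subst ln_le_cancel_iff) auto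
    qed auto
    then show ?thesis using C[OF v] unfolding C'_def by linarith
  qed
  define o1 where "o1 = (\<lambda>j::nat. if j < n then 1 else 0 :: real)"
  define K1 where "K1 = (\<Sum>(i, T)\<in>FS. \<bar>NF T o1\<bar>)"
  obtain B0 where B0: "\<And>v j. v \<in> D \<Longrightarrow> L v \<le> 1 + K1 + C' \<Longrightarrow> j < d \<Longrightarrow> \<bar>v j\<bar> \<le> B0"
    using bdd[of "1 + K1 + C'"] by blast
  define B where "B = max 0 B0"
  \<comment> \<open>One more than d * B + n, which bounds the sum of the absolute values of the
    scaled coordinates once the shifted point has all coordinates bounded by
    \<open>B\<close>.\<close>
  define \<beta> where "\<beta> = d * B + n + 1"
  have \<beta>: "0 < \<beta>" unfolding \<beta>_def B_def by (intro add_nonneg_pos add_nonneg_nonneg mult_nonneg_nonneg) auto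
  have "1 / \<beta> * (\<Sum>j<d. \<bar>v j\<bar>) \<le> Nmax v" if v: "v \<in> D" for v
  proof (rule ccontr)
    assume neg: "\<not> ?thesis"
    define s where "s = (\<Sum>j<d. \<bar>v j\<bar>)"
    have "s \<noteq> 0"
    proof
      assume "s = 0"
      then have z: "v j = 0" if "j < d" for j
        using that unfolding s_def by (subst (asm) sum_nonneg_eq_0_iff) auto
      obtain i T where "Nmax v = NF T v" by (rule Nmax_attained)
      also have "NF T v = 0" unfolding NF_def lin_form_def by (intro sum.neutral) (simp add: z)
      finally show False using neg \<open>s = 0\<close> by (simp add: s_def)
    qed
    moreover have "0 \<le> s" unfolding s_def by (rule sum_nonneg) simp
    ultimately have s: "0 < s" by simp
    \<comment> \<open>\<open>Nmax\<close> is homogeneous, so scaling \<open>v\<close> to norm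
      \<open>\<beta>\<close> keeps it at most 1 under the negated claim.\<close>
    define t where "t = \<beta> / s"
    have t: "0 < t" "t * s = \<beta>" using s \<beta> by (simp_all add: t_def)
    have tN: "t * Nmax v \<le> 1"
    proof -
      have "Nmax v \<le> s / \<beta>" using neg by (simp add: s_def)
      then have "t * Nmax v \<le> t * (s / \<beta>)" using t(1) by (intro mult_left_mono) auto
      also have "\<dots> = 1" using s \<beta> by (simp add: t_def)
      finally show ?thesis .
    qed
    define z where "z = restrict (\<lambda>j. t * v j + o1 j) {..<d}"
    have zj: "z j = t * v j + o1 j" if "j < d" for j using that by (simp add: z_def)
    have zD: "z \<in> D"
    proof -
      have "0 < z j" if "j < n" for j
        using that v t(1) zj[of j] by (auto simp: length_dom_def o1_def intro!: add_pos_pos)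
      moreover have "0 \<le> z j" if "2 * n \<le> j" "j < d" for j
        using that v t(1) zj[of j] by (auto simp: length_dom_def o1_def)
      moreover have "z \<in> {..<d} \<rightarrow>\<^sub>E UNIV" by (simp add: z_def)
      ultimately show ?thesis unfolding length_dom_def by auto
    qed
    obtain i T where iT: "i \<in> I" "T \<in> G i" and Nz: "Nmax z = NF T z" by (rule Nmax_attained)
    have "NF T z = t * NF T v + NF T o1"
      unfolding NF_def lin_form_def sum_distrib_left sum.distrib[symmetric]
      by (intro sum.cong refl) (simp add: zj algebra_simps)
    moreover have "NF T o1 \<le> K1"
    proof -
      have "(i, T) \<in> FS" using iT by (simp add: FS_def)
      then have "\<bar>NF T o1\<bar> \<le> K1"
        unfolding K1_def using member_le_sum[of "(i, T)" FS "\<lambda>(i, T). \<bar>NF T o1\<bar>"] FS_finite by auto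
      then show ?thesis by simp
    qed
    moreover have "t * NF T v \<le> t * Nmax v" using NF_le_Nmax[OF iT] t(1) by (intro mult_left_mono) auto
    ultimately have Nz1: "Nmax z \<le> 1 + K1" using Nz tN by linarith
    have "L z \<le> Nmax z + C'"
    proof (rule up[OF zD])
      fix j assume "j < n"
      then have "0 < v j" using v by (auto simp: length_dom_def)
      then have "0 < t * v j" using t(1) by simp
      then show "1 \<le> z j" using zj[of j] \<open>j < n\<close> by (simp add: o1_def)
    qed
    then have "L z \<le> 1 + K1 + C'" using Nz1 by simp
    then have zB: "\<bar>z j\<bar> \<le> B" if "j < d" for j using B0[OF zD _ that] by (simp add: B_def)
    have "\<beta> = (\<Sum>j<d. \<bar>t * v j\<bar>)" using t by (simp add: s_def abs_mult sum_distrib_left)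
    also have "\<dots> \<le> (\<Sum>j<d. \<bar>z j\<bar> + o1 j)" by (intro sum_mono) (auto simp: zj o1_def)
    also have "\<dots> \<le> (\<Sum>j<d. B + o1 j)" using zB by (intro sum_mono) auto
    also have "\<dots> = d * B + (\<Sum>j<d. o1 j)" by (simp add: sum.distrib)
    also have "(\<Sum>j<d. o1 j) = (\<Sum>j<n. 1)"
      by (rule sum.mono_neutral_cong_right) (auto simp: o1_def)
    finally show False by (simp add: \<beta>_def)
  qed
  then show ?thesis using \<beta> by (intro exI[of _ "1 / \<beta>"]) auto
qed

end

locale length_fun = proper_form +
  fixes h :: "(nat \<Rightarrow> real) \<Rightarrow> real"
  assumes h_nonneg: "\<And>v. v \<in> D \<Longrightarrow> 0 \<le> h v"
    and L_eq: "\<And>v. v \<in> D \<Longrightarrow> L v = lam (h v)"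
begin

lemma sub_lam: "0 \<le> b \<Longrightarrow> sub (lam b) = {v \<in> D. h v \<le> b}"
  using h_nonneg by (auto simp: sub_def L_eq lam_le_iff)

text \<open>Both \<open>lam t - t\<close> and \<open>1 - dlam t\<close> are at most 2 * exp(- t).
  This cancels the weight exp t and leaves polynomial growth; the rate 1/4 is chosen to lie below
  \<open>1 - \<epsilon>\<close>.\<close>

lemma weighted_error_bound:
  fixes P :: "real poly"
  obtains A where "0 \<le> A" "\<And>t. 0 \<le> t \<Longrightarrow> exp t * \<bar>poly P (lam t) * dlam t - poly P t\<bar> \<le> A * exp (t / 4)"
proof -
  obtain C0 where C0: "\<And>x. \<bar>poly P x\<bar> \<le> C0 * exp (1 / 4 * \<bar>x\<bar>)" using poly_le_exp[of "1 / 4" P] by auto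
  obtain C1 where C1: "\<And>x. \<bar>poly (pderiv P) x\<bar> \<le> C1 * exp (1 / 4 * \<bar>x\<bar>)" using poly_le_exp[of "1 / 4" "pderiv P"] by auto
  have C: "0 \<le> C0" "0 \<le> C1" using C0[of 0] C1[of 0] by simp_all
  show ?thesis
  proof (rule that[of "2 * (C0 + C1) * exp (1 / 2)"])
    show "0 \<le> 2 * (C0 + C1) * exp (1 / 2)" using C by simp
    fix t :: real assume t: "0 \<le> t"
    define E where "E = exp (1 / 2) * exp (t / 4)"
    have "exp (- t) \<le> 1" using t by simp
    then have l: "t \<le> lam t" "lam t \<le> t + 2" using lam_ge[of t] lam_le[of t] by linarith+
    have E: "exp (1 / 4 * \<bar>x\<bar>) \<le> E" if "0 \<le> x" "x \<le> t + 2" for x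
      using that by (simp add: E_def flip: exp_add)
    have 0: "\<bar>poly P (lam t)\<bar> \<le> C0 * E"
      using C0[of "lam t"] mult_left_mono[OF E[of "lam t"] C(1)] l t by linarith
    have 1: "\<bar>poly P (lam t) - poly P t\<bar> \<le> 2 * exp (- t) * (C1 * E)"
    proof (cases "t = lam t")
      case True
      then show ?thesis using C by (simp add: E_def)
    next
      case False
      then have "t < lam t" using l by simp
      from poly_MVT[OF this, of P] obtain x where x: "t < x" "x < lam t"
        "poly P (lam t) - poly P t = (lam t - t) * poly (pderiv P) x" by blast
      have "\<bar>poly (pderiv P) x\<bar> \<le> C1 * E"
        using C1[of x] mult_left_mono[OF E[of x] C(2)] l t x by linarith
      moreover have "\<bar>lam t - t\<bar> \<le> 2 * exp (- t)" using l lam_le[of t] by linarith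
      ultimately show ?thesis unfolding x(3) abs_mult by (intro mult_mono) auto
    qed
    have 2: "\<bar>poly P (lam t) * (1 - dlam t)\<bar> \<le> (C0 * E) * (2 * exp (- t))"
      unfolding abs_mult using 0 dlam_bounds[of t] t by (intro mult_mono) auto
    have "poly P (lam t) * dlam t - poly P t = (poly P (lam t) - poly P t) - poly P (lam t) * (1 - dlam t)"
      by (simp add: algebra_simps)
    then have "\<bar>poly P (lam t) * dlam t - poly P t\<bar> \<le> 2 * exp (- t) * (C1 * E) + (C0 * E) * (2 * exp (- t))"
      using 1 2 by linarith
    then have "exp t * \<bar>poly P (lam t) * dlam t - poly P t\<bar> \<le> exp t * (2 * exp (- t) * (C1 * E) + (C0 * E) * (2 * exp (- t)))"
      by (rule mult_left_mono) simp
    also have "\<dots> = 2 * (C0 + C1) * E * (exp t * exp (- t))" by (simp add: algebra_simps)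
    also have "exp t * exp (- t) = 1" by (simp flip: exp_add)
    finally show "exp t * \<bar>poly P (lam t) * dlam t - poly P t\<bar> \<le> 2 * (C0 + C1) * exp (1 / 2) * exp (t / 4)"
      by (simp add: E_def mult_ac)
  qed
qed

text \<open>The substitution l = lam t turns the density with respect to \<open>L\<close> into one
  with respect to \<open>h\<close>. Replacing \<open>poly P (lam t) * dlam t\<close> by
  \<open>poly P t\<close> costs a term covered by \<open>weighted_error_bound\<close>, and for t
  \<le> m the remainder is estimated by exp t \<le> exp ((1 - \<epsilon>) * m) * exp (\<epsilon> *
  lam t).\<close>

lemma real_density:
  assumes \<epsilon>: "good \<epsilon>" "\<epsilon> \<le> 1 / 2" and deg: "(\<Sum>i<d. degree (f i)) \<le> K"
  obtains P g where "P = 0 \<or> degree P < d + K" "g \<in> borel_measurable borel" "\<And>t. t < 0 \<Longrightarrow> g t = 0"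
    "\<And>b. 0 \<le> b \<Longrightarrow> integrable lborel (\<lambda>t. indicat_real {0..b} t * g t)"
    "\<And>b. 0 \<le> b \<Longrightarrow> integrable M (\<lambda>v. indicat_real {v \<in> D. h v \<le> b} v * pf f v)"
    "\<And>b. 0 \<le> b \<Longrightarrow> (\<integral>v. indicat_real {v \<in> D. h v \<le> b} v * pf f v \<partial>M) = (\<integral>t. indicat_real {0..b} t * g t \<partial>lborel)"
    "\<exists>C\<ge>0. \<forall>m\<ge>1. (\<integral>t. indicat_real {0..m} t * (exp t * \<bar>g t - poly P t\<bar>) \<partial>lborel) \<le> C * (1 + m) * exp ((1 - \<epsilon>) * m)"
proof -
  have \<epsilon>0: "0 < \<epsilon>" using \<epsilon>(1) by (simp add: good_def)
  obtain P r where adm: "adm (pf f)" and P: "P = 0 \<or> degree P < d + K" and r [measurable]: "r \<in> borel_measurable borel"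
    and ir: "integrable lborel (\<lambda>l. indicat_real {0..} l * (exp (\<epsilon> * l) * r l))"
    and V: "\<And>b. b\<ge>0 \<Longrightarrow> V (pf f) b = (\<integral>l. indicat_real {0..b} l * (poly P l + r l) \<partial>lborel)"
    using nice_pf[OF \<epsilon>(1) deg] by (auto simp: nice_def)
  define F where "F l = poly P l + r l" for l
  have [measurable]: "F \<in> borel_measurable borel" unfolding F_def[abs_def] by measurable
  have [measurable]: "lam \<in> borel_measurable borel" "dlam \<in> borel_measurable borel"
    unfolding lam_def[abs_def] dlam_def[abs_def] by measurable
  define g where "g t = (if t < 0 then 0 else F (lam t) * dlam t)" for t
  have gm [measurable]: "g \<in> borel_measurable borel" unfolding g_def[abs_def] by measurable
  have lam0: "0 \<le> lam 0" by (rule lam_ge)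
  have lam_nonneg: "0 \<le> lam b" if "0 \<le> b" for b using lam_ge[of b] that by linarith
  have iF: "integrable lborel (\<lambda>l. indicat_real {a..b} l * F l)" if "0 \<le> a" for a b
    unfolding F_def distrib_left
    by (intro Bochner_Integration.integrable_add integrable_poly_Icc integrable_weight_Icc[OF _ r ir])
       (use \<epsilon>0 that in auto)
  have subst: "integrable lborel (\<lambda>x. indicat_real {0..b} x * (G (lam x) * dlam x))"
    "(\<integral>x. indicat_real {lam 0..lam b} x * G x \<partial>lborel) = (\<integral>x. indicat_real {0..b} x * (G (lam x) * dlam x) \<partial>lborel)"
    if b: "0 \<le> b" and G: "integrable lborel (\<lambda>l. indicat_real {lam 0..lam b} l * G l)" for b and G :: "real \<Rightarrow> real"
  proof -
    have G': "set_integrable lborel {lam 0..lam b} G" using G by (simp add: set_integrable_def)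
    note s = integral_substitution[OF G' DERIV_lam continuous_dlam _ b]
    have nn: "\<And>x. x \<in> {0..b} \<Longrightarrow> 0 \<le> dlam x" using dlam_bounds(1) by auto
    show "integrable lborel (\<lambda>x. indicat_real {0..b} x * (G (lam x) * dlam x))"
      using s(1)[OF nn] by (simp add: set_integrable_def)
    show "(\<integral>x. indicat_real {lam 0..lam b} x * G x \<partial>lborel) = (\<integral>x. indicat_real {0..b} x * (G (lam x) * dlam x) \<partial>lborel)"
      using s(2)[OF nn] by (simp add: mult.commute mult.left_commute)
  qed
  have g_ind: "indicat_real {0..b} t * g t = indicat_real {0..b} t * (F (lam t) * dlam t)" for b t
    by (auto simp: g_def indicator_def)
  have ig: "integrable lborel (\<lambda>t. indicat_real {0..b} t * g t)" if "0 \<le> b" for b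
    unfolding g_ind by (rule subst(1)[OF that iF[OF lam0]])
  \<comment> \<open>The substitution only sees lengths from \<open>lam 0\<close> on. The piece below
    contributes nothing, because \<open>L \<ge> lam 0\<close> on \<open>D\<close> and the level set
    at \<open>lam 0\<close> is null.\<close>
  have V0: "V (pf f) (lam 0) = 0"
  proof -
    have "{lam 0} \<in> null_sets lborel" by (rule finite_imp_null_set_lborel) simp
    from L_preimage_null[OF this] have "AE v in M. indicat_real (sub (lam 0)) v * pf f v = 0"
    proof eventually_elim
      case (elim v)
      then have "v \<notin> sub (lam 0)"
        unfolding sub_lam[OF order_refl] using h_nonneg[of v] L_eq[of v] by auto
      then show ?case by simp
    qed
    then have "V (pf f) (lam 0) = (\<integral>v. 0 \<partial>M)"
      unfolding V_def by (intro integral_cong_AE) (use admD(1)[OF adm] in auto)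
    then show ?thesis by simp
  qed
  have Vg: "V (pf f) (lam b) = (\<integral>t. indicat_real {0..b} t * g t \<partial>lborel)" if b: "0 \<le> b" for b
  proof -
    have le: "lam 0 \<le> lam b" using lam_le_iff[OF order_refl b] b by simp
    have "V (pf f) (lam b) = (\<integral>l. indicat_real {0..lam b} l * F l \<partial>lborel)"
      unfolding F_def by (rule V[OF lam_nonneg[OF b]])
    also have "\<dots> = (\<integral>l. indicat_real {0..lam 0} l * F l + indicat_real {lam 0..lam b} l * F l \<partial>lborel)"
    proof (rule integral_cong_AE)
      show "AE l in lborel. indicat_real {0..lam b} l * F l =
          indicat_real {0..lam 0} l * F l + indicat_real {lam 0..lam b} l * F l"
        using AE_lborel_singleton[of "lam 0"] by eventually_elim (use le lam0 in \<open>auto simp: indicator_def\<close>)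
    next
      show "(\<lambda>l. indicat_real {0..lam b} l * F l) \<in> borel_measurable lborel"
        by (intro borel_measurable_integrable iF order_refl)
      show "(\<lambda>l. indicat_real {0..lam 0} l * F l + indicat_real {lam 0..lam b} l * F l) \<in> borel_measurable lborel"
        by (intro borel_measurable_add borel_measurable_integrable iF order_refl lam0)
    qed
    also have "\<dots> = (\<integral>l. indicat_real {0..lam 0} l * F l \<partial>lborel) + (\<integral>l. indicat_real {lam 0..lam b} l * F l \<partial>lborel)"
      by (intro Bochner_Integration.integral_add iF lam0) simp
    also have "(\<integral>l. indicat_real {0..lam 0} l * F l \<partial>lborel) = 0"
      using V[OF lam0] V0 unfolding F_def by simp
    also have "(\<integral>l. indicat_real {lam 0..lam b} l * F l \<partial>lborel) = (\<integral>t. indicat_real {0..b} t * g t \<partial>lborel)"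
      unfolding g_ind by (rule subst(2)[OF b iF[OF lam0]])
    finally show ?thesis by simp
  qed
  obtain A where A: "0 \<le> A" "\<And>t. 0 \<le> t \<Longrightarrow> exp t * \<bar>poly P (lam t) * dlam t - poly P t\<bar> \<le> A * exp (t / 4)"
    by (rule weighted_error_bound) blast
  define R where "R = (\<integral>l. \<bar>indicat_real {0..} l * (exp (\<epsilon> * l) * r l)\<bar> \<partial>lborel)"
  have R: "0 \<le> R" unfolding R_def by (rule Bochner_Integration.integral_nonneg) simp
  have growth_g: "(\<integral>t. indicat_real {0..m} t * (exp t * \<bar>g t - poly P t\<bar>) \<partial>lborel) \<le> (A + R) * (1 + m) * exp ((1 - \<epsilon>) * m)"
    if m: "1 \<le> m" for m
  proof -
    have m0: "0 \<le> m" using m by simp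
    define G where "G l = exp (\<epsilon> * l) * \<bar>r l\<bar>" for l
    have iG: "integrable lborel (\<lambda>l. indicat_real {lam 0..lam m} l * G l)"
    proof (rule Bochner_Integration.integrable_bound[OF ir])
      show "(\<lambda>l. indicat_real {lam 0..lam m} l * G l) \<in> borel_measurable lborel"
        unfolding G_def measurable_lborel1 using r by (intro borel_measurable_times borel_measurable_abs borel_measurable_exp borel_measurable_indicator) auto
      show "AE l in lborel. norm (indicat_real {lam 0..lam m} l * G l) \<le> norm (indicat_real {0..} l * (exp (\<epsilon> * l) * r l))"
        using lam0 by (intro AE_I2) (auto simp: indicator_def G_def abs_mult)
    qed
    have GR: "(\<integral>l. indicat_real {lam 0..lam m} l * G l \<partial>lborel) \<le> R"
      unfolding R_def
      by (rule integral_mono'[OF integrable_abs[OF ir]]) (use lam0 in \<open>auto simp: indicator_def G_def abs_mult\<close>)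
    define X where "X = exp ((1 - \<epsilon>) * m)"
    have X0: "0 < X" by (simp add: X_def)
    have pt: "indicat_real {0..m} t * (exp t * \<bar>g t - poly P t\<bar>) \<le>
        indicat_real {0..m} t * (A * X) + X * (indicat_real {0..m} t * (G (lam t) * dlam t))" for t
    proof (cases "t \<in> {0..m}")
      case True
      then have t: "0 \<le> t" "t \<le> m" by auto
      have "exp t * \<bar>g t - poly P t\<bar> \<le> exp t * (\<bar>poly P (lam t) * dlam t - poly P t\<bar> + \<bar>r (lam t)\<bar> * dlam t)"
      proof (rule mult_left_mono)
        have "g t - poly P t = (poly P (lam t) * dlam t - poly P t) + r (lam t) * dlam t"
          using t by (simp add: g_def F_def algebra_simps)
        moreover have "\<bar>r (lam t) * dlam t\<bar> = \<bar>r (lam t)\<bar> * dlam t"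
          using dlam_bounds(1)[OF t(1)] by (simp add: abs_mult)
        ultimately show "\<bar>g t - poly P t\<bar> \<le> \<bar>poly P (lam t) * dlam t - poly P t\<bar> + \<bar>r (lam t)\<bar> * dlam t"
          by linarith
      qed simp
      also have "\<dots> = exp t * \<bar>poly P (lam t) * dlam t - poly P t\<bar> + exp t * (\<bar>r (lam t)\<bar> * dlam t)"
        by (rule distrib_left)
      also have "exp t * \<bar>poly P (lam t) * dlam t - poly P t\<bar> \<le> A * X"
      proof -
        have "1 / 4 * t \<le> (1 - \<epsilon>) * m" using t \<epsilon>(2) by (intro mult_mono) auto
        then have "exp (t / 4) \<le> X" by (simp add: X_def)
        then have "A * exp (t / 4) \<le> A * X" using A(1) by (rule mult_left_mono)
        then show ?thesis using A(2)[OF t(1)] by linarith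
      qed
      also have "exp t * (\<bar>r (lam t)\<bar> * dlam t) \<le> X * (G (lam t) * dlam t)"
      proof -
        have "(1 - \<epsilon>) * t \<le> (1 - \<epsilon>) * m" using t \<epsilon>(2) by (intro mult_left_mono) auto
        moreover have "\<epsilon> * t \<le> \<epsilon> * lam t" using lam_ge[of t] \<epsilon>0 by (intro mult_left_mono) auto
        ultimately have "t \<le> (1 - \<epsilon>) * m + \<epsilon> * lam t" by (simp add: algebra_simps)
        then have "exp t \<le> X * exp (\<epsilon> * lam t)" by (simp add: X_def flip: exp_add)
        then have "exp t * (\<bar>r (lam t)\<bar> * dlam t) \<le> (X * exp (\<epsilon> * lam t)) * (\<bar>r (lam t)\<bar> * dlam t)"
          using dlam_bounds(1)[OF t(1)] by (intro mult_right_mono) auto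
        then show ?thesis by (simp add: G_def mult_ac)
      qed
      finally show ?thesis using True by simp
    qed simp
    have i1: "integrable lborel (\<lambda>t. indicat_real {0..m} t * (A * X))"
      by (intro integrable_mult_left integrable_real_indicator) (auto simp: emeasure_lborel_Icc_eq)
    have i2: "integrable lborel (\<lambda>t. X * (indicat_real {0..m} t * (G (lam t) * dlam t)))"
      by (intro integrable_mult_right subst(1)[OF m0 iG])
    have "(\<integral>t. indicat_real {0..m} t * (exp t * \<bar>g t - poly P t\<bar>) \<partial>lborel) \<le>
        (\<integral>t. indicat_real {0..m} t * (A * X) + X * (indicat_real {0..m} t * (G (lam t) * dlam t)) \<partial>lborel)"
    proof (rule integral_mono'[OF Bochner_Integration.integrable_add[OF i1 i2] pt])
      show "0 \<le> indicat_real {0..m} t * (A * X) + X * (indicat_real {0..m} t * (G (lam t) * dlam t))" for t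
        using A(1) X0 dlam_bounds(1)[of t] by (auto simp: indicator_def G_def intro!: add_nonneg_nonneg mult_nonneg_nonneg)
    qed
    also have "\<dots> = (\<integral>t. indicat_real {0..m} t * (A * X) \<partial>lborel) + X * (\<integral>l. indicat_real {lam 0..lam m} l * G l \<partial>lborel)"
      unfolding subst(2)[OF m0 iG] by (subst Bochner_Integration.integral_add[OF i1 i2]) simp
    also have "(\<integral>t. indicat_real {0..m} t * (A * X) \<partial>lborel) = m * (A * X)" using m0 by simp
    also have "X * (\<integral>l. indicat_real {lam 0..lam m} l * G l \<partial>lborel) \<le> X * R"
      using GR X0 by (intro mult_left_mono) auto
    also have "m * (A * X) + X * R \<le> (A + R) * (1 + m) * X"
    proof -
      have "0 \<le> A * X" "0 \<le> m * (R * X)" using A R X0 m0 by auto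
      then show ?thesis by (simp add: algebra_simps)
    qed
    finally show ?thesis by (simp add: X_def)
  qed
  show ?thesis
  proof (rule that[of P g, OF P gm _ ig])
    show "g t = 0" if "t < 0" for t using that by (simp add: g_def)
    show "integrable M (\<lambda>v. indicat_real {v \<in> D. h v \<le> b} v * pf f v)" if "0 \<le> b" for b
      using admD(2)[OF adm, of "lam b"] by (simp add: sub_lam[OF that])
    show "(\<integral>v. indicat_real {v \<in> D. h v \<le> b} v * pf f v \<partial>M) = (\<integral>t. indicat_real {0..b} t * g t \<partial>lborel)" if "0 \<le> b" for b
      using Vg[OF that] by (simp add: V_def sub_lam[OF that])
    show "\<exists>C\<ge>0. \<forall>m\<ge>1. (\<integral>t. indicat_real {0..m} t * (exp t * \<bar>g t - poly P t\<bar>) \<partial>lborel) \<le> C * (1 + m) * exp ((1 - \<epsilon>) * m)"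
      using growth_g A R by (intro exI[of _ "A + R"]) auto
  qed
qed

end

section \<open>Complex polynomials\<close>

text \<open>Half-lines generate the Borel sets and are stable under intersection. The Dynkin-class
  argument is run on integrals because the integrands are signed.\<close>

lemma pushforward_eq_of_atMost:
  fixes F1 :: "'a \<Rightarrow> real" and F2 :: "real \<Rightarrow> real"
  assumes u: "u \<in> borel_measurable N" and F1: "integrable N F1" and F2: "integrable lborel F2"
    and eq: "\<And>a. (LINT v:u -` {..a} \<inter> space N|N. F1 v) = (LINT t:{..a}|lborel. F2 t)"
    and B: "B \<in> sets borel"
  shows "(LINT v:u -` B \<inter> space N|N. F1 v) = (LINT t:B|lborel. F2 t)"
proof -
  have i1: "set_integrable N (u -` A \<inter> space N) F1" if "A \<in> sets borel" for A
    unfolding set_integrable_def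
    by (intro integrable_mult_indicator F1) (rule measurable_sets[OF u that])
  have i2: "set_integrable lborel A F2" if "A \<in> sets borel" for A
    unfolding set_integrable_def by (intro integrable_mult_indicator F2) (simp add: that)
  \<comment> \<open>The step to complements uses equality on the whole line, obtained as a limit of
    half-lines.\<close>
  have total: "(LINT v:u -` UNIV \<inter> space N|N. F1 v) = (LINT t:UNIV|lborel. F2 t)"
  proof -
    have U: "(\<Union>i::nat. {..real i}) = UNIV"
      by (auto simp: real_arch_simple)
    have "(\<lambda>i. LINT v:u -` {..real i} \<inter> space N|N. F1 v) \<longlonglongrightarrow> (LINT v:(\<Union>i. u -` {..real i} \<inter> space N)|N. F1 v)"
    proof (rule set_integral_cont_up)
      show "u -` {..real i} \<inter> space N \<in> sets N" for i by (rule measurable_sets[OF u]) simp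
      show "incseq (\<lambda>i. u -` {..real i} \<inter> space N)" by (auto simp: incseq_def)
      have "(\<Union>i. u -` {..real i} \<inter> space N) = u -` UNIV \<inter> space N" using U by blast
      then show "set_integrable N (\<Union>i. u -` {..real i} \<inter> space N) F1" using i1[of UNIV] by simp
    qed
    moreover have "(\<Union>i. u -` {..real i} \<inter> space N) = u -` UNIV \<inter> space N" using U by blast
    moreover have "(\<lambda>i. LINT t:{..real i}|lborel. F2 t) \<longlonglongrightarrow> (LINT t:(\<Union>i. {..real i})|lborel. F2 t)"
      by (rule set_integral_cont_up) (use i2[of UNIV] U in \<open>auto simp: incseq_def\<close>)
    ultimately show ?thesis unfolding eq U by (auto intro: LIMSEQ_unique)
  qed
  have "Int_stable (range (atMost :: real \<Rightarrow> real set))"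
    unfolding Int_stable_def by auto
  moreover have "range (atMost :: real \<Rightarrow> real set) \<subseteq> Pow UNIV" by simp
  moreover have "B \<in> sigma_sets UNIV (range atMost)"
    using B by (simp add: borel_eq_atMost sets_measure_of)
  ultimately show ?thesis
  proof (induction rule: sigma_sets_induct_disjoint)
    case (basic A)
    then show ?case using eq by auto
  next
    case empty
    then show ?case by (simp add: set_lebesgue_integral_def)
  next
    case (compl A)
    then have A: "A \<in> sets borel" by (simp add: borel_eq_atMost sets_measure_of)
    then have "space borel - A \<in> sets borel" by (rule sets.compl_sets)
    then have A': "UNIV - A \<in> sets borel" by simp
    have "(LINT v:(u -` A \<inter> space N) \<union> (u -` (UNIV - A) \<inter> space N)|N. F1 v) =
        (LINT v:u -` A \<inter> space N|N. F1 v) + (LINT v:u -` (UNIV - A) \<inter> space N|N. F1 v)"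
      by (intro set_integral_Un i1 A A') auto
    moreover have "(u -` A \<inter> space N) \<union> (u -` (UNIV - A) \<inter> space N) = u -` UNIV \<inter> space N" by auto
    moreover have "(LINT t:A \<union> (UNIV - A)|lborel. F2 t) = (LINT t:A|lborel. F2 t) + (LINT t:UNIV - A|lborel. F2 t)"
      by (intro set_integral_Un i2 A A') auto
    moreover have "A \<union> (UNIV - A) = UNIV" by auto
    ultimately show ?case using total compl by simp
  next
    case (union A)
    then have A: "A i \<in> sets borel" for i
      by (auto simp: borel_eq_atMost sets_measure_of)
    have disj: "A i \<inter> A j = {}" if "i \<noteq> j" for i j
      using union that by (simp add: disjoint_family_on_def)
    have "(LINT v:(\<Union>i. u -` A i \<inter> space N)|N. F1 v) = (\<Sum>i. LINT v:u -` A i \<inter> space N|N. F1 v)"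
    proof (rule lebesgue_integral_countable_add)
      show "u -` A i \<inter> space N \<in> sets N" for i by (rule measurable_sets[OF u A])
      show "(u -` A i \<inter> space N) \<inter> (u -` A j \<inter> space N) = {}" if "i \<noteq> j" for i j using disj[OF that] by auto
      have "(\<Union>i. u -` A i \<inter> space N) = u -` (\<Union>i. A i) \<inter> space N" by auto
      moreover have "(\<Union>i. A i) \<in> sets borel" using A by auto
      ultimately show "set_integrable N (\<Union>i. u -` A i \<inter> space N) F1" using i1 by simp
    qed
    moreover have "(\<Union>i. u -` A i \<inter> space N) = u -` (\<Union>i. A i) \<inter> space N" by auto
    moreover have "(LINT t:(\<Union>i. A i)|lborel. F2 t) = (\<Sum>i. LINT t:A i|lborel. F2 t)"
      by (rule lebesgue_integral_countable_add) (use A disj in \<open>auto intro!: i2\<close>)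
    ultimately show ?case using union by simp
  qed
qed

lemma poly_complex_split:
  "poly p (complex_of_real x) =
    complex_of_real (poly (map_poly Re p) x) + \<i> * complex_of_real (poly (map_poly Im p) x)"
  by (induction p) (auto simp: map_poly_pCons complex_eq_iff algebra_simps)

lemma poly_map_of_real: "poly (map_poly complex_of_real p) (complex_of_real x) = complex_of_real (poly p x)"
  by (induction p) (auto simp: map_poly_pCons)

lemma degree_map_poly_le: "f 0 = 0 \<Longrightarrow> degree (map_poly f p) \<le> degree p"
  by (rule degree_le) (simp add: coeff_map_poly coeff_eq_0)

lemma locally_integrableI:
  assumes "\<And>b. set_integrable lborel {- b..b} f" shows "locally_integrable f"
  unfolding locally_integrable_def
proof (intro allI impI)
  fix K :: "real set" assume K: "compact K"
  then obtain b where b: "\<And>x. x \<in> K \<Longrightarrow> \<bar>x\<bar> \<le> b"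
    using compact_imp_bounded[OF K] unfolding bounded_iff by auto
  have "set_integrable lborel K f"
    by (rule set_integrable_subset[OF assms[of b]]) (use K b in \<open>auto intro: borel_compact simp: abs_le_iff minus_le_iff\<close>)
  then show "set_integrable lebesgue K f"
    unfolding set_integrable_def using integrable_completion borel_measurable_integrable by blast
qed

context length_fun
begin

text \<open>\<open>B\<close> is bounded above and nothing lies below 0, so truncation at
  \<open>b\<close> makes both integrands globally integrable.\<close>

lemma pushforward_borel:
  assumes g: "\<And>t. t < 0 \<Longrightarrow> g t = 0" and b: "0 \<le> b" "B \<subseteq> {..b}" and B: "B \<in> sets borel"
    and i1: "integrable M (\<lambda>v. indicat_real {v \<in> D. h v \<le> b} v * W v)"
    and i2: "integrable lborel (\<lambda>t. indicat_real {0..b} t * g t)"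
    and eq: "\<And>b. 0 \<le> b \<Longrightarrow> (\<integral>v. indicat_real {v \<in> D. h v \<le> b} v * W v \<partial>M) = (\<integral>t. indicat_real {0..b} t * g t \<partial>lborel)"
  shows "integrable M (\<lambda>v. indicat_real B (h v) * (indicat_real D v * W v))"
    and "integrable lborel (\<lambda>t. indicat_real B t * g t)"
    and "(\<integral>v. indicat_real B (h v) * (indicat_real D v * W v) \<partial>M) = (\<integral>t. indicat_real B t * g t \<partial>lborel)"
proof -
  \<comment> \<open>\<open>h\<close> is arbitrary outside \<open>D\<close>. Its extension by 0 is
    measurable, since its sublevel sets come from those of \<open>L\<close>.\<close>
  define u where "u v = (if v \<in> D then h v else 0)" for v
  have u0: "0 \<le> u v" for v using h_nonneg by (simp add: u_def)
  have u: "u \<in> borel_measurable M"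
  proof (rule borel_measurableI_le)
    fix y
    show "{v \<in> space M. u v \<le> y} \<in> sets M"
    proof (cases "0 \<le> y")
      case True
      have "{v \<in> space M. u v \<le> y} = sub (lam y) \<union> (space M - D)"
        using True sets.sets_into_space[OF D_sets] unfolding sub_lam[OF True] by (auto simp: u_def)
      moreover have "\<dots> \<in> sets M" by (intro sets.Un sets.compl_sets sub_sets D_sets)
      ultimately show ?thesis by simp
    next
      case False
      have "{v \<in> space M. u v \<le> y} = {}" using False u0 order_trans by blast
      then show ?thesis by (metis sets.empty_sets)
    qed
  qed
  define F1 where "F1 = (\<lambda>v. indicat_real {v \<in> D. h v \<le> b} v * W v)"
  define F2 where "F2 = (\<lambda>t. indicat_real {0..b} t * g t)"
  have F: "integrable M F1" "integrable lborel F2" using i1 i2 by (simp_all add: F1_def F2_def)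
  have atMost: "(LINT v:u -` {..a} \<inter> space M|M. F1 v) = (LINT t:{..a}|lborel. F2 t)" for a
  proof (cases "0 \<le> a")
    case True
    have "(LINT v:u -` {..a} \<inter> space M|M. F1 v) = (\<integral>v. indicat_real {v \<in> D. h v \<le> min a b} v * W v \<partial>M)"
      unfolding set_lebesgue_integral_def
      by (rule Bochner_Integration.integral_cong) (auto simp: F1_def u_def indicator_def)
    also have "\<dots> = (\<integral>t. indicat_real {0..min a b} t * g t \<partial>lborel)" using True b by (intro eq) simp
    also have "\<dots> = (LINT t:{..a}|lborel. F2 t)"
      unfolding set_lebesgue_integral_def
      by (rule Bochner_Integration.integral_cong) (auto simp: F2_def indicator_def)
    finally show ?thesis .
  next
    case False
    have "(\<lambda>v. indicat_real (u -` {..a} \<inter> space M) v *\<^sub>R F1 v) = (\<lambda>v. 0)"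
      using False order_trans[OF u0] by (fastforce simp: indicator_def)
    moreover have "(\<lambda>t. indicat_real {..a} t *\<^sub>R F2 t) = (\<lambda>t. 0)"
      using False by (auto simp: indicator_def F2_def)
    ultimately show ?thesis unfolding set_lebesgue_integral_def by simp
  qed
  have B1: "indicat_real B (h v) * (indicat_real D v * W v) = indicat_real (u -` B \<inter> space M) v *\<^sub>R F1 v"
    if "v \<in> space M" for v
    using that b by (auto simp: indicator_def F1_def u_def)
  have B2: "indicat_real B t * g t = indicat_real B t *\<^sub>R F2 t" for t
    using b g[of t] by (cases "t < 0") (auto simp: indicator_def F2_def)
  have "integrable M (\<lambda>v. indicat_real (u -` B \<inter> space M) v *\<^sub>R F1 v)"
    by (intro integrable_mult_indicator F measurable_sets[OF u B])
  then show "integrable M (\<lambda>v. indicat_real B (h v) * (indicat_real D v * W v))"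
    by (subst Bochner_Integration.integrable_cong[OF refl B1])
  show "integrable lborel (\<lambda>t. indicat_real B t * g t)"
    unfolding B2 by (intro integrable_mult_indicator F) (simp add: B)
  have "(\<integral>v. indicat_real B (h v) * (indicat_real D v * W v) \<partial>M) = (LINT v:u -` B \<inter> space M|M. F1 v)"
    unfolding set_lebesgue_integral_def by (rule Bochner_Integration.integral_cong[OF refl B1])
  also have "\<dots> = (LINT t:B|lborel. F2 t)" by (rule pushforward_eq_of_atMost[OF u F atMost B])
  also have "\<dots> = (\<integral>t. indicat_real B t * g t \<partial>lborel)" unfolding set_lebesgue_integral_def B2 by (rule refl)
  finally show "(\<integral>v. indicat_real B (h v) * (indicat_real D v * W v) \<partial>M) = (\<integral>t. indicat_real B t * g t \<partial>lborel)" .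
qed


text \<open>Collects the data for one tuple of real polynomials in a single predicate, so that a
  polynomial and a density can be chosen for all subsets of coordinates at once.\<close>

definition density_pair :: "real \<Rightarrow> nat \<Rightarrow> (nat \<Rightarrow> real poly) \<Rightarrow> real poly \<Rightarrow> (real \<Rightarrow> real) \<Rightarrow> bool" where
  "density_pair \<epsilon> K f P g \<longleftrightarrow>
     degree P < d + K \<and> (\<forall>t<0. g t = 0) \<and> (\<forall>b. set_integrable lborel {- b..b} g) \<and>
     (\<forall>B\<in>sets borel. bounded B \<longrightarrow>
        integrable M (\<lambda>v. indicat_real B (h v) * (indicat_real D v * pf f v)) \<and>
        integrable lborel (\<lambda>t. indicat_real B t * g t) \<and>
        (\<integral>v. indicat_real B (h v) * (indicat_real D v * pf f v) \<partial>M) = (\<integral>t. indicat_real B t * g t \<partial>lborel)) \<and>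
     (\<exists>C\<ge>0. \<forall>m\<ge>1. (\<integral>t. indicat_real {0..m} t * (exp t * \<bar>g t - poly P t\<bar>) \<partial>lborel) \<le> C * (1 + m) * exp ((1 - \<epsilon>) * m))"

lemma density_pair_exists:
  assumes "good \<epsilon>" "\<epsilon> \<le> 1 / 2" "(\<Sum>i<d. degree (f i)) \<le> K"
  shows "\<exists>P g. density_pair \<epsilon> K f P g"
proof (rule real_density[OF assms])
  fix P g
  assume P: "P = 0 \<or> degree P < d + K" and "g \<in> borel_measurable borel"
    and g: "\<And>t. t < 0 \<Longrightarrow> g t = 0"
    and i2: "\<And>b. 0 \<le> b \<Longrightarrow> integrable lborel (\<lambda>t. indicat_real {0..b} t * g t)"
    and i1: "\<And>b. 0 \<le> b \<Longrightarrow> integrable M (\<lambda>v. indicat_real {v \<in> D. h v \<le> b} v * pf f v)"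
    and eq: "\<And>b. 0 \<le> b \<Longrightarrow> (\<integral>v. indicat_real {v \<in> D. h v \<le> b} v * pf f v \<partial>M) = (\<integral>t. indicat_real {0..b} t * g t \<partial>lborel)"
    and C: "\<exists>C\<ge>0. \<forall>m\<ge>1. (\<integral>t. indicat_real {0..m} t * (exp t * \<bar>g t - poly P t\<bar>) \<partial>lborel) \<le> C * (1 + m) * exp ((1 - \<epsilon>) * m)"
  \<comment> \<open>The zero polynomial has degree 0, which is below \<open>d + K\<close> because
    \<open>d\<close> is positive.\<close>
  have P': "degree P < d + K" using P dim_pos by auto
  have g': "\<forall>t<0. g t = 0" using g by simp
  have "set_integrable lborel {- b..b} g" for b
  proof (cases "0 \<le> b")
    case True
    have eq: "indicat_real {- b..b} t *\<^sub>R g t = indicat_real {0..b} t * g t" for t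
      using g[of t] by (cases "t < 0") (auto simp: indicator_def)
    show ?thesis unfolding set_integrable_def eq by (rule i2[OF True])
  qed simp
  then have ig: "\<forall>b. set_integrable lborel {- b..b} g" by (rule allI)
  have "integrable M (\<lambda>v. indicat_real B (h v) * (indicat_real D v * pf f v)) \<and>
        integrable lborel (\<lambda>t. indicat_real B t * g t) \<and>
        (\<integral>v. indicat_real B (h v) * (indicat_real D v * pf f v) \<partial>M) = (\<integral>t. indicat_real B t * g t \<partial>lborel)"
    if B: "B \<in> sets borel" "bounded B" for B
  proof -
    obtain b where "\<And>t. t \<in> B \<Longrightarrow> \<bar>t\<bar> \<le> b" using B(2) unfolding bounded_iff by auto
    then have b: "0 \<le> max 0 b" "B \<subseteq> {..max 0 b}" by (auto simp: abs_le_iff le_max_iff_disj)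
    note p = pushforward_borel[OF g b B(1) i1[OF b(1)] i2[OF b(1)] eq]
    show ?thesis by (intro conjI p)
  qed
  then have push: "\<forall>B\<in>sets borel. bounded B \<longrightarrow>
        integrable M (\<lambda>v. indicat_real B (h v) * (indicat_real D v * pf f v)) \<and>
        integrable lborel (\<lambda>t. indicat_real B t * g t) \<and>
        (\<integral>v. indicat_real B (h v) * (indicat_real D v * pf f v) \<partial>M) = (\<integral>t. indicat_real B t * g t \<partial>lborel)"
    by (intro ballI impI)
  show ?thesis
    by (intro exI[of _ P] exI[of _ g]) (unfold density_pair_def, intro conjI P' g' ig push C)
qed

text \<open>Each polynomial is its real part plus \<i> times its imaginary part, coefficientwise.
  Expanding the product over the set \<open>X\<close> of coordinates that contribute real parts
  reduces the claim to real polynomials, by linearity of the push-forward.\<close>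

lemma complex_density:
  assumes \<epsilon>: "good \<epsilon>" "\<epsilon> \<le> 1 / 2" and deg: "(\<Sum>i<d. degree (f i)) \<le> K"
  shows "\<exists>g\<in>SF_w (K + d - 1) \<epsilon>.
    pseudo_conv_density d h (indicat_real D) (\<lambda>i x. poly (f i) (complex_of_real x)) g"
proof -
  define fx where "fx X i = (if i \<in> X then map_poly Re (f i) else map_poly Im (f i))" for X i
  define w where "w X = \<i> ^ card ({..<d} - X)" for X :: "nat set"
  have wn: "cmod (w X) = 1" for X by (simp add: w_def norm_power)
  have "(\<Sum>i<d. degree (fx X i)) \<le> K" for X
    by (rule order_trans[OF sum_mono deg]) (simp add: fx_def degree_map_poly_le)
  then have "\<exists>P g. density_pair \<epsilon> K (fx X) P g" for X by (intro density_pair_exists \<epsilon>)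
  then obtain P g where pair: "\<And>X. density_pair \<epsilon> K (fx X) (P X) (g X)" by metis
  have degP: "degree (P X) < d + K" and ig: "set_integrable lborel {- b..b} (g X)"
    and iM: "B \<in> sets borel \<Longrightarrow> bounded B \<Longrightarrow>
        integrable M (\<lambda>v. indicat_real B (h v) * (indicat_real D v * pf (fx X) v))"
    and iB: "B \<in> sets borel \<Longrightarrow> bounded B \<Longrightarrow> integrable lborel (\<lambda>t. indicat_real B t * g X t)"
    and eqB: "B \<in> sets borel \<Longrightarrow> bounded B \<Longrightarrow>
        (\<integral>v. indicat_real B (h v) * (indicat_real D v * pf (fx X) v) \<partial>M) = (\<integral>t. indicat_real B t * g X t \<partial>lborel)"
    for X b B using pair[of X] by (auto simp: density_pair_def)
  have "\<exists>C\<ge>0. \<forall>m\<ge>1. (\<integral>t. indicat_real {0..m} t * (exp t * \<bar>g X t - poly (P X) t\<bar>) \<partial>lborel) \<le> C * (1 + m) * exp ((1 - \<epsilon>) * m)" for X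
    using pair[of X] unfolding density_pair_def by blast
  then have "\<forall>X. \<exists>C. 0 \<le> C \<and> (\<forall>m\<ge>1. (\<integral>t. indicat_real {0..m} t * (exp t * \<bar>g X t - poly (P X) t\<bar>) \<partial>lborel) \<le> C * (1 + m) * exp ((1 - \<epsilon>) * m))"
    by (intro allI)
  from choice[OF this] obtain C where C: "\<And>X. 0 \<le> C X" "\<And>X m. 1 \<le> m \<Longrightarrow>
      (\<integral>t. indicat_real {0..m} t * (exp t * \<bar>g X t - poly (P X) t\<bar>) \<partial>lborel) \<le> C X * (1 + m) * exp ((1 - \<epsilon>) * m)"
    by blast
  define Gc where "Gc t = (\<Sum>X\<in>Pow {..<d}. w X * complex_of_real (g X t))" for t
  define Pc where "Pc = (\<Sum>X\<in>Pow {..<d}. smult (w X) (map_poly complex_of_real (P X)))"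
  define r where "r X t = exp t * (g X t - poly (P X) t)" for X t
  define Rc where "Rc t = (\<Sum>X\<in>Pow {..<d}. w X * complex_of_real (r X t))" for t
  have ir: "set_integrable lborel {- b..b} (r X)" for X b
  proof -
    have "set_integrable lborel {- b..b} (\<lambda>t. exp t * g X t)"
      unfolding set_integrable_def
    proof (rule Bochner_Integration.integrable_bound)
      show "integrable lborel (\<lambda>t. exp b * (indicat_real {- b..b} t *\<^sub>R g X t))"
        by (intro integrable_mult_right ig[unfolded set_integrable_def])
      have "(\<lambda>t. exp t * (indicat_real {- b..b} t *\<^sub>R g X t)) \<in> borel_measurable lborel"
        by (intro borel_measurable_times borel_measurable_integrable[OF ig[unfolded set_integrable_def]]) simp
      then show "(\<lambda>t. indicat_real {- b..b} t *\<^sub>R (exp t * g X t)) \<in> borel_measurable lborel"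
        by (simp add: mult.left_commute)
      show "AE t in lborel. norm (indicat_real {- b..b} t *\<^sub>R (exp t * g X t)) \<le> norm (exp b * (indicat_real {- b..b} t *\<^sub>R g X t))"
        by (intro AE_I2) (auto simp: indicator_def abs_mult intro!: mult_right_mono)
    qed
    moreover have "set_integrable lborel {- b..b} (\<lambda>t. exp t * poly (P X) t)"
      by (intro borel_integrable_atLeastAtMost' continuous_intros)
    ultimately have "set_integrable lborel {- b..b} (\<lambda>t. exp t * g X t - exp t * poly (P X) t)"
      by (rule set_integral_diff)
    then show ?thesis by (simp add: r_def[abs_def] right_diff_distrib)
  qed
  have sum_li: "locally_integrable (\<lambda>t. \<Sum>X\<in>Pow {..<d}. w X * complex_of_real (y X t))"
    if "\<And>X b. set_integrable lborel {- b..b} (y X)" for y :: "nat set \<Rightarrow> real \<Rightarrow> real"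
  proof (rule locally_integrableI)
    fix b
    have "integrable lborel (\<lambda>t. \<Sum>X\<in>Pow {..<d}. w X * complex_of_real (indicat_real {- b..b} t *\<^sub>R y X t))"
      using that unfolding set_integrable_def
      by (intro Bochner_Integration.integrable_sum integrable_mult_right integrable_of_real)
    moreover have "(\<Sum>X\<in>Pow {..<d}. w X * complex_of_real (indicat_real {- b..b} t *\<^sub>R y X t)) =
        indicat_real {- b..b} t *\<^sub>R (\<Sum>X\<in>Pow {..<d}. w X * complex_of_real (y X t))" for t
      by (simp add: scaleR_conv_of_real sum_distrib_left mult.left_commute)
    ultimately show "set_integrable lborel {- b..b} (\<lambda>t. \<Sum>X\<in>Pow {..<d}. w X * complex_of_real (y X t))"
      unfolding set_integrable_def by simp
  qed
  have liG: "locally_integrable Gc" unfolding Gc_def[abs_def] by (rule sum_li[OF ig])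
  have liR: "locally_integrable Rc" unfolding Rc_def[abs_def] by (rule sum_li[OF ir])
  have "Rc \<in> R_w (1 - \<epsilon>)"
  proof -
    define C1 where "C1 = (\<Sum>X\<in>Pow {..<d}. C X) + 1"
    have "0 \<le> (\<Sum>X\<in>Pow {..<d}. C X)" by (intro sum_nonneg C)
    then have C1: "0 < C1" by (simp add: C1_def)
    have "(LINT l:{0..m}|lebesgue. cmod (Rc l)) \<le> C1 * (1 + m) powr 1 * exp ((1 - \<epsilon>) * m)" if m: "1 \<le> m" for m
    proof -
      have ir0: "integrable lborel (\<lambda>t. indicat_real {0..m} t * \<bar>r X t\<bar>)" for X
      proof -
        have "set_integrable lborel {0..m} (r X)"
          by (rule set_integrable_subset[OF ir[of m X]]) (use m in auto)
        from set_integrable_abs[OF this] show ?thesis by (simp add: set_integrable_def)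
      qed
      have iR0: "set_integrable lebesgue {0..m} (\<lambda>t. cmod (Rc t))"
        using liR unfolding locally_integrable_def by (intro set_integrable_norm) simp
      have "(LINT l:{0..m}|lebesgue. cmod (Rc l)) \<le> (LINT l|lebesgue. (\<Sum>X\<in>Pow {..<d}. indicat_real {0..m} l * \<bar>r X l\<bar>))"
        unfolding set_lebesgue_integral_def
      proof (rule integral_mono[OF iR0[unfolded set_integrable_def]])
        have "integrable lborel (\<lambda>l. \<Sum>X\<in>Pow {..<d}. indicat_real {0..m} l * \<bar>r X l\<bar>)"
          by (intro Bochner_Integration.integrable_sum ir0)
        then show "integrable lebesgue (\<lambda>l. \<Sum>X\<in>Pow {..<d}. indicat_real {0..m} l * \<bar>r X l\<bar>)"
          using integrable_completion borel_measurable_integrable by blast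
        fix l
        have "cmod (Rc l) \<le> (\<Sum>X\<in>Pow {..<d}. \<bar>r X l\<bar>)"
          unfolding Rc_def by (rule sum_norm_le) (simp add: norm_mult wn)
        then have "indicat_real {0..m} l * cmod (Rc l) \<le> indicat_real {0..m} l * (\<Sum>X\<in>Pow {..<d}. \<bar>r X l\<bar>)"
          by (rule mult_left_mono) simp
        then show "indicat_real {0..m} l *\<^sub>R cmod (Rc l) \<le> (\<Sum>X\<in>Pow {..<d}. indicat_real {0..m} l * \<bar>r X l\<bar>)"
          by (simp add: sum_distrib_left)
      qed
      also have "\<dots> = (\<integral>l. (\<Sum>X\<in>Pow {..<d}. indicat_real {0..m} l * \<bar>r X l\<bar>) \<partial>lborel)"
        by (intro integral_completion borel_measurable_integrable Bochner_Integration.integrable_sum ir0)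
      also have "\<dots> = (\<Sum>X\<in>Pow {..<d}. \<integral>l. indicat_real {0..m} l * \<bar>r X l\<bar> \<partial>lborel)"
        by (intro Bochner_Integration.integral_sum ir0)
      also have "\<dots> \<le> (\<Sum>X\<in>Pow {..<d}. C X * (1 + m) * exp ((1 - \<epsilon>) * m))"
        using C(2)[OF m] by (intro sum_mono) (simp add: r_def abs_mult)
      also have "\<dots> = (\<Sum>X\<in>Pow {..<d}. C X) * ((1 + m) * exp ((1 - \<epsilon>) * m))"
        by (simp add: sum_distrib_right mult.assoc)
      also have "\<dots> \<le> C1 * ((1 + m) * exp ((1 - \<epsilon>) * m))"
        using m by (intro mult_right_mono mult_nonneg_nonneg) (auto simp: C1_def)
      also have "\<dots> = C1 * (1 + m) powr 1 * exp ((1 - \<epsilon>) * m)" using m by (simp add: powr_one)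
      finally show ?thesis .
    qed
    then have "\<forall>m\<ge>1. (LINT l:{0..m}|lebesgue. cmod (Rc l)) \<le> C1 * (1 + m) powr 1 * exp ((1 - \<epsilon>) * m)"
      by (intro allI impI)
    then have "\<exists>c1>0. \<forall>m\<ge>1. (LINT l:{0..m}|lebesgue. cmod (Rc l)) \<le> c1 * (1 + m) powr 1 * exp ((1 - \<epsilon>) * m)"
      using C1 by (intro exI conjI)
    then have "\<exists>c>0. \<exists>c1>0. \<forall>m\<ge>1. (LINT l:{0..m}|lebesgue. cmod (Rc l)) \<le> c1 * (1 + m) powr c * exp ((1 - \<epsilon>) * m)"
      by - (rule exI[where x = "1 :: real"], rule conjI, rule zero_less_one, assumption)
    then show ?thesis unfolding R_w_def using liR by (intro CollectI conjI)
  qed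
  moreover have "Pc = 0 \<or> degree Pc < d + K"
  proof (rule disjI2)
    have "degree Pc \<le> d + K - 1"
      unfolding Pc_def
    proof (rule degree_sum_le)
      fix X
      have "degree (smult (w X) (map_poly complex_of_real (P X))) \<le> degree (P X)"
        by (rule order_trans[OF degree_smult_le degree_map_poly_le]) simp
      then show "degree (smult (w X) (map_poly complex_of_real (P X))) \<le> d + K - 1"
        using degP[of X] by linarith
    qed simp
    then show "degree Pc < d + K" using dim_pos by linarith
  qed
  \<comment> \<open>Subtraction on naturals is truncated; positivity of \<open>d\<close> makes
    adding 1 back exact.\<close>
  moreover have "K + d - 1 + 1 = d + K" using dim_pos by linarith
  moreover have Gc_eq: "Gc l = complex_of_real (exp (- l)) * (complex_of_real (exp l) * poly Pc (complex_of_real l) + Rc l)" for l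
  proof -
    have "complex_of_real (exp (- l)) * (complex_of_real (exp l) * poly Pc (complex_of_real l) + Rc l) =
        (\<Sum>X\<in>Pow {..<d}. w X * complex_of_real (exp (- l) * (exp l * poly (P X) l + r X l)))"
      unfolding Pc_def Rc_def poly_sum poly_smult poly_map_of_real
      by (simp add: sum_distrib_left sum.distrib distrib_left mult_ac)
    also have "\<dots> = Gc l"
      unfolding Gc_def
    proof (rule sum.cong[OF refl])
      fix X
      have "exp (- l) * (exp l * poly (P X) l + r X l) = (exp (- l) * exp l) * g X l"
        by (simp add: r_def algebra_simps)
      also have "exp (- l) * exp l = 1" by (simp flip: exp_add)
      finally show "w X * complex_of_real (exp (- l) * (exp l * poly (P X) l + r X l)) = w X * complex_of_real (g X l)" by simp
    qed
    finally show ?thesis by (rule sym)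
  qed
  ultimately have "Gc \<in> SF_w (K + d - 1) \<epsilon>"
    unfolding SF_w_def F_w_def by (intro image_eqI[where x = "\<lambda>l. complex_of_real (exp l) * poly Pc (complex_of_real l) + Rc l"]) auto
  moreover have "pseudo_conv_density d h (indicat_real D) (\<lambda>i x. poly (f i) (complex_of_real x)) Gc"
    unfolding pseudo_conv_density_def
  proof (intro conjI ballI impI liG)
    fix B :: "real set" assume B: "B \<in> sets borel" "bounded B"
    have prod: "(\<Prod>i<d. poly (f i) (complex_of_real (v i))) = (\<Sum>X\<in>Pow {..<d}. w X * complex_of_real (pf (fx X) v))" for v
    proof -
      have "(\<Prod>i<d. poly (f i) (complex_of_real (v i))) =
          (\<Sum>X\<in>Pow {..<d}. (\<Prod>i\<in>X. complex_of_real (poly (map_poly Re (f i)) (v i))) *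
             (\<Prod>i\<in>{..<d} - X. \<i> * complex_of_real (poly (map_poly Im (f i)) (v i))))"
        unfolding poly_complex_split by (rule prod_add) simp
      also have "\<dots> = (\<Sum>X\<in>Pow {..<d}. w X * complex_of_real (pf (fx X) v))"
      proof (rule sum.cong[OF refl])
        fix X assume "X \<in> Pow {..<d}"
        then have X: "X \<subseteq> {..<d}" by simp
        have "pf (fx X) v = (\<Prod>i\<in>{..<d} - X. poly (fx X i) (v i)) * (\<Prod>i\<in>X. poly (fx X i) (v i))"
          unfolding pf_def by (rule prod.subset_diff[OF X]) simp
        also have "(\<Prod>i\<in>{..<d} - X. poly (fx X i) (v i)) = (\<Prod>i\<in>{..<d} - X. poly (map_poly Im (f i)) (v i))"
          by (rule prod.cong) (auto simp: fx_def)
        also have "(\<Prod>i\<in>X. poly (fx X i) (v i)) = (\<Prod>i\<in>X. poly (map_poly Re (f i)) (v i))"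
          by (rule prod.cong) (auto simp: fx_def)
        finally show "(\<Prod>i\<in>X. complex_of_real (poly (map_poly Re (f i)) (v i))) *
             (\<Prod>i\<in>{..<d} - X. \<i> * complex_of_real (poly (map_poly Im (f i)) (v i))) = w X * complex_of_real (pf (fx X) v)"
          by (simp add: prod.distrib w_def mult_ac)
      qed
      finally show ?thesis .
    qed
    have int: "indicat_real B (h v) *\<^sub>R (indicat_real D v *\<^sub>R (\<Prod>i<d. poly (f i) (complex_of_real (v i)))) =
        (\<Sum>X\<in>Pow {..<d}. w X * complex_of_real (indicat_real B (h v) * (indicat_real D v * pf (fx X) v)))" for v
      unfolding prod by (simp add: scaleR_conv_of_real sum_distrib_left mult_ac)
    have iMc: "integrable M (\<lambda>v. w X * complex_of_real (indicat_real B (h v) * (indicat_real D v * pf (fx X) v)))" for X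
      by (intro integrable_mult_right integrable_of_real iM B)
    show "integrable M (\<lambda>v. indicat_real B (h v) *\<^sub>R (indicat_real D v *\<^sub>R (\<Prod>i<d. poly (f i) (complex_of_real (v i)))))"
      unfolding int by (intro Bochner_Integration.integrable_sum iMc)
    have iBc: "integrable lborel (\<lambda>t. w X * complex_of_real (indicat_real B t * g X t))" for X
      by (intro integrable_mult_right integrable_of_real iB B)
    have "(\<integral>v. indicat_real B (h v) *\<^sub>R (indicat_real D v *\<^sub>R (\<Prod>i<d. poly (f i) (complex_of_real (v i)))) \<partial>M) =
        (\<Sum>X\<in>Pow {..<d}. \<integral>v. w X * complex_of_real (indicat_real B (h v) * (indicat_real D v * pf (fx X) v)) \<partial>M)"
      unfolding int by (intro Bochner_Integration.integral_sum iMc)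
    also have "\<dots> = (\<Sum>X\<in>Pow {..<d}. \<integral>t. w X * complex_of_real (indicat_real B t * g X t) \<partial>lborel)"
      unfolding integral_mult_right_zero integral_complex_of_real eqB[OF B] by (rule refl)
    also have "\<dots> = (\<integral>t. (\<Sum>X\<in>Pow {..<d}. w X * complex_of_real (indicat_real B t * g X t)) \<partial>lborel)"
      by (intro Bochner_Integration.integral_sum[symmetric] iBc)
    also have "\<dots> = (LINT t|lebesgue. (\<Sum>X\<in>Pow {..<d}. w X * complex_of_real (indicat_real B t * g X t)))"
      by (intro integral_completion[symmetric] borel_measurable_integrable Bochner_Integration.integrable_sum iBc)
    also have "\<dots> = (LINT t:B|lebesgue. Gc t)"
      unfolding set_lebesgue_integral_def Gc_def
      by (rule Bochner_Integration.integral_cong[OF refl]) (simp add: scaleR_conv_of_real sum_distrib_left mult_ac)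
    finally show "(\<integral>v. indicat_real B (h v) *\<^sub>R (indicat_real D v *\<^sub>R (\<Prod>i<d. poly (f i) (complex_of_real (v i)))) \<partial>M) =
        (LINT t:B|lebesgue. Gc t)" .
  qed
  ultimately show ?thesis by blast
qed

end

theorem theorem4p14:
  fixes n k :: nat and h :: "(nat \<Rightarrow> real) \<Rightarrow> real"
  assumes "2 * n + k \<ge> 1"
    and "length_type n k h"
  shows "\<exists>lam::real. 0 < lam \<and> lam < 1 \<and>
    (\<forall>(f :: nat \<Rightarrow> complex poly) (K :: nat \<Rightarrow> nat).
       (\<forall>i<2 * n + k. degree (f i) = K i) \<longrightarrow>
       (\<exists>g \<in> SF_w ((\<Sum>i<2 * n + k. K i) + 2 * n + k - 1) lam.
          pseudo_conv_density (2 * n + k) h (indicat_real (length_dom n k))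
            (\<lambda>i x. poly (f i) (complex_of_real x)) g))"
proof -
  obtain e :: "nat \<Rightarrow> nat" and p :: nat and G :: "nat \<Rightarrow> (nat \<Rightarrow> real) set"
    and a :: "nat \<Rightarrow> (nat \<Rightarrow> real) \<Rightarrow> real" where nonneg: "\<forall>v\<in>length_dom n k. 0 \<le> h v"
    and proper: "proper_map (subtopology (powertop_real {..<2 * n + k}) (length_dom n k)) (top_of_set {0..}) h"
    and e: "\<forall>j<n. 1 \<le> e j" and fin: "\<forall>i<p. finite (G i) \<and> G i \<subseteq> {..<2 * n + k} \<rightarrow>\<^sub>E UNIV"
    and a: "\<forall>i<p. \<forall>T\<in>G i. 0 < a i T"
    and formula: "\<forall>v\<in>length_dom n k. cosh (h v / 2) = 1 / (\<Prod>j<n. sinh (v j / 2) ^ e j) *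
        (\<Sum>i<p. sqrt (\<Sum>T\<in>G i. a i T * exp (lin_form (2 * n + k) T v)))"
    using assms(2) unfolding length_type_def by (elim conjE exE) (rule that)
  note h0 = bspec[OF nonneg] and h = bspec[OF formula]
  \<comment> \<open>Empty sets \<open>G i\<close> contribute a square root of 0 and are dropped, so
    that every \<open>S i\<close> is positive and the softmax weights make sense.\<close>
  define I where "I = {i. i < p \<and> G i \<noteq> {}}"
  have "I \<noteq> {}"
  proof
    assume "I = {}"
    then have G: "G i = {}" if "i < p" for i using that by (auto simp: I_def)
    \<comment> \<open>Any point of the domain would do: an empty sum makes a hyperbolic cosine
      vanish there.\<close>
    define v :: "nat \<Rightarrow> real" where "v = restrict (\<lambda>j. 1) {..<2 * n + k}"
    have "v \<in> length_dom n k" by (auto simp: length_dom_def v_def)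
    from h[OF this] have "cosh (h v / 2) = 0" by (simp add: G)
    then show False using cosh_real_pos[of "h v / 2"] by linarith
  qed
  interpret length_form n k I G a e
    by unfold_locales (use assms(1) fin a e \<open>I \<noteq> {}\<close> in \<open>auto simp: I_def\<close>)
  have L_eq: "L v = lam (h v)" if v: "v \<in> D" for v
  proof -
    define Q where "Q = (\<Prod>j<n. sinh (v j / 2) ^ e j)"
    have sp: "0 < sinh (v j / 2)" if "j < n" for j using v that by (auto simp: length_dom_def)
    have Q: "0 < Q" unfolding Q_def by (intro prod_pos zero_less_power sp) simp
    have "(\<Sum>i<p. sqrt (\<Sum>T\<in>G i. a i T * exp (lin_form d T v))) = Z v"
      unfolding Z_def S_def by (rule sum.mono_neutral_right) (auto simp: I_def)
    then have c: "cosh (h v / 2) = Z v / Q" using h[OF v] by (simp add: Q_def)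
    then have Z: "0 < Z v" using Q cosh_real_pos[of "h v / 2"] by (simp add: zero_less_divide_iff)
    have "ln Q = (\<Sum>j<n. e j * ln (sinh (v j / 2)))"
      unfolding Q_def using sp by (subst ln_prod) (auto simp: ln_realpow dest: sp)
    then show ?thesis
      unfolding L_def lam_cosh c using Z Q by (simp add: ln_mult ln_div)
  qed
  \<comment> \<open>Properness makes the preimage of [0, R] under \<open>h\<close> compact, so each
    coordinate is bounded on it; \<open>lam t \<ge> t\<close> turns a bound on \<open>L\<close> into
    one on \<open>h\<close>.\<close>
  have bounded: "\<exists>B. \<forall>v\<in>D. L v \<le> R \<longrightarrow> (\<forall>j<d. \<bar>v j\<bar> \<le> B)" for R
  proof -
    define X where "X = subtopology (powertop_real {..<d}) D"
    have tX: "topspace X = D" by (auto simp: X_def length_dom_def topspace_product_topology)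
    have "compactin (top_of_set {0..}) {0..R}" by (auto simp: compactin_subtopology)
    define Y where "Y = {v \<in> D. h v \<in> {0..R}}"
    have comp: "compactin X Y"
      using compactin_proper_map_preimage[OF proper \<open>compactin _ {0..R}\<close>, folded X_def, unfolded tX] by (simp only: Y_def)
    have "\<exists>B. \<forall>v\<in>Y. \<bar>v j\<bar> \<le> B" if "j < d" for j
    proof -
      have "continuous_map X euclideanreal (\<lambda>v. v j)"
        unfolding X_def using that
        by (intro continuous_map_from_subtopology continuous_map_product_projection) auto
      from image_compactin[OF comp this] have "bounded ((\<lambda>v. v j) ` Y)" by (simp add: compact_imp_bounded)
      then show ?thesis by (simp add: bounded_iff)
    qed
    then have "\<forall>j. \<exists>B. j < d \<longrightarrow> (\<forall>v\<in>Y. \<bar>v j\<bar> \<le> B)" by blast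
    from choice[OF this] obtain B where B: "\<And>j v. j < d \<Longrightarrow> v \<in> Y \<Longrightarrow> \<bar>v j\<bar> \<le> B j" by blast
    have "\<bar>v j\<bar> \<le> (\<Sum>j<d. \<bar>B j\<bar>)" if v: "v \<in> D" "L v \<le> R" and j: "j < d" for v j
    proof -
      have "h v \<le> R" using v L_eq[OF v(1)] lam_ge[of "h v"] by linarith
      then have "\<bar>v j\<bar> \<le> \<bar>B j\<bar>" using B[OF j, of v] v h0[of v] by (simp add: Y_def)
      also have "\<dots> \<le> (\<Sum>j<d. \<bar>B j\<bar>)" using j by (intro member_le_sum) auto
      finally show ?thesis .
    qed
    then show ?thesis by blast
  qed
  obtain c where c: "0 < c" "\<And>v. v \<in> D \<Longrightarrow> c * (\<Sum>j<d. \<bar>v j\<bar>) \<le> Nmax v"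
    using growth_of_bounded_sublevels[OF bounded] by (elim exE conjE) blast
  have L0: "0 \<le> L v" if "v \<in> D" for v
    using lam_ge[of "h v"] h0[OF that] L_eq[OF that] by linarith
  interpret length_fun n k I G a e c h
    by unfold_locales (use c L0 L_eq h0 in auto)
  \<comment> \<open>The decay rate becomes the parameter of the class: times exp l, a remainder
    integrable against exp (\<epsilon> * l) has an integral over [0, m] of order exp ((1 -
    \<epsilon>) * m).\<close>
  obtain \<epsilon> where \<epsilon>: "good \<epsilon>" "\<epsilon> \<le> 1 / 2" using good_exists by blast
  have main: "\<exists>g\<in>SF_w ((\<Sum>i<d. K i) + 2 * n + k - 1) \<epsilon>.
      pseudo_conv_density d h (indicat_real D) (\<lambda>i x. poly (f i) (complex_of_real x)) g"
    if "\<forall>i<d. degree (f i) = K i" for f :: "nat \<Rightarrow> complex poly" and K :: "nat \<Rightarrow> nat"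
    using complex_density[OF \<epsilon>, of f "\<Sum>i<d. K i"] that by (simp add: add.assoc)
  have "0 < \<epsilon>" "\<epsilon> < 1" using \<epsilon> by (simp_all add: good_def)
  then show ?thesis by (intro exI[of _ \<epsilon>] conjI allI impI main) simp_all
qed

end
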